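(* Let $\lambda\in\mathbb R$, let $\mathbf F\subset\mathcal P_2(\mathsf{TX})$ be a $\lambda$-dissipative MPVF, and let $T,L>0$. Let $n\mapsto\tau(n)>0$ be a vanishing sequence of time steps, let $(\mu_{0,n})_{n\in\mathbb N}$ be a sequence in $\mathrm D(\mathbf F)$ converging to $\mu_0\in\overline{\mathrm D(\mathbf F)}$ in $\mathcal P_2(\mathsf X)$, and let $M_n\in\mathscr M(\mu_{0,n},\tau(n),T,L)$ for every $n$. Then $M_n$ converges uniformly on $[0,T]$ (with respect to $W_2$) to a limit curve $\mu\in\mathrm{Lip}([0,T];\overline{\mathrm D(\mathbf F)})$ which is a $\lambda$-EVI solution for $\mathbf F$ starting from $\mu_0$.
   Context: $\mathsf X$ is a separable real Hilbert space (possibly infinite dimensional) with norm $|\cdot|$. $\mathcal P_2(\mathsf X)$ is the set of Borel probability measures on $\mathsf X$ with finite second moment, endowed with the $L^2$-Wasserstein distance $W_2$. $\mathsf{TX}:=\mathsf X\times\mathsf X$ with points $(x,v)$; $\mathsf x(x,v):=x$, $\exp^t(x,v):=x+tv$. $\mathcal P_2(\mathsf{TX})$ is the set of Borel probability measures $\Phi$ on $\mathsf{TX}$ with $\int(|x|^2+|v|^2)\,d\Phi<\infty$, and $|\Phi|_2^2:=\int|v|^2\,d\Phi(x,v)$. Pairings: for $\Phi,\Psi\in\mathcal P_2(\mathsf{TX})$ and $\nu\in\mathcal P_2(\mathsf X)$ (the limits exist), $$[\Phi,\nu]_r:=\lim_{s\downarrow0}\frac{W_2^2(\exp^s_\sharp\Phi,\nu)-W_2^2(\mathsf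 x_\sharp\Phi,\nu)}{2s},\qquad [\Phi,\Psi]_r:=\lim_{s\downarrow0}\frac{W_2^2(\exp^s_\sharp\Phi,\exp^s_\sharp\Psi)-W_2^2(\mathsf x_\sharp\Phi,\mathsf x_\sharp\Psi)}{2s}.$$ A multivalued probability vector field (MPVF) is a nonempty subset $\mathbf F\subset\mathcal P_2(\mathsf{TX})$; $\mathrm D(\mathbf F):=\{\mathsf x_\sharp\Phi:\Phi\in\mathbf F\}$, $\mathbf F[\mu]:=\{\Phi\in\mathbf F:\mathsf x_\sharp\Phi=\mu\}$; $\overline{\mathrm D(\mathbf F)}$ is the closure in $(\mathcal P_2(\mathsf X),W_2)$. $\mathbf F$ is $\lambda$-dissipative if $[\Phi_0,\Phi_1]_r\le\lambda W_2^2(\mathsf x_\sharp\Phi_0,\mathsf x_\sharp\Phi_1)$ for all $\Phi_0,\Phi_1\in\mathbf F$. A $\lambda$-EVI solution for $\mathbf F$ on an interval $\mathcal I\subset\mathbb R$ is a continuous curve $\mu:\mathcal I\to\overline{\mathrm D(\mathbf F)}$ such that for every $\Phi\in\mathbf F$, with $\nu=\mathsf x_\sharp\Phi$, one has $\frac12\frac{d}{dt}W_2^2(\mu_t,\nu)\le\lambda W_2^2(\mu_t,\nu)-[\Phi,\mu_t]_r$ in the sense of distributions in the interior of $\mathcal I$. Explicit Euler scheme: given $\tau,T,L>0$ and $\mu^0\in\mathrm D(\mathbf F)$, put $N:=\lceil T/\tau\rceil$. An $L$-stable discrete solution consists of $M^n\in\mathrm D(\mathbf F)$, $0\le n\le N$,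 and $\Phi^n\in\mathbf F[M^n]$, $0\le n<N$, with $M^0=\mu^0$, $|\Phi^n|_2\le L$ and $M^{n+1}=\exp^\tau_\sharp\Phi^n$ for $0\le n<N$. Its affine interpolation is $M_\tau(t):=\exp^{t-n\tau}_\sharp\Phi^n$ for $t\in[n\tau,(n+1)\tau]\cap[0,T]$, $0\le n<N$. $\mathscr M(\mu^0,\tau,T,L)$ is the (possibly empty) set of all curves $M_\tau:[0,T]\to\mathcal P_2(\mathsf X)$ so obtained. *)

theory Defs
  imports "HOL-Probability.Probability"
begin

text \<open>
  The separable real Hilbert space is a type of sort \<open>{real_inner, polish_space}\<close>. The product
  type \<open>'a \<times> 'a\<close> carries the Hilbert norm with \<open>(norm (x, v))\<^sup>2 = (norm x)\<^sup>2 + (norm v)\<^sup>2\<close>, so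
  \<open>P2\<close> at that type is the set of plans on the tangent bundle with finite second moment. (The sort of \<open>P2\<close> omits completeness
  because the library does not make a product of two \<open>polish_space\<close> types a \<open>polish_space\<close>.)
\<close>

definition P2 :: "'a::{real_inner, second_countable_topology} measure set" where
  "P2 = {M. prob_space M \<and> sets M = sets borel \<and> integrable M (\<lambda>x. (norm x)\<^sup>2)}"

definition couplings :: "'a::{real_inner, polish_space} measure \<Rightarrow> 'a measure \<Rightarrow> ('a \<times> 'a) measure set" where
  "couplings \<mu> \<nu> = {\<gamma>. prob_space \<gamma> \<and> sets \<gamma> = sets borel \<and>
      distr \<gamma> borel fst = \<mu> \<and> distr \<gamma> borel snd = \<nu>}"

text \<open>The infimum is taken in \<open>ennreal\<close>; it is finite for \<open>\<mu>, \<nu> \<in> P2\<close>, the only arguments of interest.\<close>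

definition W2 :: "'a::{real_inner, polish_space} measure \<Rightarrow> 'a measure \<Rightarrow> real" where
  "W2 \<mu> \<nu> = sqrt (enn2real (INF \<gamma>\<in>couplings \<mu> \<nu>. \<integral>\<^sup>+ (x, y). ennreal ((norm (x - y))\<^sup>2) \<partial>\<gamma>))"

definition W2_closure :: "'a::{real_inner, polish_space} measure set \<Rightarrow> 'a measure set" where
  "W2_closure A = {\<mu> \<in> P2. \<forall>e>0. \<exists>\<nu>\<in>A. W2 \<mu> \<nu> < e}"

definition base :: "('a::{real_inner, polish_space} \<times> 'a) measure \<Rightarrow> 'a measure" where
  "base \<Phi> = distr \<Phi> borel fst"

definition exp_push :: "real \<Rightarrow> ('a::{real_inner, polish_space} \<times> 'a) measure \<Rightarrow> 'a measure" where
  "exp_push t \<Phi> = distr \<Phi> borel (\<lambda>(x, v). x + t *\<^sub>R v)"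

definition velocity_norm :: "('a::{real_inner, polish_space} \<times> 'a) measure \<Rightarrow> real" where
  "velocity_norm \<Phi> = sqrt (\<integral>(x, v). (norm v)\<^sup>2 \<partial>\<Phi>)"

definition pairing_meas :: "('a::{real_inner, polish_space} \<times> 'a) measure \<Rightarrow> 'a measure \<Rightarrow> real" where
  "pairing_meas \<Phi> \<nu> =
     Lim (at_right 0) (\<lambda>s. ((W2 (exp_push s \<Phi>) \<nu>)\<^sup>2 - (W2 (base \<Phi>) \<nu>)\<^sup>2) / (2 * s))"

definition pairing :: "('a::{real_inner, polish_space} \<times> 'a) measure \<Rightarrow> ('a \<times> 'a) measure \<Rightarrow> real" where
  "pairing \<Phi> \<Psi> =
     Lim (at_right 0) (\<lambda>s. ((W2 (exp_push s \<Phi>) (exp_push s \<Psi>))\<^sup>2 - (W2 (base \<Phi>) (base \<Psi>))\<^sup>2) / (2 * s))"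

definition MPVF :: "('a::{real_inner, polish_space} \<times> 'a) measure set \<Rightarrow> bool" where
  "MPVF F \<longleftrightarrow> F \<noteq> {} \<and> F \<subseteq> P2"

definition mpvf_dom :: "('a::{real_inner, polish_space} \<times> 'a) measure set \<Rightarrow> 'a measure set" where
  "mpvf_dom F = base ` F"

definition sections :: "('a::{real_inner, polish_space} \<times> 'a) measure set \<Rightarrow> 'a measure \<Rightarrow> ('a \<times> 'a) measure set" where
  "sections F \<mu> = {\<Phi> \<in> F. base \<Phi> = \<mu>}"

definition dissipative :: "real \<Rightarrow> ('a::{real_inner, polish_space} \<times> 'a) measure set \<Rightarrow> bool" where
  "dissipative lam F \<longleftrightarrow> (\<forall>\<Phi>\<^sub>0\<in>F. \<forall>\<Phi>\<^sub>1\<in>F. pairing \<Phi>\<^sub>0 \<Phi>\<^sub>1 \<le> lam * (W2 (base \<Phi>\<^sub>0) (base \<Phi>\<^sub>1))\<^sup>2)"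

definition locally_integrable :: "real set \<Rightarrow> (real \<Rightarrow> real) \<Rightarrow> bool" where
  "locally_integrable J f \<longleftrightarrow> (\<forall>K. compact K \<and> K \<subseteq> J \<longrightarrow> f absolutely_integrable_on K)"

definition test_function :: "real set \<Rightarrow> (real \<Rightarrow> real) \<Rightarrow> bool" where
  "test_function J \<phi> \<longleftrightarrow> (\<forall>k t. (deriv ^^ k) \<phi> differentiable (at t)) \<and>
     compact (closure {t. \<phi> t \<noteq> 0}) \<and> closure {t. \<phi> t \<noteq> 0} \<subseteq> J"

text \<open>
  \<open>d/dt u \<le> g\<close> as distributions on the open set \<open>J\<close>. Local integrability, needed for \<open>u\<close> and \<open>g\<close>
  to be distributions at all, is part of the definition.
\<close>

definition distr_deriv_le :: "real set \<Rightarrow> (real \<Rightarrow> real) \<Rightarrow> (real \<Rightarrow> real) \<Rightarrow> bool" where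
  "distr_deriv_le J u g \<longleftrightarrow> locally_integrable J u \<and> locally_integrable J g \<and>
     (\<forall>\<phi>. test_function J \<phi> \<and> (\<forall>t. 0 \<le> \<phi> t) \<longrightarrow>
        - (LINT t:J|lebesgue. u t * deriv \<phi> t) \<le> (LINT t:J|lebesgue. g t * \<phi> t))"

text \<open>Curves on an interval \<open>I\<close> are total functions whose values outside \<open>I\<close> are irrelevant.\<close>

definition W2_continuous_on :: "real set \<Rightarrow> (real \<Rightarrow> 'a::{real_inner, polish_space} measure) \<Rightarrow> bool" where
  "W2_continuous_on I \<mu> \<longleftrightarrow> (\<forall>t\<in>I. ((\<lambda>s. W2 (\<mu> s) (\<mu> t)) \<longlongrightarrow> 0) (at t within I))"

definition EVI_solution ::
  "real \<Rightarrow> ('a::{real_inner, polish_space} \<times> 'a) measure set \<Rightarrow> real set \<Rightarrow> (real \<Rightarrow> 'a measure) \<Rightarrow> bool" where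
  "EVI_solution lam F I \<mu> \<longleftrightarrow>
     is_interval I \<and> (\<forall>t\<in>I. \<mu> t \<in> W2_closure (mpvf_dom F)) \<and> W2_continuous_on I \<mu> \<and>
     (\<forall>\<Phi>\<in>F. distr_deriv_le (interior I)
        (\<lambda>t. 1 / 2 * (W2 (\<mu> t) (base \<Phi>))\<^sup>2)
        (\<lambda>t. lam * (W2 (\<mu> t) (base \<Phi>))\<^sup>2 - pairing_meas \<Phi> (\<mu> t)))"

definition W2_Lip :: "real set \<Rightarrow> 'a::{real_inner, polish_space} measure set \<Rightarrow> (real \<Rightarrow> 'a measure) set" where
  "W2_Lip I A = {\<mu>. (\<forall>t\<in>I. \<mu> t \<in> A) \<and>
     (\<exists>C\<ge>0. \<forall>s\<in>I. \<forall>t\<in>I. W2 (\<mu> s) (\<mu> t) \<le> C * \<bar>s - t\<bar>)}"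

definition Euler_steps :: "real \<Rightarrow> real \<Rightarrow> nat" where
  "Euler_steps \<tau> T = nat \<lceil>T / \<tau>\<rceil>"

definition stable_discrete_solution ::
  "('a::{real_inner, polish_space} \<times> 'a) measure set \<Rightarrow> 'a measure \<Rightarrow> real \<Rightarrow> real \<Rightarrow> real \<Rightarrow>
     (nat \<Rightarrow> 'a measure) \<Rightarrow> (nat \<Rightarrow> ('a \<times> 'a) measure) \<Rightarrow> bool" where
  "stable_discrete_solution F \<mu>0 \<tau> T L M \<Phi> \<longleftrightarrow>
     (\<forall>n\<le>Euler_steps \<tau> T. M n \<in> mpvf_dom F) \<and> M 0 = \<mu>0 \<and>
     (\<forall>n<Euler_steps \<tau> T. \<Phi> n \<in> sections F (M n) \<and> velocity_norm (\<Phi> n) \<le> L \<and>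
        M (Suc n) = exp_push \<tau> (\<Phi> n))"

definition Euler_curves ::
  "('a::{real_inner, polish_space} \<times> 'a) measure set \<Rightarrow> 'a measure \<Rightarrow> real \<Rightarrow> real \<Rightarrow> real \<Rightarrow>
     (real \<Rightarrow> 'a measure) set" where
  "Euler_curves F \<mu>0 \<tau> T L = {m. \<exists>M \<Phi>. stable_discrete_solution F \<mu>0 \<tau> T L M \<Phi> \<and>
     (\<forall>n<Euler_steps \<tau> T. \<forall>t \<in> {real n * \<tau> .. real (n + 1) * \<tau>} \<inter> {0..T}.
        m t = exp_push (t - real n * \<tau>) (\<Phi> n))}"

end

theory Submission
  imports Defs
begin

text \<open>
  Everything rests on one inequality. Write \<open>f(p, q) = W\<^sub>2\<^sup>2(exp\<^sup>p \<Phi>, exp\<^sup>q \<Psi>)\<close> for two plans \<open>\<Phi>, \<Psi>\<close>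
  of \<open>F\<close>. An almost optimal coupling of \<open>exp\<^sup>r \<Phi>\<close> and \<open>exp\<^sup>r \<Psi>\<close> lifts to a coupling of the two
  plans, and along the lift the cost is a quadratic polynomial that lies above \<open>f\<close> everywhere and
  (almost) touches it at \<open>(r, r)\<close>. Hence \<open>f\<close> is concave up to explicit quadratic terms: the
  pairings exist as limits of monotone quotients, and the slope of \<open>f\<close> at \<open>(0, 0)\<close> in the diagonal
  direction is at least the sum of the difference quotients in the two coordinate directions.
  Dissipativity bounds the diagonal slope, so (\<open>dissipative_split_inequality\<close>)
  \<open>(f(p, 0) - f(0, 0)) / p + (f(0, q) - f(0, 0)) / q \<le> 2 \<lambda> f(0, 0) + p |\<Phi>|\<^sup>2 + q |\<Psi>|\<^sup>2\<close>.

  Convergence. Take two Euler schemes with steps \<open>\<tau>, \<eta>\<close> and let \<open>a(i, j)\<close> be the squared distance of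
  the \<open>i\<close>-th node of the first from the \<open>j\<close>-th node of the second. The inequality with \<open>p = \<tau>\<close>,
  \<open>q = \<eta>\<close> says that a weighted mean of \<open>a(i+1, j)\<close> and \<open>a(i, j+1)\<close> hardly exceeds \<open>a(i, j)\<close>. The
  weights are the ones for which \<open>i \<tau> - j \<eta>\<close> is a martingale of small variance, so the same holds for
  \<open>a(i, j) + (i \<tau> - j \<eta>)\<^sup>2\<close>; always moving to the better neighbour therefore gives a path
  along which both the distance and the time lag stay small (\<open>greedy_lattice_path\<close>). So the
  interpolations are uniformly Cauchy, and the Wasserstein space is complete.

  EVI. With the fixed plan \<open>\<Phi>\<close>, \<open>p = s\<close>, and with \<open>q = \<tau>\<close> for the plan of one Euler step, the same inequality
  is a discrete form of the EVI in which \<open>[\<Phi>, \<cdot>]\<^sub>r\<close> is replaced by its difference quotient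
  at \<open>s\<close>. That quotient is continuous in the measure, so the step sizes may tend to zero with
  \<open>s\<close> fixed; dominated convergence as \<open>s \<down> 0\<close> restores the pairing.

  Gluing of couplings is needed for the lift, the triangle inequality and completeness. Instead of
  disintegrating measures, the shared marginal is cut into countably many cells of diameter less
  than \<open>\<epsilon>\<close> and the couplings are made conditionally independent given the cell. The middle variables then
  agree only up to \<open>\<epsilon>\<close>, which is harmless because couplings are only ever almost optimal.
\<close>



section \<open>Gluing along a countable partition\<close>

lemma small_cells:
  fixes e :: real
  assumes "e > 0"
  obtains J :: "'a::{metric_space, second_countable_topology} \<Rightarrow> nat"
  where "J \<in> measurable borel (count_space UNIV)" "\<And>x y. J x = J y \<Longrightarrow> dist x y < e"
proof -
  obtain D :: "'a set" where D: "countable D" "\<And>X. open X \<Longrightarrow> X \<noteq> {} \<Longrightarrow> \<exists>d\<in>D. d \<in> X"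
    using countable_dense_setE by blast
  have ne: "D \<noteq> {}" using D(2)[of UNIV] by auto
  define d where "d = from_nat_into D"
  define J where "J = (\<lambda>x. LEAST n. dist x (d n) < e / 2)"
  have ex: "\<exists>n. dist x (d n) < e / 2" for x
  proof -
    obtain y where y: "y \<in> D" "y \<in> ball x (e/2)"
      using D(2)[of "ball x (e/2)"] assms by fastforce
    from y(1) obtain n where "d n = y"
      unfolding d_def using from_nat_into_surj[OF D(1)] by blast
    with y(2) show ?thesis by auto
  qed
  have near: "dist x (d (J x)) < e / 2" for x
    unfolding J_def by (rule LeastI_ex[OF ex])
  show ?thesis
  proof
    show "J \<in> measurable borel (count_space UNIV)"
      unfolding J_def by measurable
    show "dist x y < e" if "J x = J y" for x y
      using near[of x] near[of y] that dist_triangle_half_l[of x "d (J x)" e y]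
      by (simp add: dist_commute)
  qed
qed

text \<open>
  The conditional law of \<open>\<beta>\<close> given \<open>J = j\<close>. On cells of measure zero the value \<open>\<beta>\<close> is a convention
  that makes it a probability measure for every \<open>j\<close>, hence a Markov kernel on a discrete space.
\<close>

definition cell_law :: "'b measure \<Rightarrow> ('b \<Rightarrow> nat) \<Rightarrow> nat \<Rightarrow> 'b measure" where
  "cell_law \<beta> J j = (if emeasure \<beta> {b\<in>space \<beta>. J b = j} = 0 then \<beta>
     else uniform_measure \<beta> {b\<in>space \<beta>. J b = j})"

lemma (in prob_space) prob_space_cell_law:
  "prob_space (cell_law M J j)"
  unfolding cell_law_def using prob_space_axioms
  by (auto intro!: prob_space_uniform_measure)

lemma sets_cell_law [measurable_cong, simp]: "sets (cell_law M J j) = sets M"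
  by (auto simp: cell_law_def)

lemma space_cell_law [simp]: "space (cell_law M J j) = space M"
  by (rule sets_eq_imp_space_eq) simp

lemma (in prob_space) cell_law_kernel:
  "cell_law M J \<in> measurable (count_space UNIV) (subprob_algebra M)"
  by (auto simp: space_subprob_algebra intro: prob_space_imp_subprob_space prob_space_cell_law)

lemma (in prob_space) AE_cell_law:
  assumes [measurable]: "J \<in> measurable M (count_space UNIV)"
    and "emeasure M {b\<in>space M. J b = j} \<noteq> 0"
  shows "AE b in cell_law M J j. J b = j"
proof -
  have "AE b in uniform_measure M {b\<in>space M. J b = j}. J b = j"
    using assms(2) by (intro AE_uniform_measureI) auto
  then show ?thesis unfolding cell_law_def if_not_P[OF assms(2)] .
qed

lemma (in prob_space) nn_integral_discrete:
  fixes h :: "nat \<Rightarrow> ennreal"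
  assumes [measurable]: "J \<in> measurable M (count_space UNIV)"
  shows "(\<integral>\<^sup>+b. h (J b) \<partial>M) = (\<Sum>j. h j * emeasure M {b\<in>space M. J b = j})"
proof -
  have "h (J b) = (\<Sum>j. h j * indicator {b\<in>space M. J b = j} b)" if "b \<in> space M" for b
  proof -
    have "(\<Sum>j. h j * indicator {b\<in>space M. J b = j} b) = (\<Sum>j\<in>{J b}. h j * indicator {b\<in>space M. J b = j} b)"
      by (rule suminf_finite) (auto simp: indicator_def)
    then show ?thesis using that by simp
  qed
  then have "(\<integral>\<^sup>+b. h (J b) \<partial>M) = (\<integral>\<^sup>+b. (\<Sum>j. h j * indicator {b\<in>space M. J b = j} b) \<partial>M)"
    by (intro nn_integral_cong) auto
  also have "\<dots> = (\<Sum>j. h j * emeasure M {b\<in>space M. J b = j})"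
    by (subst nn_integral_suminf) (auto simp: nn_integral_cmult_indicator)
  finally show ?thesis .
qed

lemma (in prob_space) cell_law_mixture:
  assumes [measurable]: "J \<in> measurable M (count_space UNIV)" and A: "A \<in> sets M"
  shows "(\<integral>\<^sup>+b. emeasure (cell_law M J (J b)) A \<partial>M) = emeasure M A"
proof -
  note A[measurable]
  have *: "emeasure (cell_law M J j) A * emeasure M {b\<in>space M. J b = j}
      = emeasure M {b\<in>A. J b = j}" for j
  proof (cases "emeasure M {b\<in>space M. J b = j} = 0")
    case True
    have "emeasure M {b\<in>A. J b = j} \<le> emeasure M {b\<in>space M. J b = j}"
      using sets.sets_into_space[OF A] by (intro emeasure_mono) auto
    with True show ?thesis by simp
  next
    case False
    have "{b\<in>space M. J b = j} \<inter> A = {b\<in>A. J b = j}"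
      using sets.sets_into_space[OF A] by auto
    with False show ?thesis
      by (simp add: cell_law_def emeasure_uniform_measure emeasure_eq_measure ennreal_divide_times
          ennreal_mult_divide_eq)
  qed
  have "(\<integral>\<^sup>+b. emeasure (cell_law M J (J b)) A \<partial>M) = (\<Sum>j. emeasure M {b\<in>A. J b = j})"
    by (subst nn_integral_discrete) (auto simp: *)
  also have "\<dots> = emeasure M (\<Union>j. {b\<in>A. J b = j})"
  proof (rule suminf_emeasure)
    have "{b\<in>A. J b = j} = A \<inter> {b\<in>space M. J b = j}" for j
      using sets.sets_into_space[OF A] by auto
    then show "range (\<lambda>j. {b\<in>A. J b = j}) \<subseteq> sets M" by auto
  qed (auto simp: disjoint_family_on_def)
  also have "(\<Union>j. {b\<in>A. J b = j}) = A" by auto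
  finally show ?thesis .
qed

text \<open>
  Only the discrete law of the cell index enters when \<open>b\<close> is drawn from the cell prescribed by \<open>a\<close>.
  Since \<open>I\<close> and \<open>J\<close> have the same law, \<open>(\<alpha>, I)\<close> can be replaced by \<open>(\<beta>, J)\<close>, and the claim becomes the law of
  total probability for \<open>\<beta>\<close>.
\<close>

lemma cell_law_bind:
  assumes a: "prob_space \<alpha>" and b: "prob_space \<beta>"
    and [measurable]: "I \<in> measurable \<alpha> (count_space UNIV)" "J \<in> measurable \<beta> (count_space UNIV)"
    and eq: "distr \<alpha> (count_space UNIV) I = distr \<beta> (count_space UNIV) J"
  shows "\<alpha> \<bind> (\<lambda>a. cell_law \<beta> J (I a)) = \<beta>" (is ?A)
    and "AE a in \<alpha>. AE b in cell_law \<beta> J (I a). J b = I a" (is ?B)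
proof -
  interpret a: prob_space \<alpha> by fact
  interpret b: prob_space \<beta> by fact
  note b.cell_law_kernel[measurable]
  have k[measurable]: "(\<lambda>a. cell_law \<beta> J (I a)) \<in> measurable \<alpha> (subprob_algebra \<beta>)"
    by measurable
  show ?A
  proof (rule measure_eqI)
    show s: "sets (\<alpha> \<bind> (\<lambda>a. cell_law \<beta> J (I a))) = sets \<beta>"
      using a.not_empty by (subst sets_bind) auto
    fix A assume "A \<in> sets (\<alpha> \<bind> (\<lambda>a. cell_law \<beta> J (I a)))"
    then have A[measurable]: "A \<in> sets \<beta>" by (simp add: s)
    have "emeasure (\<alpha> \<bind> (\<lambda>a. cell_law \<beta> J (I a))) A = (\<integral>\<^sup>+a. emeasure (cell_law \<beta> J (I a)) A \<partial>\<alpha>)"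
      by (rule emeasure_bind[OF a.not_empty k A])
    also have "\<dots> = (\<integral>\<^sup>+i. emeasure (cell_law \<beta> J i) A \<partial>distr \<alpha> (count_space UNIV) I)"
      by (subst nn_integral_distr) auto
    also have "\<dots> = (\<integral>\<^sup>+b. emeasure (cell_law \<beta> J (J b)) A \<partial>\<beta>)"
      unfolding eq by (subst nn_integral_distr) auto
    also have "\<dots> = emeasure \<beta> A" by (rule b.cell_law_mixture) auto
    finally show "emeasure (\<alpha> \<bind> (\<lambda>a. cell_law \<beta> J (I a))) A = emeasure \<beta> A" .
  qed
  \<comment> \<open>almost surely the index falls into a cell of positive measure, where \<open>cell_law\<close> is the conditional law\<close>
  have "AE i in distr \<beta> (count_space UNIV) J. emeasure \<beta> {b\<in>space \<beta>. J b = i} \<noteq> 0"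
  proof -
    have "emeasure \<beta> {x\<in>space \<beta>. emeasure \<beta> {b\<in>space \<beta>. J b = J x} = 0} 
      \<le> emeasure \<beta> (\<Union>i\<in>{i. emeasure \<beta> {b\<in>space \<beta>. J b = i} = 0}. {b\<in>space \<beta>. J b = i})"
      by (intro emeasure_mono) auto
    also have "\<dots> = 0"
    proof -
      have "(\<Union>i\<in>{i. emeasure \<beta> {b\<in>space \<beta>. J b = i} = 0}. {b\<in>space \<beta>. J b = i}) \<in> null_sets \<beta>"
        by (intro null_sets_UN') (auto simp: null_sets_def)
      then show ?thesis by auto
    qed
    finally have "AE b in \<beta>. emeasure \<beta> {b'\<in>space \<beta>. J b' = J b} \<noteq> 0"
      by (intro AE_I[where N="{x\<in>space \<beta>. emeasure \<beta> {b\<in>space \<beta>. J b = J x} = 0}"]) auto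
    then show ?thesis by (subst AE_distr_iff) auto
  qed
  then have "AE a in \<alpha>. emeasure \<beta> {b\<in>space \<beta>. J b = I a} \<noteq> 0"
    unfolding eq[symmetric] by (subst (asm) AE_distr_iff) auto
  then show ?B
    by (auto elim!: eventually_mono intro!: b.AE_cell_law)
qed

text \<open>
  Draw \<open>a\<close> from \<open>\<alpha>\<close> and then \<open>b\<close> from \<open>\<beta>\<close> conditioned on \<open>g b\<close> lying in the same small cell as \<open>f a\<close>.
  This takes the place of the exact gluing lemma.
\<close>

lemma approximate_gluing:
  fixes f :: "'b \<Rightarrow> 'a::{metric_space, second_countable_topology}" and g :: "'c \<Rightarrow> 'a"
  assumes a: "prob_space \<alpha>" and b: "prob_space \<beta>"
    and [measurable]: "f \<in> borel_measurable \<alpha>" "g \<in> borel_measurable \<beta>"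
    and eq: "distr \<alpha> borel f = distr \<beta> borel g" and e: "e > 0"
  obtains \<pi> where "prob_space \<pi>" "sets \<pi> = sets (\<alpha> \<Otimes>\<^sub>M \<beta>)"
    "distr \<pi> \<alpha> fst = \<alpha>" "distr \<pi> \<beta> snd = \<beta>" "AE z in \<pi>. dist (f (fst z)) (g (snd z)) < e"
proof -
  interpret a: prob_space \<alpha> by fact
  interpret b: prob_space \<beta> by fact
  obtain J :: "'a \<Rightarrow> nat" where J[measurable]: "J \<in> measurable borel (count_space UNIV)"
    and Je: "\<And>x y. J x = J y \<Longrightarrow> dist x y < e" using small_cells[OF e] by blast
  have eq': "distr \<alpha> (count_space UNIV) (\<lambda>a. J (f a)) = distr \<beta> (count_space UNIV) (\<lambda>b. J (g b))"
    using arg_cong[OF eq, of "\<lambda>\<rho>. distr \<rho> (count_space UNIV) J"] by (simp add: distr_distr comp_def)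
  define K where "K = (\<lambda>a. cell_law \<beta> (\<lambda>b. J (g b)) (J (f a)))"
  note kb = cell_law_bind[OF a b _ _ eq', folded K_def, simplified]
  note b.cell_law_kernel[measurable]
  have K[measurable]: "K \<in> measurable \<alpha> (subprob_algebra \<beta>)" unfolding K_def by measurable
  have pK: "prob_space (K a)" for a unfolding K_def by (rule b.prob_space_cell_law)
  have sK[measurable_cong, simp]: "sets (K a) = sets \<beta>" for a unfolding K_def by simp
  have spK[simp]: "space (K a) = space \<beta>" for a unfolding K_def by simp
  define H where "H = (\<lambda>a. distr (K a) (\<alpha> \<Otimes>\<^sub>M \<beta>) (\<lambda>b. (a, b)))"
  have H[measurable]: "H \<in> measurable \<alpha> (subprob_algebra (\<alpha> \<Otimes>\<^sub>M \<beta>))"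
    unfolding H_def by (rule measurable_distr2[OF _ K]) simp
  have pH: "prob_space (H a)" if "a \<in> space \<alpha>" for a
    unfolding H_def using that by (intro prob_space.prob_space_distr[OF pK]) simp
  define \<pi> where "\<pi> = \<alpha> \<bind> H"
  have s: "sets \<pi> = sets (\<alpha> \<Otimes>\<^sub>M \<beta>)"
    unfolding \<pi>_def by (rule sets_bind) (auto simp: H_def a.not_empty)
  note s[measurable_cong]
  have fst': "distr (H a) \<alpha> fst = return \<alpha> a" if "a \<in> space \<alpha>" for a
  proof -
    interpret prob_space "K a" by (rule pK)
    have "distr (H a) \<alpha> fst = distr (K a) \<alpha> (\<lambda>b. a)"
      unfolding H_def using that by (subst distr_distr) (auto simp: comp_def)
    also have "\<dots> = return \<alpha> a"
      by (rule measure_eqI) (use that in \<open>auto simp: emeasure_distr emeasure_space_1[simplified] indicator_def\<close>)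
    finally show ?thesis .
  qed
  have snd': "distr (H a) \<beta> snd = K a" if "a \<in> space \<alpha>" for a
    unfolding H_def using that by (subst distr_distr) (auto simp: comp_def intro: distr_id2)
  show ?thesis
  proof
    show "prob_space \<pi>" unfolding \<pi>_def
      by (rule a.prob_space_bind[OF _ H]) (auto simp: pH)
    show "sets \<pi> = sets (\<alpha> \<Otimes>\<^sub>M \<beta>)" by (rule s)
    have "distr \<pi> \<alpha> fst = \<alpha> \<bind> (\<lambda>a. distr (H a) \<alpha> fst)"
      unfolding \<pi>_def by (rule distr_bind[OF H a.not_empty]) simp
    also have "\<dots> = \<alpha> \<bind> return \<alpha>"
      by (rule bind_cong) (auto simp: fst')
    also have "\<dots> = \<alpha>" by (rule bind_return'') simp
    finally show "distr \<pi> \<alpha> fst = \<alpha>" .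
    have "distr \<pi> \<beta> snd = \<alpha> \<bind> (\<lambda>a. distr (H a) \<beta> snd)"
      unfolding \<pi>_def by (rule distr_bind[OF H a.not_empty]) simp
    also have "\<dots> = \<alpha> \<bind> K"
      by (rule bind_cong) (auto simp: snd')
    also have "\<dots> = \<beta>" by (rule kb)
    finally show "distr \<pi> \<beta> snd = \<beta>" .
    have "AE a in \<alpha>. AE z in H a. dist (f (fst z)) (g (snd z)) < e"
      using kb(2) AE_space
    proof eventually_elim
      case (elim a)
      then have "AE b in K a. dist (f a) (g b) < e"
        unfolding K_def by (auto intro: Je elim!: eventually_mono)
      with elim show ?case unfolding H_def
        by (subst AE_distr_iff) auto
    qed
    then show "AE z in \<pi>. dist (f (fst z)) (g (snd z)) < e"
      unfolding \<pi>_def by (subst AE_bind[OF H]) auto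
  qed
qed


section \<open>The Wasserstein distance\<close>

text \<open>
  The bound \<open>\<parallel>f\<parallel> \<le> |c|\<close> in \<open>L\<^sup>2(P)\<close>, stated with the extended integral so that it carries its own
  integrability.
\<close>

definition L2_bound :: "'b measure \<Rightarrow> ('b \<Rightarrow> real) \<Rightarrow> real \<Rightarrow> bool" where
  "L2_bound P f c \<longleftrightarrow> (\<integral>\<^sup>+\<omega>. ennreal ((f \<omega>)\<^sup>2) \<partial>P) \<le> ennreal (c\<^sup>2)"

text \<open>
  Minkowski's inequality: with the \<open>L\<^sup>2\<close> bounds \<open>a, b\<close> as weights, the pointwise estimate
  \<open>(x + y)\<^sup>2 \<le> (1 + b/a) x\<^sup>2 + (1 + a/b) y\<^sup>2\<close> integrates to exactly \<open>(a + b)\<^sup>2\<close>.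
\<close>

lemma L2_bound_add:
  assumes f [measurable]: "f \<in> borel_measurable P" and g [measurable]: "g \<in> borel_measurable P"
    and "L2_bound P f a" "L2_bound P g b" and ab: "a > 0" "b > 0"
  shows "L2_bound P (\<lambda>\<omega>. f \<omega> + g \<omega>) (a + b)"
proof -
  define p where "p = 1 + b / a"
  define q where "q = 1 + a / b"
  have pq: "p \<ge> 0" "q \<ge> 0" using ab by (auto simp: p_def q_def)
  have pw: "(x + y)\<^sup>2 \<le> p * x\<^sup>2 + q * y\<^sup>2" for x y :: real
  proof -
    have "0 \<le> (b * x - a * y)\<^sup>2 / (a * b)" using ab by simp
    also have "\<dots> = p * x\<^sup>2 + q * y\<^sup>2 - (x + y)\<^sup>2"
      using ab unfolding p_def q_def by (simp add: divide_simps) (simp add: power2_eq_square algebra_simps)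
    finally show ?thesis by simp
  qed
  have split: "ennreal (p * x + q * y) = ennreal p * ennreal x + ennreal q * ennreal y"
    if "x \<ge> 0" "y \<ge> 0" for x y
    using that pq by (simp only: ennreal_plus mult_nonneg_nonneg ennreal_mult)
  have "(\<integral>\<^sup>+\<omega>. ennreal ((f \<omega> + g \<omega>)\<^sup>2) \<partial>P)
     \<le> (\<integral>\<^sup>+\<omega>. ennreal p * ennreal ((f \<omega>)\<^sup>2) + ennreal q * ennreal ((g \<omega>)\<^sup>2) \<partial>P)"
    by (intro nn_integral_mono) (simp only: split[symmetric] zero_le_power2 ennreal_leI pw)
  also have "\<dots> = ennreal p * (\<integral>\<^sup>+\<omega>. ennreal ((f \<omega>)\<^sup>2) \<partial>P)
      + ennreal q * (\<integral>\<^sup>+\<omega>. ennreal ((g \<omega>)\<^sup>2) \<partial>P)"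
    by (simp add: nn_integral_add nn_integral_cmult)
  also have "\<dots> \<le> ennreal p * ennreal (a\<^sup>2) + ennreal q * ennreal (b\<^sup>2)"
    using assms(3,4) unfolding L2_bound_def by (intro add_mono mult_left_mono) auto
  also have "\<dots> = ennreal (p * a\<^sup>2 + q * b\<^sup>2)"
    by (simp only: split zero_le_power2)
  also have "p * a\<^sup>2 + q * b\<^sup>2 = (a + b)\<^sup>2"
    using ab by (simp add: p_def q_def field_simps power2_eq_square)
  finally show ?thesis unfolding L2_bound_def .
qed

lemma L2_bound_mono:
  assumes "L2_bound P g c" "AE \<omega> in P. \<bar>f \<omega>\<bar> \<le> \<bar>g \<omega>\<bar>"
  shows "L2_bound P f c"
proof -
  have "(\<integral>\<^sup>+\<omega>. ennreal ((f \<omega>)\<^sup>2) \<partial>P) \<le> (\<integral>\<^sup>+\<omega>. ennreal ((g \<omega>)\<^sup>2) \<partial>P)"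
    using assms(2) by (intro nn_integral_mono_AE) (auto elim!: eventually_mono intro!: ennreal_leI simp: abs_le_square_iff)
  with assms(1) show ?thesis unfolding L2_bound_def by simp
qed

lemma L2_bound_distr:
  assumes [measurable]: "X \<in> measurable P Q" "f \<in> borel_measurable Q"
  shows "L2_bound (distr P Q X) f c \<longleftrightarrow> L2_bound P (\<lambda>\<omega>. f (X \<omega>)) c"
  unfolding L2_bound_def by (subst nn_integral_distr) auto

lemma (in prob_space) L2_bound_const: "L2_bound M (\<lambda>_. c) c"
  unfolding L2_bound_def by (simp add: emeasure_space_1)

lemma L2_bound_integrable:
  assumes [measurable]: "f \<in> borel_measurable P" and "L2_bound P f c"
  shows "integrable P (\<lambda>\<omega>. (f \<omega>)\<^sup>2)" and "(\<integral>\<omega>. (f \<omega>)\<^sup>2 \<partial>P) \<le> c\<^sup>2"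
proof -
  show i: "integrable P (\<lambda>\<omega>. (f \<omega>)\<^sup>2)"
    using le_less_trans[OF assms(2)[unfolded L2_bound_def] ennreal_less_top]
    by (intro integrableI_nonneg) auto
  show "(\<integral>\<omega>. (f \<omega>)\<^sup>2 \<partial>P) \<le> c\<^sup>2"
    using assms(2) unfolding L2_bound_def
    by (subst (asm) nn_integral_eq_integral[OF i]) auto
qed

lemma integrable_L2_bound:
  assumes "integrable P (\<lambda>\<omega>. (f \<omega>)\<^sup>2)" "(\<integral>\<omega>. (f \<omega>)\<^sup>2 \<partial>P) \<le> c\<^sup>2"
  shows "L2_bound P f c"
  unfolding L2_bound_def using assms by (subst nn_integral_eq_integral) (auto intro!: ennreal_leI)

lemma integrable_power2_add:
  fixes X Y :: "'b \<Rightarrow> 'a::{real_inner, second_countable_topology}"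
  assumes X: "X \<in> borel_measurable P" "integrable P (\<lambda>\<omega>. (norm (X \<omega>))\<^sup>2)"
    and Y: "Y \<in> borel_measurable P" "integrable P (\<lambda>\<omega>. (norm (Y \<omega>))\<^sup>2)"
  shows "integrable P (\<lambda>\<omega>. (norm (X \<omega> + Y \<omega>))\<^sup>2)"
proof (rule Bochner_Integration.integrable_bound)
  note X(1)[measurable] Y(1)[measurable]
  show "integrable P (\<lambda>\<omega>. 2 * (norm (X \<omega>))\<^sup>2 + 2 * (norm (Y \<omega>))\<^sup>2)"
    using X Y by auto
  show "(\<lambda>\<omega>. (norm (X \<omega> + Y \<omega>))\<^sup>2) \<in> borel_measurable P" by measurable
  have "(norm (x + y))\<^sup>2 \<le> 2 * (norm x)\<^sup>2 + 2 * (norm y)\<^sup>2" for x y :: 'a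
  proof -
    have "(norm (x + y))\<^sup>2 + (norm (x - y))\<^sup>2 = 2 * (norm x)\<^sup>2 + 2 * (norm y)\<^sup>2"
      by (simp add: power2_norm_eq_inner algebra_simps inner_commute)
    then show ?thesis using zero_le_power2[of "norm (x - y)"] by linarith
  qed
  then show "AE \<omega> in P. norm ((norm (X \<omega> + Y \<omega>))\<^sup>2) \<le> norm (2 * (norm (X \<omega>))\<^sup>2 + 2 * (norm (Y \<omega>))\<^sup>2)"
    by auto
qed

lemma integrable_power2_scaleR:
  fixes X :: "'b \<Rightarrow> 'a::real_inner"
  assumes "integrable P (\<lambda>\<omega>. (norm (X \<omega>))\<^sup>2)"
  shows "integrable P (\<lambda>\<omega>. (norm (r *\<^sub>R X \<omega>))\<^sup>2)"
  using assms by (simp add: power_mult_distrib)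

lemma integrable_power2_diff:
  fixes X Y :: "'b \<Rightarrow> 'a::{real_inner, second_countable_topology}"
  assumes X: "X \<in> borel_measurable P" "integrable P (\<lambda>\<omega>. (norm (X \<omega>))\<^sup>2)"
    and Y: "Y \<in> borel_measurable P" "integrable P (\<lambda>\<omega>. (norm (Y \<omega>))\<^sup>2)"
  shows "integrable P (\<lambda>\<omega>. (norm (X \<omega> - Y \<omega>))\<^sup>2)"
  using integrable_power2_add[OF X, of "\<lambda>\<omega>. - Y \<omega>"] Y by simp

lemma P2_prob_space: "\<mu> \<in> P2 \<Longrightarrow> prob_space \<mu>"
  and P2_sets: "\<mu> \<in> P2 \<Longrightarrow> sets \<mu> = sets borel"
  and P2_integrable: "\<mu> \<in> P2 \<Longrightarrow> integrable \<mu> (\<lambda>x. (norm x)\<^sup>2)"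
  by (auto simp: P2_def)

lemma distr_in_P2_iff:
  fixes X :: "'b \<Rightarrow> 'a::{real_inner, second_countable_topology}"
  assumes "prob_space P" and [measurable]: "X \<in> borel_measurable P"
  shows "distr P borel X \<in> P2 \<longleftrightarrow> integrable P (\<lambda>\<omega>. (norm (X \<omega>))\<^sup>2)"
  using assms by (auto simp: P2_def integrable_distr_eq prob_space.prob_space_distr)

lemma W2_nonneg [simp]: "W2 \<mu> \<nu> \<ge> 0"
  by (simp add: W2_def)

text \<open>
  Couplings are usually met as pairs of random variables on some other space; their joint law is
  the competitor.
\<close>

lemma W2_le_L2_bound:
  fixes X Y :: "'b \<Rightarrow> 'a::{real_inner, polish_space}"
  assumes P: "prob_space P" and [measurable]: "X \<in> borel_measurable P" "Y \<in> borel_measurable P"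
    and b: "L2_bound P (\<lambda>\<omega>. norm (X \<omega> - Y \<omega>)) c" and c: "c \<ge> 0"
    and XY: "distr P borel X = \<mu>" "distr P borel Y = \<nu>"
  shows "W2 \<mu> \<nu> \<le> c"
proof -
  define \<gamma> where "\<gamma> = distr P borel (\<lambda>\<omega>. (X \<omega>, Y \<omega>))"
  have [measurable]: "(\<lambda>\<omega>. (X \<omega>, Y \<omega>)) \<in> measurable P borel"
    unfolding borel_prod[symmetric] by simp
  have m: "(\<lambda>z::'a\<times>'a. (norm (fst z - snd z))\<^sup>2) \<in> borel_measurable borel"
    unfolding borel_prod[symmetric] by measurable
  have fs: "fst \<in> borel_measurable (borel::('a\<times>'a) measure)" "snd \<in> borel_measurable (borel::('a\<times>'a) measure)"
    unfolding borel_prod[symmetric] by measurable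
  have "\<gamma> \<in> couplings \<mu> \<nu>"
    unfolding couplings_def \<gamma>_def using P XY fs
    by (auto intro: prob_space.prob_space_distr simp: distr_distr comp_def)
  then have "(INF \<gamma>\<in>couplings \<mu> \<nu>. \<integral>\<^sup>+ (x, y). ennreal ((norm (x - y))\<^sup>2) \<partial>\<gamma>)
     \<le> (\<integral>\<^sup>+ (x, y). ennreal ((norm (x - y))\<^sup>2) \<partial>\<gamma>)"
    by (rule INF_lower)
  also have "\<dots> = (\<integral>\<^sup>+\<omega>. ennreal ((norm (X \<omega> - Y \<omega>))\<^sup>2) \<partial>P)"
    unfolding \<gamma>_def case_prod_beta using m by (subst nn_integral_distr) auto
  also have "\<dots> \<le> ennreal (c\<^sup>2)" using b by (simp add: L2_bound_def)
  finally have "enn2real (INF \<gamma>\<in>couplings \<mu> \<nu>. \<integral>\<^sup>+ (x, y). ennreal ((norm (x - y))\<^sup>2) \<partial>\<gamma>) \<le> c\<^sup>2"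
    by (auto intro: enn2real_leI)
  then show ?thesis unfolding W2_def using c by (simp add: real_le_lsqrt)
qed

lemma W2_power2_le_integral:
  fixes X Y :: "'b \<Rightarrow> 'a::{real_inner, polish_space}"
  assumes P: "prob_space P" and m: "X \<in> borel_measurable P" "Y \<in> borel_measurable P"
    and i: "integrable P (\<lambda>\<omega>. (norm (X \<omega> - Y \<omega>))\<^sup>2)"
    and XY: "distr P borel X = \<mu>" "distr P borel Y = \<nu>"
  shows "(W2 \<mu> \<nu>)\<^sup>2 \<le> (\<integral>\<omega>. (norm (X \<omega> - Y \<omega>))\<^sup>2 \<partial>P)"
proof -
  let ?c = "sqrt (\<integral>\<omega>. (norm (X \<omega> - Y \<omega>))\<^sup>2 \<partial>P)"
  have c: "?c\<^sup>2 = (\<integral>\<omega>. (norm (X \<omega> - Y \<omega>))\<^sup>2 \<partial>P)" by simp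
  have "W2 \<mu> \<nu> \<le> ?c"
    by (rule W2_le_L2_bound[OF P m integrable_L2_bound[OF i] _ XY]) auto
  then have "(W2 \<mu> \<nu>)\<^sup>2 \<le> ?c\<^sup>2" by (intro power_mono) auto
  then show ?thesis by simp
qed

text \<open>
  The product measure has finite cost, so the infimum in the definition of \<open>W2\<close> is finite and the
  conversion from the extended reals loses nothing.
\<close>

lemma near_optimal_coupling:
  fixes \<mu> \<nu> :: "'a::{real_inner, polish_space} measure"
  assumes \<mu>: "\<mu> \<in> P2" and \<nu>: "\<nu> \<in> P2" and c: "W2 \<mu> \<nu> < c"
  obtains \<gamma> where "prob_space \<gamma>" "sets \<gamma> = sets borel" "distr \<gamma> borel fst = \<mu>" "distr \<gamma> borel snd = \<nu>"
    "L2_bound \<gamma> (\<lambda>z. norm (fst z - snd z)) c"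
proof -
  let ?C = "\<lambda>\<gamma>. \<integral>\<^sup>+ (x, y). ennreal ((norm (x - y :: 'a))\<^sup>2) \<partial>\<gamma>"
  let ?I = "INF \<gamma>\<in>couplings \<mu> \<nu>. ?C \<gamma>"
  interpret \<mu>: prob_space \<mu> using \<mu> by (rule P2_prob_space)
  interpret \<nu>: prob_space \<nu> using \<nu> by (rule P2_prob_space)
  interpret pair_prob_space \<mu> \<nu> ..
  note [measurable_cong] = P2_sets[OF \<mu>] P2_sets[OF \<nu>]
  have s: "sets (\<mu> \<Otimes>\<^sub>M \<nu>) = sets borel"
    unfolding borel_prod[symmetric] using P2_sets[OF \<mu>] P2_sets[OF \<nu>] by (rule sets_pair_measure_cong)
  have "distr (\<mu> \<Otimes>\<^sub>M \<nu>) borel fst = distr (\<mu> \<Otimes>\<^sub>M \<nu>) \<mu> fst"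
    by (rule distr_cong) (simp_all add: P2_sets[OF \<mu>])
  also have "\<dots> = \<mu>" by (rule \<nu>.distr_pair_fst)
  finally have d1: "distr (\<mu> \<Otimes>\<^sub>M \<nu>) borel fst = \<mu>" .
  have d2: "distr (\<mu> \<Otimes>\<^sub>M \<nu>) borel snd = \<nu>"
  proof (rule measure_eqI)
    fix A assume "A \<in> sets (distr (\<mu> \<Otimes>\<^sub>M \<nu>) borel snd)"
    then have A: "A \<in> sets \<nu>" by (simp add: P2_sets[OF \<nu>])
    have "snd -` A \<inter> space (\<mu> \<Otimes>\<^sub>M \<nu>) = space \<mu> \<times> A"
      using sets.sets_into_space[OF A] by (auto simp: space_pair_measure)
    then show "emeasure (distr (\<mu> \<Otimes>\<^sub>M \<nu>) borel snd) A = emeasure \<nu> A"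
      using A by (simp add: emeasure_distr P2_sets[OF \<nu>] \<nu>.emeasure_pair_measure_Times \<mu>.emeasure_space_1)
  qed (simp add: P2_sets[OF \<nu>])
  have "\<mu> \<Otimes>\<^sub>M \<nu> \<in> couplings \<mu> \<nu>"
    unfolding couplings_def using s d1 d2 prob_space_axioms by auto
  then have "?I \<le> ?C (\<mu> \<Otimes>\<^sub>M \<nu>)" by (rule INF_lower)
  also have "\<dots> < \<infinity>"
  proof -
    have "integrable (\<mu> \<Otimes>\<^sub>M \<nu>) (\<lambda>z. (norm (fst z - snd z))\<^sup>2)"
    proof (rule integrable_power2_diff)
      show "integrable (\<mu> \<Otimes>\<^sub>M \<nu>) (\<lambda>z. (norm (fst z))\<^sup>2)"
        using \<mu> distr_in_P2_iff[OF prob_space_axioms, of fst, unfolded d1] by simp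
      show "integrable (\<mu> \<Otimes>\<^sub>M \<nu>) (\<lambda>z. (norm (snd z))\<^sup>2)"
        using \<nu> distr_in_P2_iff[OF prob_space_axioms, of snd, unfolded d2] by simp
    qed auto
    then show ?thesis
      unfolding case_prod_beta by (subst nn_integral_eq_integral) auto
  qed
  finally have fin: "?I < \<infinity>" .
  have "?I = ennreal (enn2real ?I)" using fin by (intro ennreal_enn2real[symmetric]) simp
  also have "enn2real ?I = (W2 \<mu> \<nu>)\<^sup>2"
    unfolding W2_def by (rule real_sqrt_pow2[symmetric]) (rule enn2real_nonneg)
  also have "ennreal ((W2 \<mu> \<nu>)\<^sup>2) < ennreal (c\<^sup>2)"
  proof (rule ennreal_lessI)
    show "(W2 \<mu> \<nu>)\<^sup>2 < c\<^sup>2" using c by (intro power_strict_mono) auto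
    show "0 < c\<^sup>2" using le_less_trans[OF W2_nonneg c] by simp
  qed
  finally obtain \<gamma> where \<gamma>: "\<gamma> \<in> couplings \<mu> \<nu>" "?C \<gamma> < ennreal (c\<^sup>2)"
    unfolding INF_less_iff by blast
  show ?thesis
  proof
    show "L2_bound \<gamma> (\<lambda>z. norm (fst z - snd z)) c"
      unfolding L2_bound_def using \<gamma>(2) unfolding case_prod_beta by (rule less_imp_le)
  qed (use \<gamma>(1) in \<open>auto simp: couplings_def\<close>)
qed

text \<open>
  An almost optimal coupling of two images \<open>f\<^sub>\<sharp> \<alpha>\<close>, \<open>g\<^sub>\<sharp> \<beta>\<close> is realised on the product of the original
  spaces by gluing \<open>\<alpha>\<close> to its first and \<open>\<beta>\<close> to its second marginal. Each gluing costs \<open>e\<close>, which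
  is half of the slack left between the cost of the coupling and \<open>c\<close>.
\<close>

lemma lift_near_optimal_coupling:
  fixes f :: "'b \<Rightarrow> 'a::{real_inner, polish_space}" and g :: "'c \<Rightarrow> 'a"
  assumes a: "prob_space \<alpha>" and b: "prob_space \<beta>"
    and f[measurable]: "f \<in> borel_measurable \<alpha>" and g[measurable]: "g \<in> borel_measurable \<beta>"
    and \<mu>: "distr \<alpha> borel f \<in> P2" and \<nu>: "distr \<beta> borel g \<in> P2"
    and c: "W2 (distr \<alpha> borel f) (distr \<beta> borel g) < c"
  obtains \<pi> where "prob_space \<pi>" "sets \<pi> = sets (\<alpha> \<Otimes>\<^sub>M \<beta>)"
    "distr \<pi> \<alpha> fst = \<alpha>" "distr \<pi> \<beta> snd = \<beta>" "L2_bound \<pi> (\<lambda>z. norm (f (fst z) - g (snd z))) c"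
proof -
  obtain c' where c': "W2 (distr \<alpha> borel f) (distr \<beta> borel g) < c'" "c' < c" using c dense by blast
  define e where "e = (c - c') / 2"
  have e: "e > 0" using c' by (simp add: e_def)
  have c'0: "c' > 0" using c'(1) W2_nonneg by (rule order.strict_trans1[rotated])
  obtain \<gamma> where \<gamma>: "prob_space \<gamma>" "sets \<gamma> = sets borel" "distr \<gamma> borel fst = distr \<alpha> borel f"
    "distr \<gamma> borel snd = distr \<beta> borel g" "L2_bound \<gamma> (\<lambda>z. norm (fst z - snd z)) c'"
    by (rule near_optimal_coupling[OF \<mu> \<nu> c'(1)])
  have \<gamma>m[measurable_cong]: "sets \<gamma> = sets (borel \<Otimes>\<^sub>M borel)" unfolding borel_prod by (rule \<gamma>(2))
  obtain \<pi>1 where 1: "prob_space \<pi>1" "sets \<pi>1 = sets (\<alpha> \<Otimes>\<^sub>M \<gamma>)" "distr \<pi>1 \<alpha> fst = \<alpha>" "distr \<pi>1 \<gamma> snd = \<gamma>"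
    "AE z in \<pi>1. dist (f (fst z)) (fst (snd z)) < e"
    by (rule approximate_gluing[OF a \<gamma>(1) f _ \<gamma>(3)[symmetric] e]) auto
  note 1(2)[measurable_cong]
  have "distr \<pi>1 borel (\<lambda>z. snd (snd z)) = distr (distr \<pi>1 \<gamma> snd) borel snd"
    by (subst distr_distr) (auto simp: comp_def)
  then have eq: "distr \<pi>1 borel (\<lambda>z. snd (snd z)) = distr \<beta> borel g" by (simp add: 1(4) \<gamma>(4))
  obtain \<pi>2 where 2: "prob_space \<pi>2" "sets \<pi>2 = sets (\<pi>1 \<Otimes>\<^sub>M \<beta>)" "distr \<pi>2 \<pi>1 fst = \<pi>1" "distr \<pi>2 \<beta> snd = \<beta>"
    "AE z in \<pi>2. dist (snd (snd (fst z))) (g (snd z)) < e"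
    by (rule approximate_gluing[OF 1(1) b _ g eq e]) auto
  note 2(2)[measurable_cong]
  have ae1: "AE z in \<pi>2. dist (f (fst (fst z))) (fst (snd (fst z))) < e"
  proof -
    have "AE z in distr \<pi>2 \<pi>1 fst. dist (f (fst z)) (fst (snd z)) < e" by (subst 2(3)) (rule 1(5))
    then show ?thesis by (subst (asm) AE_distr_iff) auto
  qed
  have L: "L2_bound \<pi>2 (\<lambda>z. norm (fst (snd (fst z)) - snd (snd (fst z)))) c'"
  proof -
    have "L2_bound \<pi>1 (\<lambda>z. norm (fst (snd z) - snd (snd z))) c'"
      using \<gamma>(5) L2_bound_distr[of snd \<pi>1 \<gamma> "\<lambda>z. norm (fst z - snd z)" c', unfolded 1(4)] by simp
    then show ?thesis
      using L2_bound_distr[of fst \<pi>2 \<pi>1 "\<lambda>z. norm (fst (snd z) - snd (snd z))" c', unfolded 2(3)] by simp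
  qed
  interpret \<pi>2: prob_space \<pi>2 by (rule 2(1))
  have "L2_bound \<pi>2 (\<lambda>z. norm (fst (snd (fst z)) - snd (snd (fst z))) + (e + e)) (c' + (e + e))"
    using e c'0 L by (intro L2_bound_add \<pi>2.L2_bound_const) auto
  then have "L2_bound \<pi>2 (\<lambda>z. norm (f (fst (fst z)) - g (snd z))) (c' + (e + e))"
  proof (rule L2_bound_mono)
    show "AE z in \<pi>2. \<bar>norm (f (fst (fst z)) - g (snd z))\<bar> 
        \<le> \<bar>norm (fst (snd (fst z)) - snd (snd (fst z))) + (e + e)\<bar>"
      using ae1 2(5)
    proof eventually_elim
      case (elim z)
      have "dist (f (fst (fst z))) (g (snd z)) \<le> dist (f (fst (fst z))) (fst (snd (fst z)))
        + dist (fst (snd (fst z))) (snd (snd (fst z))) + dist (snd (snd (fst z))) (g (snd z))"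
        by metric
      with elim e show ?case unfolding dist_norm by simp
    qed
  qed
  also have "c' + (e + e) = c" by (simp add: e_def)
  finally have L2: "L2_bound \<pi>2 (\<lambda>z. norm (f (fst (fst z)) - g (snd z))) c" .
  define \<pi> where "\<pi> = distr \<pi>2 (\<alpha> \<Otimes>\<^sub>M \<beta>) (\<lambda>z. (fst (fst z), snd z))"
  show ?thesis
  proof
    show "prob_space \<pi>" unfolding \<pi>_def by (rule \<pi>2.prob_space_distr) simp
    show "sets \<pi> = sets (\<alpha> \<Otimes>\<^sub>M \<beta>)" by (simp add: \<pi>_def)
    have "distr \<pi> \<alpha> fst = distr (distr \<pi>2 \<pi>1 fst) \<alpha> fst"
      unfolding \<pi>_def by (subst (1 2) distr_distr) (auto simp: comp_def)
    then show "distr \<pi> \<alpha> fst = \<alpha>" by (simp add: 2(3) 1(3))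
    have "distr \<pi> \<beta> snd = distr \<pi>2 \<beta> snd"
      unfolding \<pi>_def by (subst distr_distr) (auto simp: comp_def)
    then show "distr \<pi> \<beta> snd = \<beta>" by (simp add: 2(4))
    show "L2_bound \<pi> (\<lambda>z. norm (f (fst z) - g (snd z))) c"
      unfolding \<pi>_def using L2 by (subst L2_bound_distr) auto
  qed
qed

text \<open>
  The lift applied to \<open>snd\<close> on an almost optimal coupling of \<open>\<mu>, \<nu>\<close> and to the identity on \<open>\<sigma>\<close> produces
  three random variables to which Minkowski's inequality applies.
\<close>

lemma W2_triangle:
  fixes \<mu> \<nu> \<sigma> :: "'a::{real_inner, polish_space} measure"
  assumes P2: "\<mu> \<in> P2" "\<nu> \<in> P2" "\<sigma> \<in> P2"
  shows "W2 \<mu> \<sigma> \<le> W2 \<mu> \<nu> + W2 \<nu> \<sigma>"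
proof (rule field_le_epsilon)
  fix e :: real assume "e > 0"
  define a where "a = W2 \<mu> \<nu> + e / 2"
  define b where "b = W2 \<nu> \<sigma> + e / 2"
  have a: "W2 \<mu> \<nu> < a" "a > 0" and b: "W2 \<nu> \<sigma> < b" "b > 0"
    using \<open>e > 0\<close> by (auto simp: a_def b_def add_nonneg_pos)
  obtain \<gamma> where \<gamma>: "prob_space \<gamma>" "sets \<gamma> = sets borel" "distr \<gamma> borel fst = \<mu>"
    "distr \<gamma> borel snd = \<nu>" "L2_bound \<gamma> (\<lambda>z. norm (fst z - snd z)) a"
    by (rule near_optimal_coupling[OF P2(1,2) a(1)])
  have \<gamma>m[measurable_cong]: "sets \<gamma> = sets (borel \<Otimes>\<^sub>M borel)" unfolding borel_prod by (rule \<gamma>(2))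
  note [measurable_cong] = P2_sets[OF P2(3)]
  have id: "distr \<sigma> borel (\<lambda>x. x) = \<sigma>" by (rule distr_id2) (simp add: P2_sets[OF P2(3)])
  obtain \<pi> where \<pi>: "prob_space \<pi>" "sets \<pi> = sets (\<gamma> \<Otimes>\<^sub>M \<sigma>)"
    "distr \<pi> \<gamma> fst = \<gamma>" "distr \<pi> \<sigma> snd = \<sigma>" "L2_bound \<pi> (\<lambda>z. norm (snd (fst z) - snd z)) b"
    by (rule lift_near_optimal_coupling[OF \<gamma>(1) P2_prob_space[OF P2(3)], of snd "\<lambda>x. x" b])
      (use P2 b in \<open>auto simp: \<gamma> id\<close>)
  note [measurable_cong] = \<pi>(2)
  have 1: "L2_bound \<pi> (\<lambda>z. norm (fst (fst z) - snd (fst z))) a"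
    using \<gamma>(5) L2_bound_distr[of fst \<pi> \<gamma> "\<lambda>z. norm (fst z - snd z)" a, unfolded \<pi>(3)] by simp
  have 2: "L2_bound \<pi> (\<lambda>z. norm (fst (fst z) - snd (fst z)) + norm (snd (fst z) - snd z)) (a + b)"
    using 1 \<pi>(5) a b by (intro L2_bound_add) auto
  have "W2 \<mu> \<sigma> \<le> a + b"
  proof (rule W2_le_L2_bound[OF \<pi>(1)])
    show "L2_bound \<pi> (\<lambda>z. norm (fst (fst z) - snd z)) (a + b)"
    proof (rule L2_bound_mono[OF 2], rule AE_I2)
      fix z
      show "\<bar>norm (fst (fst z) - snd z)\<bar> \<le> \<bar>norm (fst (fst z) - snd (fst z)) + norm (snd (fst z) - snd z)\<bar>"
        using norm_triangle_ineq[of "fst (fst z) - snd (fst z)" "snd (fst z) - snd z"] by simp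
    qed
    have "distr \<pi> borel (\<lambda>z. fst (fst z)) = distr (distr \<pi> \<gamma> fst) borel fst"
      by (subst distr_distr) (auto simp: comp_def)
    then show "distr \<pi> borel (\<lambda>z. fst (fst z)) = \<mu>" by (simp add: \<pi> \<gamma>)
    have "distr \<pi> borel (\<lambda>z. snd z) = distr (distr \<pi> \<sigma> snd) borel (\<lambda>x. x)"
      by (subst distr_distr) (auto simp: comp_def)
    then show "distr \<pi> borel (\<lambda>z. snd z) = \<sigma>" by (simp add: \<pi> id)
  qed (use a b in auto)
  then show "W2 \<mu> \<sigma> \<le> W2 \<mu> \<nu> + W2 \<nu> \<sigma> + e" by (simp add: a_def b_def)
qed

lemma W2_commute:
  assumes "\<mu> \<in> P2" "\<nu> \<in> P2" shows "W2 \<mu> \<nu> = W2 \<nu> \<mu>"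
proof -
  have "W2 \<nu> \<mu> \<le> W2 \<mu> \<nu>" if P2: "\<mu> \<in> P2" "\<nu> \<in> P2" for \<mu> \<nu> :: "'a measure"
  proof (rule field_le_epsilon)
    fix e :: real assume "e > 0"
    then have "W2 \<mu> \<nu> < W2 \<mu> \<nu> + e" by simp
    then obtain \<gamma> where \<gamma>: "prob_space \<gamma>" "sets \<gamma> = sets borel" "distr \<gamma> borel fst = \<mu>"
      "distr \<gamma> borel snd = \<nu>" "L2_bound \<gamma> (\<lambda>z. norm (fst z - snd z)) (W2 \<mu> \<nu> + e)"
      by (rule near_optimal_coupling[OF P2])
    have \<gamma>m[measurable_cong]: "sets \<gamma> = sets (borel \<Otimes>\<^sub>M borel)" unfolding borel_prod by (rule \<gamma>(2))
    show "W2 \<nu> \<mu> \<le> W2 \<mu> \<nu> + e"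
    proof (rule W2_le_L2_bound[OF \<gamma>(1) _ _ _ _ \<gamma>(4,3)])
      show "L2_bound \<gamma> (\<lambda>z. norm (snd z - fst z)) (W2 \<mu> \<nu> + e)"
        using \<gamma>(5) by (simp add: norm_minus_commute)
      show "0 \<le> W2 \<mu> \<nu> + e" using \<open>e > 0\<close> by simp
    qed simp_all
  qed
  from this[OF assms] this[OF assms(2,1)] show ?thesis by (rule antisym[rotated])
qed

lemma W2_diff_le:
  assumes "\<mu> \<in> P2" "\<nu> \<in> P2" "\<sigma> \<in> P2"
  shows "\<bar>W2 \<mu> \<sigma> - W2 \<nu> \<sigma>\<bar> \<le> W2 \<mu> \<nu>"
  using W2_triangle[OF assms] W2_triangle[OF assms(2,1,3)] W2_commute[OF assms(1,2)] by linarith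


section \<open>Completeness\<close>

text \<open>
  Iterating the cell construction defines a Markov chain whose \<open>k\<close>-th state has law \<open>\<gamma> k\<close>; the
  Ionescu-Tulcea theorem provides it on one probability space.
\<close>

lemma infinite_cell_gluing:
  fixes \<gamma> :: "nat \<Rightarrow> 'b measure" and I J :: "nat \<Rightarrow> 'b \<Rightarrow> nat"
  assumes prob: "\<And>k. prob_space (\<gamma> k)" and sets_\<gamma>: "\<And>k. sets (\<gamma> k) = sets S"
    and I [measurable]: "\<And>k. I k \<in> measurable S (count_space UNIV)"
    and J [measurable]: "\<And>k. J k \<in> measurable S (count_space UNIV)"
    and eq: "\<And>k. distr (\<gamma> k) (count_space UNIV) (I k) = distr (\<gamma> (Suc k)) (count_space UNIV) (J (Suc k))"
  obtains P :: "(nat \<Rightarrow> 'b) measure" where "prob_space P" "\<And>k. (\<lambda>\<omega>. \<omega> k) \<in> measurable P S"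
    "\<And>k. distr P S (\<lambda>\<omega>. \<omega> k) = \<gamma> k" "\<And>k. AE \<omega> in P. J (Suc k) (\<omega> (Suc k)) = I k (\<omega> k)"
proof -
  note [measurable_cong] = sets_\<gamma>
  have space_\<gamma>: "space (\<gamma> k) = space S" for k by (rule sets_eq_imp_space_eq) (rule sets_\<gamma>)
  define K where "K = (\<lambda>k a. cell_law (\<gamma> (Suc k)) (J (Suc k)) (I k a))"
  have K [measurable]: "K k \<in> measurable S (subprob_algebra S)" for k
  proof -
    interpret prob_space "\<gamma> (Suc k)" by (rule prob)
    have "cell_law (\<gamma> (Suc k)) (J (Suc k)) \<in> measurable (count_space UNIV) (subprob_algebra S)"
      using cell_law_kernel[of "J (Suc k)"] subprob_algebra_cong[OF sets_\<gamma>[of "Suc k"]] by simp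
    then show ?thesis unfolding K_def by measurable
  qed
  have pK: "prob_space (K k a)" for k a unfolding K_def by (rule prob_space.prob_space_cell_law[OF prob])
  have sK [simp, measurable_cong]: "sets (K k a) = sets S" for k a by (simp add: K_def sets_\<gamma>)
  have bK: "\<gamma> k \<bind> K k = \<gamma> (Suc k)" for k
    unfolding K_def by (rule cell_law_bind(1)[OF prob prob _ _ eq]) measurable
  have aK: "AE a in \<gamma> k. AE b in K k a. J (Suc k) b = I k a" for k
    unfolding K_def by (rule cell_law_bind(2)[OF prob prob _ _ eq]) measurable
  \<comment> \<open>the law of state \<open>k\<close> given the past \<open>\<omega>\<close>\<close>
  define Q where "Q = (\<lambda>k \<omega>. case k of 0 \<Rightarrow> \<gamma> 0 | Suc n \<Rightarrow> K n (\<omega> n))"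
  have Q0: "Q 0 \<omega> = \<gamma> 0" and QS: "Q (Suc k) \<omega> = K k (\<omega> k)" for k \<omega> by (auto simp: Q_def)
  have pQ: "prob_space (Q k \<omega>)" for k \<omega> using prob pK by (cases k) (auto simp: Q0 QS)
  have sQ [simp, measurable_cong]: "sets (Q k \<omega>) = sets S" for k \<omega> by (cases k) (auto simp: Q0 QS sets_\<gamma>)
  interpret IT: Ionescu_Tulcea Q "\<lambda>_. S"
  proof (rule Ionescu_Tulcea.intro)
    fix k
    show "Q k \<in> measurable (PiM {0..<k} (\<lambda>_. S)) (subprob_algebra S)"
    proof (cases k)
      case 0
      then show ?thesis
        using prob_space_imp_subprob_space[OF prob] sets_\<gamma>
        by (auto simp: Q_def space_subprob_algebra)
    next
      case (Suc n)
      have "(\<lambda>\<omega>. K n (\<omega> n)) \<in> measurable (PiM {0..<Suc n} (\<lambda>_. S)) (subprob_algebra S)"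
        by (rule measurable_compose[OF _ K]) (rule measurable_component_singleton, simp)
      then show ?thesis by (simp add: Suc Q_def)
    qed
  qed (rule pQ)
  define u where "u = (\<lambda>_::nat. undefined :: 'b)"
  have u: "u \<in> space (PiM {0..<0} (\<lambda>_. S))" by (simp add: u_def)
  have C: "distr IT.PF.lim (PiM {0..<n} (\<lambda>_. S)) (\<lambda>\<omega>. restrict \<omega> {0..<n}) = IT.C 0 n u" for n
  proof -
    have "IT.CI {0..<n} = IT.C 0 n u"
    proof (rule measure_eqI)
      show "sets (IT.CI {0..<n}) = sets (IT.C 0 n u)"
        using IT.sets_C[OF u, of n] by (simp add: IT.CI_def)
      fix X assume "X \<in> sets (IT.CI {0..<n})"
      then have X: "X \<in> sets (PiM {0..<n} (\<lambda>_. S))" by (simp add: IT.CI_def)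
      show "emeasure (IT.CI {0..<n}) X = emeasure (IT.C 0 n u) X"
        using IT.emeasure_CI[OF order_refl X] sets.sets_into_space[OF X]
        by (simp add: prod_emb_id space_PiM u_def)
    qed
    then show ?thesis by (simp add: IT.distr_lim)
  qed
  have mc: "(\<lambda>\<omega>. \<omega> k) \<in> measurable (PiM {0..<n} (\<lambda>_. S)) S" if "k < n" for k n :: nat
    by (rule measurable_component_singleton) (use that in auto)
  have mr: "(\<lambda>\<omega>. restrict \<omega> {0..<n}) \<in> measurable IT.PF.lim (PiM {0..<n} (\<lambda>_. S))" for n
    by (subst measurable_cong_sets[OF IT.PF.sets_lim refl]) (rule measurable_restrict_subset, simp)
  have ml [measurable]: "(\<lambda>\<omega>. \<omega> k) \<in> measurable IT.PF.lim S" for k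
    by (subst measurable_cong_sets[OF IT.PF.sets_lim refl]) (rule measurable_component_singleton, simp)
  have pC: "prob_space (IT.C 0 n u)" for n by (rule IT.prob_space_C[OF u])
  have neC: "space (IT.C 0 n u) \<noteq> {}" for n by (rule prob_space.not_empty[OF pC])
  have spC: "space (IT.C 0 n u) = space (PiM {0..<n} (\<lambda>_. S))" for n using IT.space_C[OF u, of n] by simp
  have seC: "sets (IT.C 0 n u) = sets (PiM {0..<n} (\<lambda>_. S))" for n using IT.sets_C[OF u, of n] by simp
  have eP: "IT.eP n \<in> measurable (IT.C 0 n u) (subprob_algebra (PiM {0..<Suc n} (\<lambda>_. S)))" for n
    by (subst measurable_cong_sets[OF seC refl]) (rule IT.measurable_eP)
  have Qm: "Q n \<in> measurable (IT.C 0 n u) (subprob_algebra S)" for n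
    by (subst measurable_cong_sets[OF seC refl]) (rule IT.P)
  have fu: "fun_upd \<omega> n \<in> measurable (Q n \<omega>) (PiM {0..<Suc n} (\<lambda>_. S))"
    if "\<omega> \<in> space (PiM {0..<n} (\<lambda>_. S))" for \<omega> n
    by (rule measurable_fun_upd[where J="{0..<n}"]) (use that in \<open>auto simp: measurable_ident_sets\<close>)
  have law_step: "distr (IT.C 0 (Suc n) u) S (\<lambda>\<omega>. \<omega> n) = IT.C 0 n u \<bind> Q n" for n
  proof -
    have "distr (IT.C 0 (Suc n) u) S (\<lambda>\<omega>. \<omega> n) = IT.C 0 n u \<bind> (\<lambda>\<omega>. distr (IT.eP n \<omega>) S (\<lambda>\<omega>. \<omega> n))"
      unfolding IT.C.simps(2)[of 0 n] add_0 by (rule distr_bind[OF eP neC mc]) simp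
    also have "\<dots> = IT.C 0 n u \<bind> Q n"
    proof (rule bind_cong[OF refl])
      fix \<omega> assume "\<omega> \<in> space (IT.C 0 n u)"
      then have "\<omega> \<in> space (PiM {0..<n} (\<lambda>_. S))" by (simp only: spC)
      then have "distr (IT.eP n \<omega>) S (\<lambda>\<omega>. \<omega> n) = distr (Q n \<omega>) S (\<lambda>x. x)"
        unfolding IT.eP_def by (subst distr_distr[OF mc fu]) (auto simp: comp_def)
      also have "\<dots> = Q n \<omega>" by (rule distr_id2) simp
      finally show "distr (IT.eP n \<omega>) S (\<lambda>\<omega>. \<omega> n) = Q n \<omega>" .
    qed
    finally show ?thesis .
  qed
  have law: "distr (IT.C 0 (Suc n) u) S (\<lambda>\<omega>. \<omega> n) = \<gamma> n" for n
  proof (induction n)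
    case 0
    have "IT.C 0 0 u \<bind> Q 0 = IT.C 0 0 u \<bind> (\<lambda>\<omega>. \<gamma> 0)"
      by (rule bind_cong[OF refl]) (rule Q0)
    also have "\<dots> = \<gamma> 0"
      by (rule bind_const'[OF pC prob_space_imp_subprob_space[OF prob]])
    finally show ?case unfolding law_step .
  next
    case step: (Suc n)
    have "IT.C 0 (Suc n) u \<bind> Q (Suc n) = IT.C 0 (Suc n) u \<bind> (\<lambda>\<omega>. K n (\<omega> n))"
      by (rule bind_cong[OF refl]) (rule QS)
    also have "\<dots> = distr (IT.C 0 (Suc n) u) S (\<lambda>\<omega>. \<omega> n) \<bind> K n"
      by (rule bind_distr[symmetric, OF _ K neC])
        (subst measurable_cong_sets[OF seC refl], rule mc, simp)
    also have "\<dots> = \<gamma> (Suc n)" unfolding step bK ..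
    finally show ?case unfolding law_step[of "Suc n"] .
  qed
  have ae: "AE \<omega> in IT.C 0 (Suc (Suc n)) u. J (Suc n) (\<omega> (Suc n)) = I n (\<omega> n)" for n
  proof -
    have [measurable]: "(\<lambda>\<omega>. \<omega> n) \<in> measurable (PiM {0..<Suc (Suc n)} (\<lambda>_. S)) S"
        "(\<lambda>\<omega>. \<omega> (Suc n)) \<in> measurable (PiM {0..<Suc (Suc n)} (\<lambda>_. S)) S" by (rule mc, simp)+
    have m: "Measurable.pred (PiM {0..<Suc (Suc n)} (\<lambda>_. S)) (\<lambda>\<omega>. J (Suc n) (\<omega> (Suc n)) = I n (\<omega> n))"
      by measurable
    have mC: "(\<lambda>\<omega>. \<omega> n) \<in> measurable (IT.C 0 (Suc n) u) S"
      by (subst measurable_cong_sets[OF seC refl]) (rule mc, simp)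
    have "AE a in distr (IT.C 0 (Suc n) u) S (\<lambda>\<omega>. \<omega> n). AE b in K n a. J (Suc n) b = I n a"
      unfolding law by (rule aK)
    then have "AE \<omega> in IT.C 0 (Suc n) u. AE b in K n (\<omega> n). J (Suc n) b = I n (\<omega> n)"
      by (rule AE_distrD[OF mC])
    then have "AE \<omega> in IT.C 0 (Suc n) u. AE \<omega>' in IT.eP (Suc n) \<omega>. J (Suc n) (\<omega>' (Suc n)) = I n (\<omega>' n)"
      using AE_space
    proof eventually_elim
      case (elim \<omega>)
      then have "\<omega> \<in> space (PiM {0..<Suc n} (\<lambda>_. S))" by (simp only: spC)
      from fu[OF this] show ?case
        unfolding IT.eP_def QS using elim(1) m by (subst AE_distr_iff) auto
    qed
    then show ?thesis
      unfolding IT.C.simps(2)[of 0 "Suc n"] add_0 by (subst AE_bind[OF eP m])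
  qed
  show ?thesis
  proof
    have "prob_space (distr IT.PF.lim (PiM {0..<0} (\<lambda>_. S)) (\<lambda>\<omega>. restrict \<omega> {0..<0}))"
      unfolding C by (rule pC)
    then show "prob_space IT.PF.lim" by (rule prob_space_distrD[OF mr])
    show "(\<lambda>\<omega>. \<omega> k) \<in> measurable IT.PF.lim S" for k by (rule ml)
    show "distr IT.PF.lim S (\<lambda>\<omega>. \<omega> k) = \<gamma> k" for k
    proof -
      have "distr IT.PF.lim S (\<lambda>\<omega>. \<omega> k) = distr (distr IT.PF.lim (PiM {0..<Suc k} (\<lambda>_. S)) (\<lambda>\<omega>. restrict \<omega> {0..<Suc k})) S (\<lambda>\<omega>. \<omega> k)"
        by (subst distr_distr[OF mc mr]) (auto simp: comp_def)
      then show ?thesis by (simp only: C law)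
    qed
    show "AE \<omega> in IT.PF.lim. J (Suc k) (\<omega> (Suc k)) = I k (\<omega> k)" for k
      using AE_distrD[OF mr ae[of k, folded C]] by simp
  qed
qed

lemma L2_bound_weaken:
  assumes "L2_bound P f c" "0 \<le> c" "c \<le> d" shows "L2_bound P f d"
proof -
  have "ennreal (c\<^sup>2) \<le> ennreal (d\<^sup>2)"
    using assms(2,3) by (intro ennreal_leI power_mono)
  with assms(1) show ?thesis unfolding L2_bound_def by (rule order_trans)
qed

lemma Cauchy_of_summable_dist:
  fixes x :: "nat \<Rightarrow> 'a::metric_space"
  assumes "summable (\<lambda>k. dist (x k) (x (Suc k)))"
  shows "Cauchy x"
proof (rule metric_CauchyI)
  fix e :: real assume "e > 0"
  define s where "s = (\<lambda>n. \<Sum>k<n. dist (x k) (x (Suc k)))"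
  have "Cauchy s"
    using assms unfolding s_def summable_iff_convergent by (rule convergent_Cauchy)
  then obtain N where N: "\<And>m n. m \<ge> N \<Longrightarrow> n \<ge> N \<Longrightarrow> dist (s m) (s n) < e"
    using \<open>e > 0\<close> unfolding Cauchy_def by blast
  have le: "dist (x m) (x (m + l)) \<le> s (m + l) - s m" for m l
  proof (induction l)
    case (Suc l)
    then show ?case
      using dist_triangle[of "x m" "x (m + Suc l)" "x (m + l)"] by (simp add: s_def)
  qed (simp add: s_def)
  have "dist (x m) (x n) < e" if "m \<ge> N" "n \<ge> N" "m \<le> n" for m n
    using le[of m "n - m"] N[of m n] that by (simp add: dist_real_def)
  then show "\<exists>N. \<forall>m\<ge>N. \<forall>n\<ge>N. dist (x m) (x n) < e"
    by (metis dist_commute nle_le)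
qed

text \<open>
  States of the chain are pairs with law an almost optimal coupling of \<open>\<mu> k\<close> and \<open>\<mu> (k + 1)\<close>, and the second
  component of one state is close to the first component of the next. So the first components \<open>X k\<close>
  have laws \<open>\<mu> k\<close> and consecutive \<open>L\<^sup>2\<close> distances of order \<open>2\<^sup>-\<^sup>k\<close>. They converge almost
  surely, and by Fatou's lemma in \<open>L\<^sup>2\<close>, to a random variable whose law is the limit.
\<close>

lemma W2_complete_sequence:
  fixes \<mu> :: "nat \<Rightarrow> 'a::{real_inner, polish_space} measure"
  assumes P2: "\<And>k. \<mu> k \<in> P2" and dist: "\<And>k. W2 (\<mu> k) (\<mu> (Suc k)) < (1 / 2) ^ k"
  obtains \<nu> where "\<nu> \<in> P2" "(\<lambda>k. W2 (\<mu> k) \<nu>) \<longlonglongrightarrow> 0"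
proof -
  have "\<forall>k. \<exists>\<gamma>. prob_space \<gamma> \<and> sets \<gamma> = sets borel \<and> distr \<gamma> borel fst = \<mu> k \<and> distr \<gamma> borel snd = \<mu> (Suc k)
    \<and> L2_bound \<gamma> (\<lambda>z. norm (fst z - snd z)) ((1/2)^k)" (is "\<forall>k. \<exists>\<gamma>. ?coupling k \<gamma>")
  proof
    fix k
    show "\<exists>\<gamma>. ?coupling k \<gamma>"
      by (rule near_optimal_coupling[OF P2[of k] P2[of "Suc k"] dist[of k]]) (rule exI, intro conjI)
  qed
  from choice[OF this] obtain \<gamma> where \<gamma>: "\<And>k. prob_space (\<gamma> k)" "\<And>k. sets (\<gamma> k) = sets borel" "\<And>k. distr (\<gamma> k) borel fst = \<mu> k"
    "\<And>k. distr (\<gamma> k) borel snd = \<mu> (Suc k)" "\<And>k. L2_bound (\<gamma> k) (\<lambda>z. norm (fst z - snd z)) ((1/2)^k)"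
    by auto
  have "\<forall>k. \<exists>C :: 'a \<Rightarrow> nat. C \<in> measurable borel (count_space UNIV) \<and> (\<forall>x y. C x = C y \<longrightarrow> dist x y < (1/2)^k)"
    (is "\<forall>k. \<exists>C. ?cells k C")
  proof
    fix k
    have "(1/2::real)^k > 0" by simp
    then obtain C :: "'a \<Rightarrow> nat" where "C \<in> measurable borel (count_space UNIV)" "\<And>x y. C x = C y \<Longrightarrow> dist x y < (1/2)^k"
      by (rule small_cells) blast
    then show "\<exists>C. ?cells k C" by blast
  qed
  from choice[OF this] obtain C :: "nat \<Rightarrow> 'a \<Rightarrow> nat" where C [measurable]: "\<And>k. C k \<in> measurable borel (count_space UNIV)"
    and near: "\<And>k x y. C k x = C k y \<Longrightarrow> dist x y < (1/2)^k" by auto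
  have \<gamma>m [measurable_cong]: "sets (\<gamma> k) = sets (borel \<Otimes>\<^sub>M borel)" for k unfolding borel_prod by (rule \<gamma>(2))
  have eq: "distr (\<gamma> k) (count_space UNIV) (\<lambda>z. C k (snd z)) = distr (\<gamma> (Suc k)) (count_space UNIV) (\<lambda>z. C (Suc k - 1) (fst z))" for k
  proof -
    have "distr (\<gamma> k) (count_space UNIV) (\<lambda>z. C k (snd z)) = distr (distr (\<gamma> k) borel snd) (count_space UNIV) (C k)"
      by (subst distr_distr) (auto simp: comp_def)
    also have "\<dots> = distr (distr (\<gamma> (Suc k)) borel fst) (count_space UNIV) (C k)" by (simp only: \<gamma>)
    also have "\<dots> = distr (\<gamma> (Suc k)) (count_space UNIV) (\<lambda>z. C (Suc k - 1) (fst z))"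
      by (subst distr_distr) (auto simp: comp_def)
    finally show ?thesis .
  qed
  obtain P :: "(nat \<Rightarrow> 'a \<times> 'a) measure" where P: "prob_space P" 
    and Pm [measurable]: "\<And>k. (\<lambda>\<omega>. \<omega> k) \<in> measurable P (borel \<Otimes>\<^sub>M borel)"
    and law: "\<And>k. distr P (borel \<Otimes>\<^sub>M borel) (\<lambda>\<omega>. \<omega> k) = \<gamma> k"
    and glue: "\<And>k. AE \<omega> in P. C (Suc k - 1) (fst (\<omega> (Suc k))) = C k (snd (\<omega> k))"
    by (rule infinite_cell_gluing[where I="\<lambda>k z. C k (snd z)" and J="\<lambda>k z. C (k - 1) (fst z)", OF \<gamma>(1) \<gamma>m _ _ eq]) auto
  interpret P: prob_space P by (rule P)
  define X where "X = (\<lambda>k (\<omega> :: nat \<Rightarrow> 'a \<times> 'a). fst (\<omega> k))"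
  have X [measurable]: "X k \<in> borel_measurable P" for k unfolding X_def by measurable
  have lawX: "distr P borel (X k) = \<mu> k" for k
  proof -
    have "distr P borel (X k) = distr (distr P (borel \<Otimes>\<^sub>M borel) (\<lambda>\<omega>. \<omega> k)) borel fst"
      unfolding X_def by (subst distr_distr) (auto simp: comp_def)
    then show ?thesis by (simp only: law \<gamma>)
  qed
  have step: "L2_bound P (\<lambda>\<omega>. norm (X k \<omega> - X (Suc k) \<omega>)) (2 * (1/2)^k)" for k
  proof -
    have "L2_bound P (\<lambda>\<omega>. norm (fst (\<omega> k) - snd (\<omega> k))) ((1/2)^k)"
      using \<gamma>(5)[of k] L2_bound_distr[of "\<lambda>\<omega>. \<omega> k" P "borel \<Otimes>\<^sub>M borel" "\<lambda>z. norm (fst z - snd z)" "(1/2)^k", unfolded law] by simp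
    then have "L2_bound P (\<lambda>\<omega>. norm (fst (\<omega> k) - snd (\<omega> k)) + (1/2)^k) ((1/2)^k + (1/2)^k)"
      by (intro L2_bound_add P.L2_bound_const) auto
    then have "L2_bound P (\<lambda>\<omega>. norm (X k \<omega> - X (Suc k) \<omega>)) ((1/2)^k + (1/2)^k)"
    proof (rule L2_bound_mono)
      show "AE \<omega> in P. \<bar>norm (X k \<omega> - X (Suc k) \<omega>)\<bar> \<le> \<bar>norm (fst (\<omega> k) - snd (\<omega> k)) + (1/2)^k\<bar>"
        using glue[of k]
      proof eventually_elim
        case (elim \<omega>)
        then have "dist (fst (\<omega> (Suc k))) (snd (\<omega> k)) < (1/2)^k" by (intro near) simp
        then have "dist (fst (\<omega> k)) (fst (\<omega> (Suc k))) \<le> dist (fst (\<omega> k)) (snd (\<omega> k)) + (1/2)^k"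
          using dist_triangle[of "fst (\<omega> k)" "fst (\<omega> (Suc k))" "snd (\<omega> k)"] by (simp add: dist_commute)
        then show ?case by (simp add: X_def dist_norm)
      qed
    qed
    then show ?thesis by simp
  qed
  have far: "L2_bound P (\<lambda>\<omega>. norm (X k \<omega> - X (k + m) \<omega>)) (4 * (1/2)^k)" for k m
  proof (cases m)
    case 0
    then show ?thesis by (simp add: L2_bound_def)
  next
    case (Suc l)
    have "L2_bound P (\<lambda>\<omega>. norm (X k \<omega> - X (k + Suc l) \<omega>)) (4 * (1/2)^k - 4 * (1/2)^(k + Suc l))"
    proof (induction l)
      case 0
      show ?case using step[of k] by simp
    next
      case (Suc l)
      let ?a = "4 * (1/2)^k - 4 * (1/2)^(k + Suc l) :: real"
      have "(1/2::real)^(Suc l) < 1" by (rule power_Suc_less_one) auto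
      then have a: "?a > 0" by (simp add: power_add)
      have "L2_bound P (\<lambda>\<omega>. norm (X k \<omega> - X (k + Suc l) \<omega>) + norm (X (k + Suc l) \<omega> - X (Suc (k + Suc l)) \<omega>)) (?a + 2 * (1/2)^(k + Suc l))"
        by (rule L2_bound_add[OF _ _ Suc step a]) auto
      then have "L2_bound P (\<lambda>\<omega>. norm (X k \<omega> - X (k + Suc (Suc l)) \<omega>)) (?a + 2 * (1/2)^(k + Suc l))"
      proof (rule L2_bound_mono, intro AE_I2)
        fix \<omega>
        show "\<bar>norm (X k \<omega> - X (k + Suc (Suc l)) \<omega>)\<bar> \<le> \<bar>norm (X k \<omega> - X (k + Suc l) \<omega>) + norm (X (k + Suc l) \<omega> - X (Suc (k + Suc l)) \<omega>)\<bar>"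
          using norm_triangle_ineq[of "X k \<omega> - X (k + Suc l) \<omega>" "X (k + Suc l) \<omega> - X (Suc (k + Suc l)) \<omega>"] by simp
      qed
      also have "?a + 2 * (1/2)^(k + Suc l) = 4 * (1/2)^k - 4 * (1/2)^(k + Suc (Suc l))"
        by simp
      finally show ?case .
    qed
    then have "L2_bound P (\<lambda>\<omega>. norm (X k \<omega> - X (k + m) \<omega>)) (4 * (1/2)^k - 4 * (1/2)^(k + m))" by (simp only: Suc)
    then show ?thesis
    proof (rule L2_bound_weaken)
      have "(1/2::real)^(k+m) \<le> (1/2)^k" by (rule power_decreasing) auto
      then show "0 \<le> 4 * (1/2)^k - 4 * (1/2::real)^(k + m)" by simp
    qed simp
  qed
  have "(\<integral>\<^sup>+\<omega>. (\<Sum>k. ennreal (2^k * (norm (X k \<omega> - X (Suc k) \<omega>))\<^sup>2)) \<partial>P)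
      = (\<Sum>k. \<integral>\<^sup>+\<omega>. ennreal (2^k * (norm (X k \<omega> - X (Suc k) \<omega>))\<^sup>2) \<partial>P)"
    by (rule nn_integral_suminf) measurable
  also have "\<dots> \<le> (\<Sum>k. ennreal (4 * (1/2)^k))"
  proof (rule suminf_le)
    fix k
    have "(\<integral>\<^sup>+\<omega>. ennreal (2^k * (norm (X k \<omega> - X (Suc k) \<omega>))\<^sup>2) \<partial>P)
       = ennreal (2^k) * (\<integral>\<^sup>+\<omega>. ennreal ((norm (X k \<omega> - X (Suc k) \<omega>))\<^sup>2) \<partial>P)"
      by (subst nn_integral_cmult[symmetric]) (auto simp: ennreal_mult)
    also have "\<dots> \<le> ennreal (2^k) * ennreal ((2 * (1/2)^k)\<^sup>2)"
      using step[of k] unfolding L2_bound_def by (rule mult_left_mono) simp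
    also have "\<dots> = ennreal (2^k * (2 * (1/2)^k)\<^sup>2)" by (rule ennreal_mult[symmetric]) auto
    also have "2^k * (2 * (1/2::real)^k)\<^sup>2 = 4 * (1/2)^k"
      by (simp add: power2_eq_square power_one_over)
    finally show "(\<integral>\<^sup>+\<omega>. ennreal (2^k * (norm (X k \<omega> - X (Suc k) \<omega>))\<^sup>2) \<partial>P) \<le> ennreal (4 * (1/2)^k)" .
  qed auto
  also have "\<dots> = ennreal (\<Sum>k. 4 * (1/2)^k)"
    by (rule suminf_ennreal2) (auto intro!: summable_mult summable_geometric)
  also have "\<dots> < \<infinity>" by simp
  finally have "AE \<omega> in P. (\<Sum>k. ennreal (2^k * (norm (X k \<omega> - X (Suc k) \<omega>))\<^sup>2)) \<noteq> \<infinity>"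
    by (intro nn_integral_PInf_AE) auto
  then have cauchy: "AE \<omega> in P. Cauchy (\<lambda>k. X k \<omega>)"
  proof eventually_elim
    case (elim \<omega>)
    define f where "f = (\<lambda>k. norm (X k \<omega> - X (Suc k) \<omega>))"
    have "summable (\<lambda>k. 2^k * (f k)\<^sup>2)"
      using elim by (intro summable_suminf_not_top) (auto simp: f_def)
    then have "summable (\<lambda>k. 2^k * (f k)\<^sup>2 + (1/2)^k)"
      by (intro summable_add summable_geometric) auto
    then have "summable f"
    proof (rule summable_comparison_test[rotated], intro exI allI impI)
      fix k
      \<comment> \<open>the weights \<open>2\<^sup>k\<close> turn summability of squares into summability\<close>
      have "0 \<le> 2^k * (f k - (1/2)^k)\<^sup>2 + f k" by (simp add: f_def)
      also have "\<dots> = 2^k * (f k)\<^sup>2 + (1/2)^k - f k"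
        by (simp add: power2_eq_square power_one_over field_simps)
      finally show "norm (f k) \<le> 2^k * (f k)\<^sup>2 + (1/2)^k" by (simp add: f_def)
    qed
    then show ?case by (intro Cauchy_of_summable_dist) (simp add: f_def dist_norm)
  qed
  \<comment> \<open>replaces divergent sequences by zero, so that the limit exists everywhere and is measurable\<close>
  define X' where "X' = (\<lambda>k \<omega>. if Cauchy (\<lambda>k. X k \<omega>) then X k \<omega> else 0)"
  define Y where "Y = (\<lambda>\<omega>. lim (\<lambda>k. X' k \<omega>))"
  have X'Y: "(\<lambda>k. X' k \<omega>) \<longlonglongrightarrow> Y \<omega>" for \<omega>
  proof -
    have "Cauchy (\<lambda>k. X' k \<omega>)"
      by (cases "Cauchy (\<lambda>k. X k \<omega>)") (auto simp: X'_def intro: convergent_Cauchy convergent_const)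
    then show ?thesis
      unfolding Y_def by (simp add: Cauchy_convergent_iff convergent_LIMSEQ_iff)
  qed
  have Y [measurable]: "Y \<in> borel_measurable P"
    by (rule borel_measurable_LIMSEQ_metric[OF _ X'Y]) (unfold X'_def, measurable)
  have lim: "AE \<omega> in P. (\<lambda>k. X k \<omega>) \<longlonglongrightarrow> Y \<omega>"
    using cauchy
  proof eventually_elim
    case (elim \<omega>)
    then show ?case using X'Y[of \<omega>] by (simp add: X'_def)
  qed
  have XY: "L2_bound P (\<lambda>\<omega>. norm (X k \<omega> - Y \<omega>)) (4 * (1/2)^k)" for k
  proof -
    have "(\<integral>\<^sup>+\<omega>. ennreal ((norm (X k \<omega> - Y \<omega>))\<^sup>2) \<partial>P) = (\<integral>\<^sup>+\<omega>. liminf (\<lambda>m. ennreal ((norm (X k \<omega> - X (k + m) \<omega>))\<^sup>2)) \<partial>P)"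
    proof (rule nn_integral_cong_AE)
      show "AE \<omega> in P. ennreal ((norm (X k \<omega> - Y \<omega>))\<^sup>2) = liminf (\<lambda>m. ennreal ((norm (X k \<omega> - X (k + m) \<omega>))\<^sup>2))"
        using lim
      proof eventually_elim
        case (elim \<omega>)
        then have "(\<lambda>m. X (k + m) \<omega>) \<longlonglongrightarrow> Y \<omega>" by (subst add.commute) (rule LIMSEQ_ignore_initial_segment)
        then have "(\<lambda>m. ennreal ((norm (X k \<omega> - X (k + m) \<omega>))\<^sup>2)) \<longlonglongrightarrow> ennreal ((norm (X k \<omega> - Y \<omega>))\<^sup>2)"
          by (intro tendsto_intros tendsto_ennrealI)
        then show ?case by (intro lim_imp_Liminf[symmetric]) auto
      qed
    qed
    also have "\<dots> \<le> liminf (\<lambda>m. \<integral>\<^sup>+\<omega>. ennreal ((norm (X k \<omega> - X (k + m) \<omega>))\<^sup>2) \<partial>P)"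
      by (rule nn_integral_liminf) measurable
    also have "\<dots> \<le> liminf (\<lambda>m. ennreal ((4 * (1/2)^k)\<^sup>2) :: ennreal)"
      using far[of k] unfolding L2_bound_def by (intro Liminf_mono always_eventually allI)
    also have "\<dots> = ennreal ((4 * (1/2)^k)\<^sup>2)" by (rule Liminf_const) simp
    finally show ?thesis unfolding L2_bound_def .
  qed
  define \<nu> where "\<nu> = distr P borel Y"
  show ?thesis
  proof
    have "integrable P (\<lambda>\<omega>. (norm (X 0 \<omega>))\<^sup>2)"
      using P2[of 0] distr_in_P2_iff[OF P X, of 0] by (simp add: lawX)
    moreover have "integrable P (\<lambda>\<omega>. (norm (X 0 \<omega> - Y \<omega>))\<^sup>2)"
      using XY[of 0] by (intro L2_bound_integrable(1)) auto
    ultimately have "integrable P (\<lambda>\<omega>. (norm (X 0 \<omega> - (X 0 \<omega> - Y \<omega>)))\<^sup>2)"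
      by (rule integrable_power2_diff[OF X _ borel_measurable_diff[OF X Y]])
    then show "\<nu> \<in> P2" unfolding \<nu>_def using distr_in_P2_iff[OF P Y] by simp
    have le: "W2 (\<mu> k) \<nu> \<le> 4 * (1/2)^k" for k
      by (rule W2_le_L2_bound[OF P X Y XY _ lawX]) (auto simp: \<nu>_def)
    have "(\<lambda>k. 4 * (1/2)^k :: real) \<longlonglongrightarrow> 4 * 0" by (intro tendsto_intros LIMSEQ_power_zero) auto
    then show "(\<lambda>k. W2 (\<mu> k) \<nu>) \<longlonglongrightarrow> 0"
      by (intro tendsto_sandwich[of "\<lambda>_. 0" "\<lambda>k. W2 (\<mu> k) \<nu>" _ "\<lambda>k. 4 * (1/2)^k"]) (auto simp: le)
  qed
qed


section \<open>Concavity along the exponential and the pairings\<close>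

context
  fixes \<Phi> :: "('a::{real_inner, polish_space} \<times> 'a) measure"
  assumes \<Phi>: "\<Phi> \<in> P2"
begin

lemma plan_sets [measurable_cong]: "sets \<Phi> = sets (borel \<Otimes>\<^sub>M borel)"
  unfolding borel_prod by (rule P2_sets[OF \<Phi>])

lemma plan_exp_measurable: "(\<lambda>z. fst z + t *\<^sub>R snd z) \<in> borel_measurable \<Phi>"
  by measurable

lemma plan_integrable_fst: "integrable \<Phi> (\<lambda>z. (norm (fst z))\<^sup>2)"
proof (rule Bochner_Integration.integrable_bound[OF P2_integrable[OF \<Phi>]])
  show "AE z in \<Phi>. norm ((norm (fst z))\<^sup>2) \<le> norm ((norm z)\<^sup>2)"
    by (rule AE_I2) (simp add: norm_prod_def)
qed measurable

lemma plan_integrable_snd: "integrable \<Phi> (\<lambda>z. (norm (snd z))\<^sup>2)"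
proof (rule Bochner_Integration.integrable_bound[OF P2_integrable[OF \<Phi>]])
  show "AE z in \<Phi>. norm ((norm (snd z))\<^sup>2) \<le> norm ((norm z)\<^sup>2)"
    by (rule AE_I2) (simp add: norm_prod_def)
qed measurable

lemma velocity_norm_power2: "(velocity_norm \<Phi>)\<^sup>2 = (\<integral>z. (norm (snd z))\<^sup>2 \<partial>\<Phi>)"
  unfolding velocity_norm_def case_prod_beta by simp

lemma plan_exp_integrable: "integrable \<Phi> (\<lambda>z. (norm (fst z + t *\<^sub>R snd z))\<^sup>2)"
  by (intro integrable_power2_add integrable_power2_scaleR plan_integrable_fst plan_integrable_snd) measurable

lemma exp_push_in_P2: "exp_push t \<Phi> \<in> P2"
  unfolding exp_push_def case_prod_beta
  using distr_in_P2_iff[OF P2_prob_space[OF \<Phi>] plan_exp_measurable] plan_exp_integrable by blast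

lemma exp_push_0: "exp_push 0 \<Phi> = base \<Phi>"
  unfolding exp_push_def base_def case_prod_beta by simp

lemma base_in_P2: "base \<Phi> \<in> P2"
  using exp_push_in_P2[of 0] by (simp add: exp_push_0)

lemma velocity_norm_nonneg: "velocity_norm \<Phi> \<ge> 0"
  unfolding velocity_norm_def case_prod_beta by simp

lemma exp_push_Lipschitz: "W2 (exp_push s \<Phi>) (exp_push t \<Phi>) \<le> \<bar>s - t\<bar> * velocity_norm \<Phi>"
proof -
  have eq: "norm (fst z + s *\<^sub>R snd z - (fst z + t *\<^sub>R snd z)) = \<bar>s - t\<bar> * norm (snd z)" for z :: "'a \<times> 'a"
    by (simp add: scaleR_diff_left[symmetric])
  have "(W2 (exp_push s \<Phi>) (exp_push t \<Phi>))\<^sup>2 \<le> (\<integral>z. (norm (fst z + s *\<^sub>R snd z - (fst z + t *\<^sub>R snd z)))\<^sup>2 \<partial>\<Phi>)"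
  proof (rule W2_power2_le_integral[OF P2_prob_space[OF \<Phi>] plan_exp_measurable plan_exp_measurable])
    show "integrable \<Phi> (\<lambda>z. (norm (fst z + s *\<^sub>R snd z - (fst z + t *\<^sub>R snd z)))\<^sup>2)"
      unfolding eq power_mult_distrib by (intro integrable_mult_right plan_integrable_snd)
  qed (unfold exp_push_def case_prod_beta, (rule refl)+)
  also have "\<dots> = (\<bar>s - t\<bar> * velocity_norm \<Phi>)\<^sup>2"
    unfolding eq power_mult_distrib velocity_norm_power2 by simp
  finally show ?thesis
    by (rule power2_le_imp_le) (simp add: velocity_norm_nonneg)
qed

end

text \<open>
  An almost optimal coupling of the measures at time \<open>r\<close> is lifted to the plans. The lift bounds
  the distances at the other pairs of times as well, so a quadratic inequality between vectors of
  the Hilbert space, with \<open>x\<close> the difference of positions, passes to squared Wasserstein distances.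
  Below, the pairs \<open>(0, 0), (p, 0), (0, q)\<close> and \<open>(0, 0), (p, p)\<close> are used.
\<close>

lemma W2_exp_transfer:
  fixes \<Phi> \<Psi> :: "('a::{real_inner, polish_space} \<times> 'a) measure"
  assumes \<Phi>: "\<Phi> \<in> P2" and \<Psi>: "\<Psi> \<in> P2" and c: "c0 \<ge> 0" "c1 \<ge> 0" "c2 \<ge> 0"
    and pointwise: "\<And>x v w :: 'a. c0 * (norm x)\<^sup>2 + c1 * (norm (x + p1 *\<^sub>R v - q1 *\<^sub>R w))\<^sup>2
        + c2 * (norm (x + p2 *\<^sub>R v - q2 *\<^sub>R w))\<^sup>2
      \<le> (norm (x + r *\<^sub>R v - r *\<^sub>R w))\<^sup>2 + k * (norm v)\<^sup>2 + l * (norm w)\<^sup>2"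
  shows "c0 * (W2 (base \<Phi>) (base \<Psi>))\<^sup>2 + c1 * (W2 (exp_push p1 \<Phi>) (exp_push q1 \<Psi>))\<^sup>2
      + c2 * (W2 (exp_push p2 \<Phi>) (exp_push q2 \<Psi>))\<^sup>2
    \<le> (W2 (exp_push r \<Phi>) (exp_push r \<Psi>))\<^sup>2 + k * (velocity_norm \<Phi>)\<^sup>2 + l * (velocity_norm \<Psi>)\<^sup>2"
    (is "?lhs \<le> ?rhs")
proof (rule field_le_epsilon)
  fix e :: real assume "e > 0"
  note [measurable_cong] = plan_sets[OF \<Phi>] plan_sets[OF \<Psi>]
  let ?w = "W2 (exp_push r \<Phi>) (exp_push r \<Psi>)"
  have "?w\<^sup>2 < ?w\<^sup>2 + e" using \<open>e > 0\<close> by simp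
  then have slack: "?w < sqrt (?w\<^sup>2 + e)" by (rule real_less_rsqrt)
  have c2: "(sqrt (?w\<^sup>2 + e))\<^sup>2 = ?w\<^sup>2 + e" using \<open>e > 0\<close> by simp
  let ?f = "\<lambda>z :: 'a \<times> 'a. fst z + r *\<^sub>R snd z"
  have dist: "distr \<Phi> borel (\<lambda>z. fst z + s *\<^sub>R snd z) = exp_push s \<Phi>"
     "distr \<Psi> borel (\<lambda>z. fst z + s *\<^sub>R snd z) = exp_push s \<Psi>" for s
    unfolding exp_push_def case_prod_beta by (rule refl)+
  obtain P where P: "prob_space P" "sets P = sets (\<Phi> \<Otimes>\<^sub>M \<Psi>)" "distr P \<Phi> fst = \<Phi>" "distr P \<Psi> snd = \<Psi>"
    "L2_bound P (\<lambda>z. norm (?f (fst z) - ?f (snd z))) (sqrt (?w\<^sup>2 + e))"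
    by (rule lift_near_optimal_coupling[OF P2_prob_space[OF \<Phi>] P2_prob_space[OF \<Psi>], of ?f ?f "sqrt (?w\<^sup>2 + e)"])
      (use slack plan_exp_measurable[OF \<Phi>] plan_exp_measurable[OF \<Psi>] in \<open>auto simp: dist exp_push_in_P2 \<Phi> \<Psi>\<close>)
  have sP: "sets P = sets ((borel \<Otimes>\<^sub>M borel) \<Otimes>\<^sub>M (borel \<Otimes>\<^sub>M borel))"
    unfolding P(2) by (intro sets_pair_measure_cong plan_sets \<Phi> \<Psi>)
  \<comment> \<open>positions \<open>X, Y\<close> and velocities \<open>V, W\<close> of the lifted coupling\<close>
  define X V Y W where "X = (\<lambda>z :: ('a \<times> 'a) \<times> ('a \<times> 'a). fst (fst z))" and "V = (\<lambda>z :: ('a \<times> 'a) \<times> ('a \<times> 'a). snd (fst z))"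
    and "Y = (\<lambda>z :: ('a \<times> 'a) \<times> ('a \<times> 'a). fst (snd z))" and "W = (\<lambda>z :: ('a \<times> 'a) \<times> ('a \<times> 'a). snd (snd z))"
  have m [measurable]: "X \<in> borel_measurable P" "V \<in> borel_measurable P" "Y \<in> borel_measurable P" "W \<in> borel_measurable P"
    unfolding X_def V_def Y_def W_def measurable_cong_sets[OF sP refl] by measurable
  have proj [simp]: "fst \<in> measurable P \<Phi>" "snd \<in> measurable P \<Psi>"
    unfolding measurable_cong_sets[OF sP plan_sets[OF \<Phi>]] measurable_cong_sets[OF sP plan_sets[OF \<Psi>]] by measurable
  have int: "integrable P (\<lambda>\<omega>. (norm (X \<omega>))\<^sup>2)" "integrable P (\<lambda>\<omega>. (norm (V \<omega>))\<^sup>2)"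
    "integrable P (\<lambda>\<omega>. (norm (Y \<omega>))\<^sup>2)" "integrable P (\<lambda>\<omega>. (norm (W \<omega>))\<^sup>2)"
    using integrable_distr[of fst P \<Phi>, unfolded P(3), OF _ plan_integrable_fst[OF \<Phi>]]
      integrable_distr[of fst P \<Phi>, unfolded P(3), OF _ plan_integrable_snd[OF \<Phi>]]
      integrable_distr[of snd P \<Psi>, unfolded P(4), OF _ plan_integrable_fst[OF \<Psi>]]
      integrable_distr[of snd P \<Psi>, unfolded P(4), OF _ plan_integrable_snd[OF \<Psi>]]
    by (simp_all add: X_def V_def Y_def W_def)
  have vel: "(\<integral>\<omega>. (norm (V \<omega>))\<^sup>2 \<partial>P) = (velocity_norm \<Phi>)\<^sup>2"
      "(\<integral>\<omega>. (norm (W \<omega>))\<^sup>2 \<partial>P) = (velocity_norm \<Psi>)\<^sup>2"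
    using integral_distr[OF proj(1) borel_measurable_integrable[OF plan_integrable_snd[OF \<Phi>]], unfolded P(3)]
      integral_distr[OF proj(2) borel_measurable_integrable[OF plan_integrable_snd[OF \<Psi>]], unfolded P(4)]
    by (simp_all add: velocity_norm_power2 \<Phi> \<Psi> V_def W_def)
  define Q where "Q = (\<lambda>s t \<omega>. (norm (X \<omega> + s *\<^sub>R V \<omega> - (Y \<omega> + t *\<^sub>R W \<omega>)))\<^sup>2)"
  have Qint: "integrable P (Q s t)" for s t
    unfolding Q_def
    by (intro integrable_power2_diff integrable_power2_add integrable_power2_scaleR int) measurable
  have Q_eq: "Q s t \<omega> = (norm ((X \<omega> - Y \<omega>) + s *\<^sub>R V \<omega> - t *\<^sub>R W \<omega>))\<^sup>2" for s t \<omega>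
    unfolding Q_def by (simp add: algebra_simps)
  have le: "(W2 (exp_push s \<Phi>) (exp_push t \<Psi>))\<^sup>2 \<le> (\<integral>\<omega>. Q s t \<omega> \<partial>P)" for s t
    unfolding Q_def
  proof (rule W2_power2_le_integral[OF P(1) _ _ Qint[unfolded Q_def]])
    show "distr P borel (\<lambda>\<omega>. X \<omega> + s *\<^sub>R V \<omega>) = exp_push s \<Phi>"
      unfolding dist(1)[symmetric] X_def V_def
      using distr_distr[OF plan_exp_measurable[OF \<Phi>, of s] proj(1), unfolded P(3)] by (simp add: comp_def)
    show "distr P borel (\<lambda>\<omega>. Y \<omega> + t *\<^sub>R W \<omega>) = exp_push t \<Psi>"
      unfolding dist(2)[symmetric] Y_def W_def
      using distr_distr[OF plan_exp_measurable[OF \<Psi>, of t] proj(2), unfolded P(4)] by (simp add: comp_def)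
  qed measurable
  have near: "(\<integral>\<omega>. Q r r \<omega> \<partial>P) \<le> ?w\<^sup>2 + e"
  proof -
    have "(\<lambda>\<omega>. norm (X \<omega> + r *\<^sub>R V \<omega> - (Y \<omega> + r *\<^sub>R W \<omega>))) \<in> borel_measurable P" by measurable
    from L2_bound_integrable(2)[OF this[unfolded X_def V_def Y_def W_def] P(5)] show ?thesis
      by (simp add: Q_def X_def V_def Y_def W_def c2)
  qed
  have "?lhs \<le> c0 * (\<integral>\<omega>. Q 0 0 \<omega> \<partial>P) + c1 * (\<integral>\<omega>. Q p1 q1 \<omega> \<partial>P) + c2 * (\<integral>\<omega>. Q p2 q2 \<omega> \<partial>P)"
    unfolding exp_push_0[OF \<Phi>, symmetric] exp_push_0[OF \<Psi>, symmetric]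
    by (intro add_mono mult_left_mono le c)
  also have "\<dots> = (\<integral>\<omega>. c0 * Q 0 0 \<omega> + c1 * Q p1 q1 \<omega> + c2 * Q p2 q2 \<omega> \<partial>P)"
    by (simp add: Qint)
  also have "\<dots> \<le> (\<integral>\<omega>. Q r r \<omega> + k * (norm (V \<omega>))\<^sup>2 + l * (norm (W \<omega>))\<^sup>2 \<partial>P)"
  proof (rule integral_mono)
    show "c0 * Q 0 0 \<omega> + c1 * Q p1 q1 \<omega> + c2 * Q p2 q2 \<omega>
        \<le> Q r r \<omega> + k * (norm (V \<omega>))\<^sup>2 + l * (norm (W \<omega>))\<^sup>2" for \<omega>
      using pointwise[of "X \<omega> - Y \<omega>" "V \<omega>" "W \<omega>"] by (simp add: Q_eq)
  qed (intro integrable_mult_right Bochner_Integration.integrable_add Qint int)+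
  also have "\<dots> = (\<integral>\<omega>. Q r r \<omega> \<partial>P) + k * (velocity_norm \<Phi>)\<^sup>2 + l * (velocity_norm \<Psi>)\<^sup>2"
    by (simp add: Qint int vel)
  finally show "?lhs \<le> ?rhs + e"
    using near by linarith
qed

text \<open>
  The point \<open>(r, r)\<close> is the convex combination of \<open>(0, 0)\<close>, \<open>(p, 0)\<close> and \<open>(0, q)\<close> with weights
  \<open>1 - r/p - r/q\<close>, \<open>r/p\<close>, \<open>r/q\<close>; the right-hand side carries the price of the quadratic terms.
\<close>

lemma W2_exp_split_concave:
  fixes \<Phi> \<Psi> :: "('a::{real_inner, polish_space} \<times> 'a) measure"
  assumes \<Phi>: "\<Phi> \<in> P2" and \<Psi>: "\<Psi> \<in> P2" and pos: "r > 0" "p > 0" "q > 0" and small: "r / p + r / q \<le> 1"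
  shows "(1 - r / p - r / q) * (W2 (base \<Phi>) (base \<Psi>))\<^sup>2 + r / p * (W2 (exp_push p \<Phi>) (base \<Psi>))\<^sup>2
      + r / q * (W2 (base \<Phi>) (exp_push q \<Psi>))\<^sup>2
    \<le> (W2 (exp_push r \<Phi>) (exp_push r \<Psi>))\<^sup>2 + r * p * (velocity_norm \<Phi>)\<^sup>2 + r * q * (velocity_norm \<Psi>)\<^sup>2"
proof -
  have "(1 - r / p - r / q) * (W2 (base \<Phi>) (base \<Psi>))\<^sup>2 + r / p * (W2 (exp_push p \<Phi>) (exp_push 0 \<Psi>))\<^sup>2
      + r / q * (W2 (exp_push 0 \<Phi>) (exp_push q \<Psi>))\<^sup>2
    \<le> (W2 (exp_push r \<Phi>) (exp_push r \<Psi>))\<^sup>2 + r * p * (velocity_norm \<Phi>)\<^sup>2 + r * q * (velocity_norm \<Psi>)\<^sup>2"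
  proof (rule W2_exp_transfer[OF \<Phi> \<Psi>])
    fix x v w :: 'a
    have "(norm (x + r *\<^sub>R v - r *\<^sub>R w))\<^sup>2 + r * p * (norm v)\<^sup>2 + r * q * (norm w)\<^sup>2
        - ((1 - r / p - r / q) * (norm x)\<^sup>2 + r / p * (norm (x + p *\<^sub>R v - 0 *\<^sub>R w))\<^sup>2
          + r / q * (norm (x + 0 *\<^sub>R v - q *\<^sub>R w))\<^sup>2) = r\<^sup>2 * (norm (v - w))\<^sup>2"
      using pos unfolding power2_norm_eq_inner
      by (simp add: inner_diff_left inner_diff_right inner_add_left inner_add_right inner_commute)
        (simp add: field_simps power2_eq_square)
    moreover have "\<dots> \<ge> 0" by simp
    ultimately show "(1 - r / p - r / q) * (norm x)\<^sup>2 + r / p * (norm (x + p *\<^sub>R v - 0 *\<^sub>R w))\<^sup>2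
        + r / q * (norm (x + 0 *\<^sub>R v - q *\<^sub>R w))\<^sup>2
      \<le> (norm (x + r *\<^sub>R v - r *\<^sub>R w))\<^sup>2 + r * p * (norm v)\<^sup>2 + r * q * (norm w)\<^sup>2"
      by linarith
  qed (use pos small in auto)
  then show ?thesis by (simp only: exp_push_0[OF \<Phi>] exp_push_0[OF \<Psi>])
qed

text \<open>
  Along the diagonal the squared norm \<open>|x + t (v - w)|\<^sup>2\<close> differs from an affine function of \<open>t\<close> by
  \<open>t\<^sup>2 |v - w|\<^sup>2\<close>; the last factor on the right bounds the mean of \<open>|v - w|\<^sup>2\<close> for every
  coupling of the plans.
\<close>

lemma W2_exp_diagonal_semiconcave:
  fixes \<Phi> \<Psi> :: "('a::{real_inner, polish_space} \<times> 'a) measure"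
  assumes \<Phi>: "\<Phi> \<in> P2" and \<Psi>: "\<Psi> \<in> P2" and pos: "0 < r" "r \<le> p"
  shows "(1 - r / p) * (W2 (base \<Phi>) (base \<Psi>))\<^sup>2 + r / p * (W2 (exp_push p \<Phi>) (exp_push p \<Psi>))\<^sup>2
    \<le> (W2 (exp_push r \<Phi>) (exp_push r \<Psi>))\<^sup>2
      + (r * p - r\<^sup>2) * (2 * (velocity_norm \<Phi>)\<^sup>2 + 2 * (velocity_norm \<Psi>)\<^sup>2)"
proof -
  let ?k = "2 * (r * p - r\<^sup>2)"
  have rp: "0 \<le> r * p - r\<^sup>2" using pos by (simp add: power2_eq_square)
  have "(1 - r / p) * (W2 (base \<Phi>) (base \<Psi>))\<^sup>2 + r / p * (W2 (exp_push p \<Phi>) (exp_push p \<Psi>))\<^sup>2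
      + 0 * (W2 (exp_push 0 \<Phi>) (exp_push 0 \<Psi>))\<^sup>2
    \<le> (W2 (exp_push r \<Phi>) (exp_push r \<Psi>))\<^sup>2 + ?k * (velocity_norm \<Phi>)\<^sup>2 + ?k * (velocity_norm \<Psi>)\<^sup>2"
  proof (rule W2_exp_transfer[OF \<Phi> \<Psi>])
    fix x v w :: 'a
    have "(1 - r / p) * (norm x)\<^sup>2 + r / p * (norm (x + p *\<^sub>R v - p *\<^sub>R w))\<^sup>2
        = (norm (x + r *\<^sub>R v - r *\<^sub>R w))\<^sup>2 + (r * p - r\<^sup>2) * (norm (v - w))\<^sup>2"
      using pos unfolding power2_norm_eq_inner
      by (simp add: inner_diff_left inner_diff_right inner_add_left inner_add_right inner_commute)
        (simp add: field_simps power2_eq_square)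
    moreover have "(r * p - r\<^sup>2) * (norm (v - w))\<^sup>2 \<le> (r * p - r\<^sup>2) * (2 * (norm v)\<^sup>2 + 2 * (norm w)\<^sup>2)"
    proof (rule mult_left_mono[OF _ rp])
      have "2 * (norm v)\<^sup>2 + 2 * (norm w)\<^sup>2 - (norm (v - w))\<^sup>2 = (norm (v + w))\<^sup>2"
        unfolding power2_norm_eq_inner by (simp add: algebra_simps inner_commute)
      then show "(norm (v - w))\<^sup>2 \<le> 2 * (norm v)\<^sup>2 + 2 * (norm w)\<^sup>2"
        using zero_le_power2[of "norm (v + w)"] by linarith
    qed
    ultimately show "(1 - r / p) * (norm x)\<^sup>2 + r / p * (norm (x + p *\<^sub>R v - p *\<^sub>R w))\<^sup>2
        + 0 * (norm (x + 0 *\<^sub>R v - 0 *\<^sub>R w))\<^sup>2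
      \<le> (norm (x + r *\<^sub>R v - r *\<^sub>R w))\<^sup>2 + ?k * (norm v)\<^sup>2 + ?k * (norm w)\<^sup>2"
      by (simp add: algebra_simps)
  qed (use pos in auto)
  then show ?thesis by (simp add: algebra_simps)
qed

lemma antimono_tendsto_at_right_0:
  fixes h :: "real \<Rightarrow> real"
  assumes anti: "\<And>r p. 0 < r \<Longrightarrow> r \<le> p \<Longrightarrow> h p \<le> h r" and bdd: "\<And>r. 0 < r \<Longrightarrow> r \<le> 1 \<Longrightarrow> h r \<le> B"
  shows "(h \<longlongrightarrow> Sup (h ` {0<..})) (at_right 0)"
proof -
  have B: "h r \<le> B" if "r > 0" for r
    using anti[of "min r 1" r] bdd[of "min r 1"] that by auto
  then have bd: "bdd_above (h ` {0<..})" by (auto intro!: bdd_aboveI)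
  show ?thesis
  proof (rule order_tendstoI)
    fix a assume "a < Sup (h ` {0<..})"
    then obtain p where p: "p > 0" "a < h p"
      using less_cSup_iff[of "h ` {0<..}" a] bd by auto
    then have "a < h r" if "0 < r" "r < p" for r using anti[of r p] that by auto
    with p(1) show "\<forall>\<^sub>F r in at_right 0. a < h r" unfolding eventually_at_right_field by auto
  next
    fix a assume a: "Sup (h ` {0<..}) < a"
    have "h r < a" if "0 < r" for r
      using cSup_upper[OF _ bd, of "h r"] a that by auto
    then show "\<forall>\<^sub>F r in at_right 0. h r < a"
      unfolding eventually_at_right_field by (intro exI[of _ 1]) auto
  qed
qed

lemma W2_power2_diff_le:
  fixes \<mu> \<nu> \<sigma> :: "'a::{real_inner, polish_space} measure"
  assumes "\<mu> \<in> P2" "\<nu> \<in> P2" "\<sigma> \<in> P2" and d: "W2 \<mu> \<nu> \<le> d"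
  shows "\<bar>(W2 \<mu> \<sigma>)\<^sup>2 - (W2 \<nu> \<sigma>)\<^sup>2\<bar> \<le> d * (2 * W2 \<nu> \<sigma> + d)"
proof -
  have 1: "\<bar>W2 \<mu> \<sigma> - W2 \<nu> \<sigma>\<bar> \<le> d" using W2_diff_le[OF assms(1-3)] d by linarith
  have "\<bar>(W2 \<mu> \<sigma>)\<^sup>2 - (W2 \<nu> \<sigma>)\<^sup>2\<bar> = \<bar>W2 \<mu> \<sigma> - W2 \<nu> \<sigma>\<bar> * \<bar>W2 \<mu> \<sigma> + W2 \<nu> \<sigma>\<bar>"
    by (simp add: power2_eq_square square_diff_square_factored abs_mult)
  also have "\<dots> \<le> d * (2 * W2 \<nu> \<sigma> + d)"
    using 1 W2_nonneg[of \<mu> \<sigma>] W2_nonneg[of \<nu> \<sigma>] by (intro mult_mono) auto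
  finally show ?thesis .
qed

text \<open>
  By semiconcavity the difference quotient, corrected by the linear term \<open>r K\<close>, is nonincreasing in \<open>r\<close>;
  it is bounded above because displacements move measures at finite speed. So the limit that \<open>pairing\<close>
  names does exist.
\<close>

lemma pairing_tendsto:
  fixes \<Phi> \<Psi> :: "('a::{real_inner, polish_space} \<times> 'a) measure"
  assumes \<Phi>: "\<Phi> \<in> P2" and \<Psi>: "\<Psi> \<in> P2"
  shows "((\<lambda>s. ((W2 (exp_push s \<Phi>) (exp_push s \<Psi>))\<^sup>2 - (W2 (base \<Phi>) (base \<Psi>))\<^sup>2) / (2 * s)) \<longlongrightarrow> pairing \<Phi> \<Psi>) (at_right 0)"
proof -
  define f where "f = (\<lambda>s. (W2 (exp_push s \<Phi>) (exp_push s \<Psi>))\<^sup>2)"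
  define f0 where "f0 = (W2 (base \<Phi>) (base \<Psi>))\<^sup>2"
  define K where "K = 2 * (velocity_norm \<Phi>)\<^sup>2 + 2 * (velocity_norm \<Psi>)\<^sup>2"
  define h where "h = (\<lambda>r. (f r - f0) / r - r * K)"
  define w a where "w = W2 (base \<Phi>) (base \<Psi>)" and "a = velocity_norm \<Phi> + velocity_norm \<Psi>"
  have a: "a \<ge> 0" unfolding a_def by (simp add: velocity_norm_nonneg \<Phi> \<Psi>)
  have "(h \<longlongrightarrow> Sup (h ` {0<..})) (at_right 0)"
  proof (rule antimono_tendsto_at_right_0)
    fix r p :: real assume rp: "0 < r" "r \<le> p"
    have "(1 - r / p) * f0 + r / p * f p \<le> f r + (r * p - r\<^sup>2) * K"
      unfolding f_def f0_def K_def using \<Phi> \<Psi> rp by (rule W2_exp_diagonal_semiconcave)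
    then have "r * ((f p - f0) / p - p * K) \<le> r * ((f r - f0) / r - r * K)"
      using rp by (simp add: divide_simps power2_eq_square) (simp add: algebra_simps)
    then show "h p \<le> h r" unfolding h_def using rp by simp
  next
    fix r :: real assume r: "0 < r" "r \<le> 1"
    have "W2 (exp_push r \<Phi>) (exp_push r \<Psi>) \<le> W2 (exp_push r \<Phi>) (base \<Phi>) + (w + W2 (base \<Psi>) (exp_push r \<Psi>))"
      using W2_triangle[of "exp_push r \<Phi>" "base \<Phi>" "exp_push r \<Psi>"] W2_triangle[of "base \<Phi>" "base \<Psi>" "exp_push r \<Psi>"]
      by (simp add: \<Phi> \<Psi> exp_push_in_P2 base_in_P2 w_def)
    also have "\<dots> \<le> w + r * a"
      using exp_push_Lipschitz[OF \<Phi>, of r 0] exp_push_Lipschitz[OF \<Psi>, of 0 r] r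
      by (simp add: exp_push_0 \<Phi> \<Psi> a_def algebra_simps)
    finally have "f r \<le> (w + r * a)\<^sup>2" unfolding f_def by (intro power_mono) auto
    then have "f r - f0 \<le> r * (2 * w * a + r * a\<^sup>2)"
      by (simp add: f0_def w_def[symmetric] power2_eq_square algebra_simps)
    then have "(f r - f0) / r \<le> 2 * w * a + r * a\<^sup>2"
      using r by (simp add: divide_simps mult.commute)
    also have "\<dots> \<le> 2 * w * a + a\<^sup>2" using r by (simp add: mult_left_le_one_le)
    finally show "h r \<le> 2 * w * a + a\<^sup>2"
      unfolding h_def K_def using r by (smt (verit) mult_nonneg_nonneg zero_le_power2)
  qed
  then have "((\<lambda>r. (h r + r * K) / 2) \<longlongrightarrow> (Sup (h ` {0<..}) + 0 * K) / 2) (at_right 0)"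
    by (intro tendsto_intros) auto
  moreover have "\<forall>\<^sub>F r in at_right 0. (h r + r * K) / 2 = (f r - f0) / (2 * r)"
    unfolding eventually_at_right_field h_def by (intro exI[of _ 1]) (auto simp: field_simps)
  ultimately have "((\<lambda>r. (f r - f0) / (2 * r)) \<longlongrightarrow> (Sup (h ` {0<..}) + 0 * K) / 2) (at_right 0)"
    by (rule Lim_transform_eventually)
  then show ?thesis
    unfolding pairing_def f_def f0_def by (subst tendsto_Lim) auto
qed

text \<open>
  Dividing \<open>W2_exp_split_concave\<close> by \<open>2 r\<close> and letting \<open>r \<down> 0\<close> leaves the pairing on the right, which
  dissipativity controls. Its use is that the steps \<open>p\<close> and \<open>q\<close> in the two arguments are
  independent of each other.
\<close>

lemma dissipative_split_inequality:
  assumes F: "MPVF F" "dissipative lam F" and \<Phi>: "\<Phi> \<in> F" and \<Psi>: "\<Psi> \<in> F" and pq: "p > 0" "q > 0"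
  shows "((W2 (exp_push p \<Phi>) (base \<Psi>))\<^sup>2 - (W2 (base \<Phi>) (base \<Psi>))\<^sup>2) / p
      + ((W2 (base \<Phi>) (exp_push q \<Psi>))\<^sup>2 - (W2 (base \<Phi>) (base \<Psi>))\<^sup>2) / q
    \<le> 2 * lam * (W2 (base \<Phi>) (base \<Psi>))\<^sup>2 + p * (velocity_norm \<Phi>)\<^sup>2 + q * (velocity_norm \<Psi>)\<^sup>2"
proof -
  have P2: "\<Phi> \<in> P2" "\<Psi> \<in> P2" using F(1) \<Phi> \<Psi> by (auto simp: MPVF_def)
  define f0 fp fq a b where "f0 = (W2 (base \<Phi>) (base \<Psi>))\<^sup>2" and "fp = (W2 (exp_push p \<Phi>) (base \<Psi>))\<^sup>2"
    and "fq = (W2 (base \<Phi>) (exp_push q \<Psi>))\<^sup>2" and "a = (velocity_norm \<Phi>)\<^sup>2" and "b = (velocity_norm \<Psi>)\<^sup>2"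
  let ?L = "((fp - f0) / p + (fq - f0) / q - p * a - q * b) / 2"
  have "?L \<le> pairing \<Phi> \<Psi>"
  proof (rule tendsto_lowerbound[OF pairing_tendsto[OF P2]])
    \<comment> \<open>the weight of \<open>(0, 0)\<close> is nonnegative exactly for \<open>r \<le> R\<close>\<close>
    define R where "R = 1 / (1 / p + 1 / q)"
    have R: "R > 0" using pq by (simp add: R_def add_pos_pos)
    have "?L \<le> ((W2 (exp_push r \<Phi>) (exp_push r \<Psi>))\<^sup>2 - f0) / (2 * r)" if r: "0 < r" "r < R" for r
    proof -
      have "r / p + r / q = r / R" using pq by (simp add: R_def field_simps)
      also have "\<dots> \<le> 1" using r by simp
      finally have "(1 - r / p - r / q) * f0 + r / p * fp + r / q * fq 
         \<le> (W2 (exp_push r \<Phi>) (exp_push r \<Psi>))\<^sup>2 + r * p * a + r * q * b"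
        unfolding f0_def fp_def fq_def a_def b_def
        by (rule W2_exp_split_concave[OF P2 r(1) pq])
      then have "r * ((fp - f0) / p + (fq - f0) / q - p * a - q * b) \<le> (W2 (exp_push r \<Phi>) (exp_push r \<Psi>))\<^sup>2 - f0"
        by (simp add: algebra_simps diff_divide_distrib)
      moreover have "l / 2 \<le> D / (2 * r)" if "r * l \<le> D" for l D
        using r that by (simp add: pos_le_divide_eq mult_ac)
      ultimately show ?thesis by blast
    qed
    then show "\<forall>\<^sub>F r in at_right 0. ?L \<le> ((W2 (exp_push r \<Phi>) (exp_push r \<Psi>))\<^sup>2 - (W2 (base \<Phi>) (base \<Psi>))\<^sup>2) / (2 * r)"
      unfolding eventually_at_right_field f0_def using R by blast
  qed simp
  also have "pairing \<Phi> \<Psi> \<le> lam * f0"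
    using F(2) \<Phi> \<Psi> by (auto simp: dissipative_def f0_def)
  finally show ?thesis unfolding f0_def fp_def fq_def a_def b_def by simp
qed

text \<open>
  A measure is a plan with zero velocity. This makes the pairing with a measure a special case of
  the pairing of plans.
\<close>

definition at_rest :: "'a::{real_inner, polish_space} measure \<Rightarrow> ('a \<times> 'a) measure" where
  "at_rest \<nu> = distr \<nu> borel (\<lambda>x. (x, 0))"

lemma
  assumes \<nu>: "\<nu> \<in> P2"
  shows at_rest_in_P2: "at_rest \<nu> \<in> P2" and exp_push_at_rest: "exp_push s (at_rest \<nu>) = \<nu>"
    and base_at_rest: "base (at_rest \<nu>) = \<nu>"
proof -
  note [measurable_cong] = P2_sets[OF \<nu>]
  have m [measurable]: "(\<lambda>x. (x, 0 :: 'a)) \<in> borel_measurable \<nu>"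
    unfolding measurable_cong_sets[OF P2_sets[OF \<nu>] refl]
    by (intro borel_measurable_continuous_onI continuous_intros)
  show 1: "at_rest \<nu> \<in> P2"
    unfolding at_rest_def using P2_integrable[OF \<nu>]
    by (subst distr_in_P2_iff[OF P2_prob_space[OF \<nu>] m]) (simp add: norm_prod_def)
  have [measurable]: "(\<lambda>z :: 'a \<times> 'a. fst z + s *\<^sub>R snd z) \<in> borel_measurable borel" for s
    by (intro borel_measurable_continuous_onI continuous_intros)
  show 2: "exp_push s (at_rest \<nu>) = \<nu>" for s
    unfolding exp_push_def at_rest_def case_prod_beta
    by (subst distr_distr) (auto simp: comp_def P2_sets[OF \<nu>] intro!: distr_id2)
  show "base (at_rest \<nu>) = \<nu>" using exp_push_0[OF 1] 2[of 0] by simp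
qed

lemma pairing_meas_tendsto:
  assumes "\<Phi> \<in> P2" "\<nu> \<in> P2"
  shows "((\<lambda>s. ((W2 (exp_push s \<Phi>) \<nu>)\<^sup>2 - (W2 (base \<Phi>) \<nu>)\<^sup>2) / (2 * s)) \<longlongrightarrow> pairing_meas \<Phi> \<nu>) (at_right 0)"
proof -
  have "pairing_meas \<Phi> \<nu> = pairing \<Phi> (at_rest \<nu>)"
    unfolding pairing_meas_def pairing_def by (simp add: exp_push_at_rest base_at_rest assms)
  with pairing_tendsto[OF assms(1) at_rest_in_P2[OF assms(2)]] show ?thesis
    by (simp add: exp_push_at_rest base_at_rest assms)
qed


section \<open>Comparison of two Euler schemes\<close>

text \<open>
  Let \<open>p = \<eta> / (\<tau> + \<eta>)\<close>, \<open>q = \<tau> / (\<tau> + \<eta>)\<close>. A random walk that increases \<open>i\<close> with probability \<open>p\<close>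
  and \<open>j\<close> with probability \<open>q\<close> advances both times \<open>i \<tau>\<close>, \<open>j \<eta>\<close> by \<open>h\<close> in the mean, and
  the square of the lag \<open>i \<tau> - j \<eta>\<close> grows by \<open>\<tau> \<eta> = h (\<tau> + \<eta>)\<close> in the mean. By \<open>step\<close> the mean of \<open>a\<close> grows at
  most by \<open>h (2 \<lambda> a + L\<^sup>2 (\<tau> + \<eta>))\<close>. So the potential \<open>g = a + lag\<^sup>2\<close> satisfies a discrete Gronwall
  inequality in the mean, and one of the two neighbours does at least as well as the mean: following it
  keeps \<open>g\<close> below \<open>\<delta>\<^sup>2\<close>. A small lag in turn keeps the path in the region \<open>i \<tau> < T\<close>,
  \<open>j \<eta> < T\<close> where \<open>step\<close> is available, as long as \<open>k h \<le> T - \<delta>\<close>.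
\<close>

lemma greedy_lattice_path:
  fixes a :: "nat \<Rightarrow> nat \<Rightarrow> real" and \<tau> \<eta> T L lam \<delta> h :: real and k :: nat
  defines "h \<equiv> \<tau> * \<eta> / (\<tau> + \<eta>)"
  assumes pos: "\<tau> > 0" "\<eta> > 0" "\<delta> > 0" and a: "\<And>i j. a i j \<ge> 0"
    and step: "\<And>i j. i * \<tau> < T \<Longrightarrow> j * \<eta> < T \<Longrightarrow>
      (a (Suc i) j - a i j) / \<tau> + (a i (Suc j) - a i j) / \<eta> \<le> 2 * lam * a i j + L\<^sup>2 * (\<tau> + \<eta>)"
    and B: "exp (2 * \<bar>lam\<bar> * T) * (a 0 0 + T * ((\<tau> + \<eta>) * (L\<^sup>2 + 1))) < \<delta>\<^sup>2"
    and k: "k * h \<le> T - \<delta>"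
  shows "\<exists>i j. a i j < \<delta>\<^sup>2 \<and> \<bar>i * \<tau> - k * h\<bar> < \<delta> \<and> \<bar>j * \<eta> - k * h\<bar> < \<delta>"
proof -
  define c where "c = (\<tau> + \<eta>) * (L\<^sup>2 + 1)"
  define lm where "lm = 2 * \<bar>lam\<bar>"
  define g where "g = (\<lambda>i j. a i j + (i * \<tau> - j * \<eta>)\<^sup>2)"
  define E where "E = (\<lambda>k :: nat. exp (lm * (k * h)) * (a 0 0 + k * h * c))"
  have h: "h > 0" using pos by (simp add: h_def)
  have c: "c \<ge> 0" using pos by (simp add: c_def)
  have lm: "lm \<ge> 0" by (simp add: lm_def)
  have EB: "E k < \<delta>\<^sup>2" if "k * h \<le> T - \<delta>" for k :: nat
  proof -
    have "E k \<le> exp (lm * T) * (a 0 0 + T * c)"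
      unfolding E_def using that pos h c lm a[of 0 0]
      by (intro mult_mono add_left_mono mult_right_mono) (auto intro!: mult_left_mono add_nonneg_nonneg)
    then show ?thesis using B by (simp add: lm_def c_def)
  qed
  have algebraic: "x * \<tau> - (x + y) * (\<tau> * \<eta> / (\<tau> + \<eta>)) = \<tau> / (\<tau> + \<eta>) * (x * \<tau> - y * \<eta>)"
    "y * \<eta> - (x + y) * (\<tau> * \<eta> / (\<tau> + \<eta>)) = - (\<eta> / (\<tau> + \<eta>) * (x * \<tau> - y * \<eta>))" for x y :: real
  proof -
    have "\<tau> + \<eta> \<noteq> 0" using pos by simp
    then show "x * \<tau> - (x + y) * (\<tau> * \<eta> / (\<tau> + \<eta>)) = \<tau> / (\<tau> + \<eta>) * (x * \<tau> - y * \<eta>)"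
      "y * \<eta> - (x + y) * (\<tau> * \<eta> / (\<tau> + \<eta>)) = - (\<eta> / (\<tau> + \<eta>) * (x * \<tau> - y * \<eta>))"
      by (simp_all add: field_simps)
  qed
  \<comment> \<open>after \<open>i + j\<close> moves both clocks differ from the mean time \<open>(i + j) h\<close> by at most the lag\<close>
  have loc: "\<bar>i * \<tau> - (i + j) * h\<bar> \<le> \<bar>i * \<tau> - j * \<eta>\<bar>" "\<bar>j * \<eta> - (i + j) * h\<bar> \<le> \<bar>i * \<tau> - j * \<eta>\<bar>" for i j :: nat
  proof -
    have "i * \<tau> - (i + j) * h = \<tau> / (\<tau> + \<eta>) * (i * \<tau> - j * \<eta>)"
      "j * \<eta> - (i + j) * h = - (\<eta> / (\<tau> + \<eta>) * (i * \<tau> - j * \<eta>))"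
      using algebraic[where x="real i" and y="real j"] by (simp_all add: h_def)
    moreover have "\<bar>\<tau> / (\<tau> + \<eta>)\<bar> \<le> 1" "\<bar>\<eta> / (\<tau> + \<eta>)\<bar> \<le> 1" using pos by auto
    ultimately show "\<bar>i * \<tau> - (i + j) * h\<bar> \<le> \<bar>i * \<tau> - j * \<eta>\<bar>" "\<bar>j * \<eta> - (i + j) * h\<bar> \<le> \<bar>i * \<tau> - j * \<eta>\<bar>"
      by (simp_all only: abs_mult abs_minus_cancel mult_left_le_one_le abs_ge_zero)
  qed
  have near: "a i j < \<delta>\<^sup>2 \<and> \<bar>i * \<tau> - (i + j) * h\<bar> < \<delta> \<and> \<bar>j * \<eta> - (i + j) * h\<bar> < \<delta>" if "g i j < \<delta>\<^sup>2" for i j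
  proof -
    have "(i * \<tau> - j * \<eta>)\<^sup>2 < \<delta>\<^sup>2" "a i j < \<delta>\<^sup>2"
      using that a[of i j] zero_le_power2[of "i * \<tau> - j * \<eta>"] unfolding g_def by linarith+
    moreover have "\<bar>i * \<tau> - j * \<eta>\<bar> < \<delta>"
    proof (rule power2_less_imp_less)
      show "\<bar>i * \<tau> - j * \<eta>\<bar>\<^sup>2 < \<delta>\<^sup>2" using \<open>(i * \<tau> - j * \<eta>)\<^sup>2 < \<delta>\<^sup>2\<close> by simp
      show "0 \<le> \<delta>" using pos by simp
    qed
    ultimately show ?thesis using loc[where i=i and j=j] unfolding of_nat_add by linarith
  qed
  have "\<exists>i j. i + j = k \<and> g i j \<le> E k" if "k * h \<le> T - \<delta>" for k
    using that
  proof (induction k)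
    case 0
    show ?case by (intro exI[of _ 0]) (simp add: g_def E_def)
  next
    case (Suc k)
    have kh: "k * h \<le> T - \<delta>" using Suc.prems h by (simp add: algebra_simps)
    then obtain i j where ij: "i + j = k" "g i j \<le> E k" using Suc.IH by auto
    have "\<bar>i * \<tau> - k * h\<bar> < \<delta>" "\<bar>j * \<eta> - k * h\<bar> < \<delta>"
      using near[of i j] ij EB[OF kh] by auto
    then have inside: "i * \<tau> < T" "j * \<eta> < T" using kh by linarith+
    define p q where "p = \<eta> / (\<tau> + \<eta>)" and "q = \<tau> / (\<tau> + \<eta>)"
    have pq: "p > 0" "q > 0" "p + q = 1" using pos by (auto simp: p_def q_def add_divide_distrib[symmetric] add.commute)
    define d where "d = i * \<tau> - j * \<eta>"
    have ph: "p * x = h * (x / \<tau>)" "q * x = h * (x / \<eta>)" for x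
      using pos by (simp_all add: p_def q_def h_def)
    have "p * a (Suc i) j + q * a i (Suc j) = a i j + h * ((a (Suc i) j - a i j) / \<tau> + (a i (Suc j) - a i j) / \<eta>)"
    proof -
      have "p * a (Suc i) j + q * a i (Suc j) = (p + q) * a i j + (p * (a (Suc i) j - a i j) + q * (a i (Suc j) - a i j))"
        by (simp only: distrib_left distrib_right right_diff_distrib)
      then show ?thesis unfolding pq(3) ph(1)[of "a (Suc i) j - a i j"] ph(2)[of "a i (Suc j) - a i j"]
        by (simp add: distrib_left)
    qed
    also have "\<dots> \<le> a i j + h * (2 * lam * a i j + L\<^sup>2 * (\<tau> + \<eta>))"
      using step[OF inside] h by (intro add_left_mono mult_left_mono) auto
    also have "\<dots> \<le> a i j + h * (lm * a i j + L\<^sup>2 * (\<tau> + \<eta>))"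
      unfolding lm_def using a[of i j] h by (intro add_left_mono mult_left_mono add_right_mono mult_right_mono) auto
    finally have 1: "p * a (Suc i) j + q * a i (Suc j) \<le> a i j + h * (lm * a i j + L\<^sup>2 * (\<tau> + \<eta>))" .
    have 2: "p * (Suc i * \<tau> - j * \<eta>)\<^sup>2 + q * (i * \<tau> - Suc j * \<eta>)\<^sup>2 = d\<^sup>2 + h * (\<tau> + \<eta>)"
    proof -
      have "p * (Suc i * \<tau> - j * \<eta>)\<^sup>2 + q * (i * \<tau> - Suc j * \<eta>)\<^sup>2 = p * (d + \<tau>)\<^sup>2 + q * (d - \<eta>)\<^sup>2"
        by (simp add: d_def algebra_simps)
      also have "\<dots> = (p + q) * d\<^sup>2 + 2 * d * (p * \<tau> - q * \<eta>) + (p * \<tau>) * \<tau> + (q * \<eta>) * \<eta>"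
        by (simp add: power2_eq_square algebra_simps)
      also have "\<dots> = d\<^sup>2 + h * \<tau> + h * \<eta>"
      proof -
        have "p * \<tau> = h" "q * \<eta> = h" by (auto simp: p_def q_def h_def)
        then show ?thesis by (simp add: pq)
      qed
      finally show ?thesis by (simp add: algebra_simps)
    qed
    have "p * g (Suc i) j + q * g i (Suc j) \<le> a i j + h * (lm * a i j + L\<^sup>2 * (\<tau> + \<eta>)) + d\<^sup>2 + h * (\<tau> + \<eta>)"
      using 1 2 unfolding g_def by (simp add: distrib_left)
    also have "\<dots> \<le> (1 + lm * h) * g i j + h * c"
      using lm h mult_nonneg_nonneg[of "lm * h" "d\<^sup>2"] by (simp add: g_def d_def c_def algebra_simps)
    also have "\<dots> \<le> (1 + lm * h) * E k + h * c"
      using ij(2) lm h by (intro add_right_mono mult_left_mono) auto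
    also have "\<dots> \<le> exp (lm * h) * E k + exp (lm * (Suc k * h)) * (h * c)"
    proof (intro add_mono mult_right_mono exp_ge_add_one_self)
      show "0 \<le> E k" using a[of 0 0] h c by (simp add: E_def)
      have "1 \<le> exp (lm * (Suc k * h))" using lm h by simp
      then show "h * c \<le> exp (lm * (Suc k * h)) * (h * c)"
        using mult_right_mono[of 1 _ "h * c"] h c by simp
    qed
    also have "\<dots> = E (Suc k)"
      by (simp add: E_def exp_add[symmetric] algebra_simps)
    finally have le: "p * g (Suc i) j + q * g i (Suc j) \<le> E (Suc k)" .
    have "g (Suc i) j \<le> E (Suc k) \<or> g i (Suc j) \<le> E (Suc k)"
    proof (rule ccontr)
      assume "\<not> ?thesis"
      then have "p * E (Suc k) < p * g (Suc i) j" "q * E (Suc k) < q * g i (Suc j)"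
        using pq by auto
      then have "(p + q) * E (Suc k) < p * g (Suc i) j + q * g i (Suc j)" by (simp add: distrib_right)
      with le pq show False by simp
    qed
    then show ?case using ij(1) by (metis add_Suc add_Suc_right)
  qed
  from this[OF k] obtain i j where "i + j = k" "g i j \<le> E k" by auto
  with near[of i j] EB[OF k] show ?thesis by (intro exI[of _ i] exI[of _ j]) auto
qed

text \<open>
  The interpolation of a stable discrete solution together with its nodes and plans. The initial
  measure is \<open>m 0\<close>.
\<close>

locale euler_curve =
  fixes F :: "('a::{real_inner, polish_space} \<times> 'a) measure set" and lam T L \<tau> :: real
    and m :: "real \<Rightarrow> 'a measure" and N :: nat and M :: "nat \<Rightarrow> 'a measure" and \<Phi> :: "nat \<Rightarrow> ('a \<times> 'a) measure"
  assumes F: "MPVF F" "dissipative lam F" and T: "T > 0" and L: "L > 0" and \<tau>: "\<tau> > 0"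
    and N: "N = Euler_steps \<tau> T"
    and sol: "stable_discrete_solution F (m 0) \<tau> T L M \<Phi>"
    and interpolates: "\<And>n t. n < N \<Longrightarrow> real n * \<tau> \<le> t \<Longrightarrow> t \<le> real (n + 1) * \<tau> \<Longrightarrow> 0 \<le> t \<Longrightarrow> t \<le> T \<Longrightarrow>
        m t = exp_push (t - real n * \<tau>) (\<Phi> n)"
begin

lemma less_N_iff: "n < N \<longleftrightarrow> real n * \<tau> < T"
proof -
  have "n < N \<longleftrightarrow> real n < T / \<tau>"
    unfolding N Euler_steps_def zless_nat_eq_int_zless by (simp add: less_ceiling_iff)
  then show ?thesis using \<tau> by (simp add: field_simps)
qed

lemma plan: assumes "n < N" shows "\<Phi> n \<in> F" "\<Phi> n \<in> P2" "base (\<Phi> n) = M n" "velocity_norm (\<Phi> n) \<le> L"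
    "exp_push \<tau> (\<Phi> n) = M (Suc n)"
  using sol assms F(1) unfolding stable_discrete_solution_def N sections_def MPVF_def by auto

lemma velocity_power2_le: "n < N \<Longrightarrow> (velocity_norm (\<Phi> n))\<^sup>2 \<le> L\<^sup>2"
  using plan(2,4)[of n] by (intro power_mono velocity_norm_nonneg) auto

lemma N_pos: "0 < N" using T by (simp add: less_N_iff)

lemma within_step:
  assumes "n < N" "0 \<le> r" "r \<le> \<tau>" "real n * \<tau> + r \<le> T"
  shows "m (real n * \<tau> + r) = exp_push r (\<Phi> n)"
  using interpolates[of n "real n * \<tau> + r"] assms \<tau> by (simp add: algebra_simps)

lemma node: "n < N \<Longrightarrow> m (real n * \<tau>) = M n"
  using within_step[of n 0] \<tau> plan[of n] by (auto simp: exp_push_0 less_N_iff)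

lemma node_in_dom: "n < N \<Longrightarrow> m (real n * \<tau>) \<in> mpvf_dom F"
  using plan[of n] node[of n] unfolding mpvf_dom_def by (auto intro: rev_image_eqI)

lemma previous_node:
  assumes "0 \<le> t" "t \<le> T"
  obtains n r where "n < N" "0 \<le> r" "r \<le> \<tau>" "t = real n * \<tau> + r"
proof (cases "nat \<lfloor>t / \<tau>\<rfloor> < N")
  case True
  have f: "real (nat \<lfloor>t / \<tau>\<rfloor>) = of_int \<lfloor>t / \<tau>\<rfloor>" using assms \<tau> by simp
  have "of_int \<lfloor>t / \<tau>\<rfloor> * \<tau> \<le> t" "t \<le> (of_int \<lfloor>t / \<tau>\<rfloor> + 1) * \<tau>"
    using floor_correct[of "t / \<tau>"] \<tau> by (auto simp: pos_le_divide_eq[symmetric] pos_divide_le_eq[symmetric])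
  then show ?thesis using True f
    by (intro that[of "nat \<lfloor>t / \<tau>\<rfloor>" "t - real (nat \<lfloor>t / \<tau>\<rfloor>) * \<tau>"]) (auto simp: algebra_simps)
next
  case False
  then have "N \<le> nat \<lfloor>t / \<tau>\<rfloor>" by simp
  then have "real N \<le> real (nat \<lfloor>t / \<tau>\<rfloor>)" by simp
  also have "\<dots> = of_int \<lfloor>t / \<tau>\<rfloor>" using assms \<tau> by simp
  also have "\<dots> \<le> t / \<tau>" by simp
  finally have "real N * \<tau> \<le> t" using \<tau> by (simp add: pos_le_divide_eq)
  moreover have "T \<le> real N * \<tau>" using less_N_iff[of N] by simp
  ultimately have "t = real N * \<tau>" using assms by simp
  moreover obtain k where k: "N = Suc k" using N_pos gr0_implies_Suc by blast
  ultimately have "t = real k * \<tau> + \<tau>" by (simp add: algebra_simps)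
  then show ?thesis using k \<tau> by (intro that[of k \<tau>]) auto
qed

lemma curve_in_P2:
  assumes "0 \<le> t" "t \<le> T" shows "m t \<in> P2"
proof -
  obtain n r where nr: "n < N" "0 \<le> r" "r \<le> \<tau>" "t = real n * \<tau> + r"
    by (rule previous_node[OF assms])
  then have "m t = exp_push r (\<Phi> n)" using assms by (simp add: within_step)
  then show ?thesis using exp_push_in_P2[OF plan(2)[OF nr(1)]] by simp
qed

text \<open>
  Within one step the curve moves along one plan, at speed at most \<open>L\<close>.
\<close>

lemma Lipschitz_within_step:
  assumes n: "n < N" and "real n * \<tau> \<le> s" "s \<le> t" "t \<le> real (n + 1) * \<tau>" "t \<le> T"
  shows "W2 (m s) (m t) \<le> L * (t - s)"
proof -
  have s: "0 \<le> s" using assms(2) \<tau> by (meson mult_nonneg_nonneg of_nat_0_le_iff less_imp_le order_trans)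
  have "W2 (m s) (m t) \<le> \<bar>(s - real n * \<tau>) - (t - real n * \<tau>)\<bar> * velocity_norm (\<Phi> n)"
    using interpolates[of n s] interpolates[of n t] assms s
      exp_push_Lipschitz[OF plan(2)[OF n], of "s - real n * \<tau>" "t - real n * \<tau>"] by simp
  also have "\<dots> \<le> (t - s) * L"
    using assms plan(4)[OF n] by (intro mult_mono) (auto simp: velocity_norm_nonneg plan(2)[OF n])
  finally show ?thesis by (simp add: mult.commute)
qed

lemma Lipschitz_aux:
  "0 \<le> s \<Longrightarrow> s \<le> t \<Longrightarrow> t \<le> T \<Longrightarrow> t \<le> real (n + 1) * \<tau> \<Longrightarrow> W2 (m s) (m t) \<le> L * (t - s)"
proof (induction n arbitrary: t)
  case 0
  then show ?case by (intro Lipschitz_within_step[of 0]) (auto simp: N_pos)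
next
  case (Suc n)
  let ?u = "real (n + 1) * \<tau>"
  show ?case
  proof (cases "t \<le> ?u")
    case True
    then show ?thesis using Suc by auto
  next
    case False
    then have n: "Suc n < N" using Suc.prems by (simp add: less_N_iff)
    show ?thesis
    proof (cases "?u \<le> s")
      case True
      then show ?thesis using n Suc.prems by (intro Lipschitz_within_step[of "Suc n"]) auto
    next
      case us: False
      have u: "0 \<le> ?u" using \<tau> by simp
      have 1: "W2 (m s) (m ?u) \<le> L * (?u - s)"
        using Suc.prems False us by (intro Suc.IH) auto
      have 2: "W2 (m ?u) (m t) \<le> L * (t - ?u)"
        using n Suc.prems False by (intro Lipschitz_within_step[of "Suc n"]) auto
      have "W2 (m s) (m t) \<le> W2 (m s) (m ?u) + W2 (m ?u) (m t)"
        using Suc.prems False u us by (intro W2_triangle curve_in_P2) auto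
      also have "\<dots> \<le> L * (?u - s) + L * (t - ?u)" using 1 2 by (rule add_mono)
      finally show ?thesis by (simp add: algebra_simps)
    qed
  qed
qed

lemma Lipschitz:
  assumes "0 \<le> s" "s \<le> T" "0 \<le> t" "t \<le> T"
  shows "W2 (m s) (m t) \<le> L * \<bar>s - t\<bar>"
proof -
  have *: "W2 (m s) (m t) \<le> L * (t - s)" if "0 \<le> s" "s \<le> t" "t \<le> T" for s t
  proof -
    obtain n where "t / \<tau> < real n" using reals_Archimedean2 by blast
    then have "t \<le> real (n + 1) * \<tau>" using \<tau> by (simp add: pos_divide_less_eq algebra_simps)
    with that show ?thesis by (rule Lipschitz_aux)
  qed
  show ?thesis
  proof (cases "s \<le> t")
    case True
    then show ?thesis using *[of s t] assms by simp
  next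
    case False
    then show ?thesis using *[of t s] assms W2_commute[of "m s" "m t"] by (simp add: curve_in_P2)
  qed
qed

end

text \<open>
  Up to time \<open>T - \<delta>\<close> the greedy path supplies nodes of both curves at distance less than \<open>\<delta>\<close> whose
  times differ from the given one by at most \<open>\<delta> + \<tau>\<close>; the Lipschitz bound bridges these gaps as
  well as the final interval of length \<open>\<delta>\<close>.
\<close>

lemma two_euler_curves_close:
  assumes m: "euler_curve F lam T L \<tau> m N M \<Phi>" and m': "euler_curve F lam T L \<eta> m' N' M' \<Phi>'"
    and \<delta>: "0 < \<delta>" "\<delta> < T"
    and B: "exp (2 * \<bar>lam\<bar> * T) * ((W2 (m 0) (m' 0))\<^sup>2 + T * ((\<tau> + \<eta>) * (L\<^sup>2 + 1))) < \<delta>\<^sup>2"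
    and t: "0 \<le> t" "t \<le> T"
  shows "W2 (m t) (m' t) \<le> \<delta> + 4 * L * \<delta> + 2 * L * \<tau>"
proof -
  interpret m: euler_curve F lam T L \<tau> m N M \<Phi> by fact
  interpret m': euler_curve F lam T L \<eta> m' N' M' \<Phi>' by fact
  define a where "a = (\<lambda>i j. (W2 (M i) (M' j))\<^sup>2)"
  define h where "h = \<tau> * \<eta> / (\<tau> + \<eta>)"
  have h: "h > 0" "h \<le> \<tau>" using m.\<tau> m'.\<tau> by (auto simp: h_def field_simps)
  have early: "W2 (m s) (m' s) \<le> \<delta> + 2 * L * \<tau> + 2 * L * \<delta>" if s: "0 \<le> s" "s \<le> T - \<delta>" for s
  proof -
    define k where "k = nat \<lfloor>s / h\<rfloor>"
    have kf: "real k = of_int \<lfloor>s / h\<rfloor>" using s h by (simp add: k_def)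
    have k: "k * h \<le> s" "s \<le> k * h + h"
    proof -
      have "real k \<le> s / h" "s / h < real k + 1" unfolding kf by linarith+
      then have "real k * h \<le> s" "s < (real k + 1) * h"
        using h(1) by (simp_all only: pos_le_divide_eq pos_divide_less_eq)
      then show "k * h \<le> s" "s \<le> k * h + h" by (simp_all add: algebra_simps)
    qed
    have "\<exists>i j. a i j < \<delta>\<^sup>2 \<and> \<bar>i * \<tau> - k * h\<bar> < \<delta> \<and> \<bar>j * \<eta> - k * h\<bar> < \<delta>"
      unfolding h_def
    proof (rule greedy_lattice_path[where T=T and L=L and lam=lam])
      fix i j :: nat assume "i * \<tau> < T" "j * \<eta> < T"
      then have ij: "i < N" "j < N'" by (auto simp: m.less_N_iff m'.less_N_iff)
      have "(a (Suc i) j - a i j) / \<tau> + (a i (Suc j) - a i j) / \<eta> \<le> 2 * lam * a i j 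
          + \<tau> * (velocity_norm (\<Phi> i))\<^sup>2 + \<eta> * (velocity_norm (\<Phi>' j))\<^sup>2"
        using dissipative_split_inequality[OF m.F m.plan(1)[OF ij(1)] m'.plan(1)[OF ij(2)] m.\<tau> m'.\<tau>]
        by (simp add: a_def m.plan[OF ij(1)] m'.plan[OF ij(2)])
      also have "\<dots> \<le> 2 * lam * a i j + \<tau> * L\<^sup>2 + \<eta> * L\<^sup>2"
        using mult_left_mono[OF m.velocity_power2_le[OF ij(1)], of \<tau>]
          mult_left_mono[OF m'.velocity_power2_le[OF ij(2)], of \<eta>] m.\<tau> m'.\<tau> by linarith
      finally show "(a (Suc i) j - a i j) / \<tau> + (a i (Suc j) - a i j) / \<eta> \<le> 2 * lam * a i j + L\<^sup>2 * (\<tau> + \<eta>)"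
        by (simp add: algebra_simps)
    next
      show "exp (2 * \<bar>lam\<bar> * T) * (a 0 0 + T * ((\<tau> + \<eta>) * (L\<^sup>2 + 1))) < \<delta>\<^sup>2"
        using B m.node[OF m.N_pos] m'.node[OF m'.N_pos] by (simp add: a_def)
      show "k * (\<tau> * \<eta> / (\<tau> + \<eta>)) \<le> T - \<delta>"
        using k s by (simp add: h_def)
    qed (use m.\<tau> m'.\<tau> \<delta> in \<open>auto simp: a_def\<close>)
    then obtain i j where ij: "a i j < \<delta>\<^sup>2" "\<bar>i * \<tau> - k * h\<bar> < \<delta>" "\<bar>j * \<eta> - k * h\<bar> < \<delta>" by blast
    have i: "i < N" "i * \<tau> \<le> T" "0 \<le> i * \<tau>" and j: "j < N'" "j * \<eta> \<le> T" "0 \<le> j * \<eta>"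
      using ij k s m.\<tau> m'.\<tau> by (auto simp: m.less_N_iff m'.less_N_iff)
    have st: "0 \<le> s" "s \<le> T" using s \<delta> by auto
    have w: "W2 (m (i * \<tau>)) (m' (j * \<eta>)) < \<delta>"
      using ij(1) \<delta> i j by (auto simp: a_def m.node m'.node intro: power_less_imp_less_base)
    have "W2 (m s) (m (i * \<tau>)) \<le> L * (\<tau> + \<delta>)"
    proof -
      have "\<bar>s - i * \<tau>\<bar> \<le> \<tau> + \<delta>" using ij(2) k h by linarith
      then show ?thesis using m.Lipschitz[OF st i(3,2)] m.L
        by (meson mult_left_mono less_imp_le order_trans)
    qed
    moreover have "W2 (m' (j * \<eta>)) (m' s) \<le> L * (\<tau> + \<delta>)"
    proof -
      have "\<bar>j * \<eta> - s\<bar> \<le> \<tau> + \<delta>" using ij(3) k h by linarith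
      then show ?thesis using m'.Lipschitz[OF j(3,2) st] m.L
        by (meson mult_left_mono less_imp_le order_trans)
    qed
    moreover have "W2 (m s) (m' s) \<le> W2 (m s) (m (i * \<tau>)) + (W2 (m (i * \<tau>)) (m' (j * \<eta>)) + W2 (m' (j * \<eta>)) (m' s))"
      using W2_triangle[of "m s" "m (i * \<tau>)" "m' s"] W2_triangle[of "m (i * \<tau>)" "m' (j * \<eta>)" "m' s"]
      using m.curve_in_P2[OF st] m.curve_in_P2[OF i(3,2)] m'.curve_in_P2[OF st] m'.curve_in_P2[OF j(3,2)] by linarith
    ultimately show ?thesis using w by (simp add: algebra_simps)
  qed
  show ?thesis
  proof (cases "t \<le> T - \<delta>")
    case True
    have "0 \<le> 2 * L * \<delta>" using m.L \<delta> by simp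
    with early[OF t(1) True] show ?thesis by linarith
  next
    case False
    define s where "s = T - \<delta>"
    have s: "0 \<le> s" "s \<le> T" "s \<le> T - \<delta>" "\<bar>t - s\<bar> \<le> \<delta>" "\<bar>s - t\<bar> \<le> \<delta>" using \<delta> t False by (auto simp: s_def)
    have "W2 (m t) (m s) \<le> L * \<delta>"
      using m.Lipschitz[OF t s(1,2)] s(4) m.L by (meson mult_left_mono less_imp_le order_trans)
    moreover have "W2 (m' s) (m' t) \<le> L * \<delta>"
      using m'.Lipschitz[OF s(1,2) t] s(5) m.L by (meson mult_left_mono less_imp_le order_trans)
    moreover have "W2 (m t) (m' t) \<le> W2 (m t) (m s) + (W2 (m s) (m' s) + W2 (m' s) (m' t))"
      using W2_triangle[of "m t" "m s" "m' t"] W2_triangle[of "m s" "m' s" "m' t"]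
      using m.curve_in_P2[OF t] m.curve_in_P2[OF s(1,2)] m'.curve_in_P2[OF t] m'.curve_in_P2[OF s(1,2)] by linarith
    ultimately show ?thesis using early[OF s(1,3)] by linarith
  qed
qed


section \<open>The limit curve\<close>

lemma euler_curve_of_Euler_curves:
  assumes F: "MPVF F" "dissipative lam F" and pos: "T > 0" "L > 0" "\<tau> > 0" and m: "m \<in> Euler_curves F \<mu>0 \<tau> T L"
  obtains N M \<Phi> where "euler_curve F lam T L \<tau> m N M \<Phi>" "m 0 = \<mu>0"
proof -
  obtain M \<Phi> where sol: "stable_discrete_solution F \<mu>0 \<tau> T L M \<Phi>"
    and i: "\<And>n t. n < Euler_steps \<tau> T \<Longrightarrow> t \<in> {real n * \<tau> .. real (n + 1) * \<tau>} \<inter> {0..T} \<Longrightarrow> m t = exp_push (t - real n * \<tau>) (\<Phi> n)"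
    using m unfolding Euler_curves_def by blast
  have N: "0 < Euler_steps \<tau> T" using pos by (simp add: Euler_steps_def)
  have "m 0 = exp_push (0 - real 0 * \<tau>) (\<Phi> 0)" using pos by (intro i[OF N]) auto
  also have "\<dots> = base (\<Phi> 0)"
  proof -
    have "\<Phi> 0 \<in> P2" using sol N F(1) unfolding stable_discrete_solution_def sections_def MPVF_def by auto
    then show ?thesis by (simp add: exp_push_0)
  qed
  also have "\<dots> = \<mu>0" using sol N unfolding stable_discrete_solution_def sections_def by auto
  finally have m0: "m 0 = \<mu>0" .
  have "euler_curve F lam T L \<tau> m (Euler_steps \<tau> T) M \<Phi>"
    using F pos sol i by unfold_locales (auto simp: m0)
  with m0 that show ?thesis by blast
qed

text \<open>
  Completeness applied at each \<open>t\<close> separately; the rate of convergence does not depend on \<open>t\<close>.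
\<close>

lemma W2_uniform_limit:
  fixes m :: "nat \<Rightarrow> 't \<Rightarrow> 'a::{real_inner, polish_space} measure"
  assumes P2: "\<And>n t. t \<in> S \<Longrightarrow> m n t \<in> P2"
    and Cauchy: "\<And>e. e > 0 \<Longrightarrow> \<exists>n0. \<forall>k\<ge>n0. \<forall>l\<ge>n0. \<forall>t\<in>S. W2 (m k t) (m l t) < e"
  shows "\<exists>\<mu>. (\<forall>t\<in>S. \<mu> t \<in> P2) \<and> (\<forall>e>0. \<forall>\<^sub>F n in sequentially. \<forall>t\<in>S. W2 (m n t) (\<mu> t) < e)"
proof -
  have "\<forall>i. \<exists>n0. \<forall>k\<ge>n0. \<forall>l\<ge>n0. \<forall>t\<in>S. W2 (m k t) (m l t) < (1/2)^i"
    using Cauchy by simp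
  from choice[OF this] obtain n0 where n0: "\<And>i k l t. k \<ge> n0 i \<Longrightarrow> l \<ge> n0 i \<Longrightarrow> t \<in> S \<Longrightarrow> W2 (m k t) (m l t) < (1/2)^i"
    by blast
  \<comment> \<open>beyond \<open>n0 i\<close> at the indices \<open>i\<close> and \<open>i + 1\<close>, and unbounded\<close>
  define r where "r = (\<lambda>i. i + (\<Sum>j\<le>i. n0 j))"
  have r: "n0 i \<le> r i" "n0 i \<le> r (Suc i)" "i \<le> r i" for i
  proof -
    have "n0 i \<le> (\<Sum>j\<le>i. n0 j)" "n0 i \<le> (\<Sum>j\<le>Suc i. n0 j)" by (rule member_le_sum; simp)+
    then show "n0 i \<le> r i" "n0 i \<le> r (Suc i)" "i \<le> r i" by (simp_all add: r_def)
  qed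
  have "\<forall>t. \<exists>\<nu>. t \<in> S \<longrightarrow> \<nu> \<in> P2 \<and> (\<lambda>i. W2 (m (r i) t) \<nu>) \<longlonglongrightarrow> 0"
  proof
    fix t
    show "\<exists>\<nu>. t \<in> S \<longrightarrow> \<nu> \<in> P2 \<and> (\<lambda>i. W2 (m (r i) t) \<nu>) \<longlonglongrightarrow> 0"
    proof (cases "t \<in> S")
      case True
      have "W2 (m (r i) t) (m (r (Suc i)) t) < (1/2)^i" for i
        using n0[OF r(1,2) True] .
      then obtain \<nu> where "\<nu> \<in> P2" "(\<lambda>i. W2 (m (r i) t) \<nu>) \<longlonglongrightarrow> 0"
        using W2_complete_sequence[of "\<lambda>i. m (r i) t"] P2[OF True] by blast
      then show ?thesis by blast
    qed auto
  qed
  from choice[OF this] obtain \<mu> where \<mu>: "\<And>t. t \<in> S \<Longrightarrow> \<mu> t \<in> P2"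
    and lim: "\<And>t. t \<in> S \<Longrightarrow> (\<lambda>i. W2 (m (r i) t) (\<mu> t)) \<longlonglongrightarrow> 0" by blast
  show ?thesis
  proof (intro exI[of _ \<mu>] conjI ballI allI impI)
    show "\<mu> t \<in> P2" if "t \<in> S" for t by (rule \<mu>[OF that])
    fix e :: real assume "e > 0"
    then obtain N where N: "\<And>k l t. k \<ge> N \<Longrightarrow> l \<ge> N \<Longrightarrow> t \<in> S \<Longrightarrow> W2 (m k t) (m l t) < e / 2"
      using Cauchy[of "e / 2"] by auto
    have "W2 (m n t) (\<mu> t) < e" if n: "n \<ge> N" and t: "t \<in> S" for n t
    proof -
      have "(\<lambda>i. e / 2 + W2 (m (r i) t) (\<mu> t)) \<longlonglongrightarrow> e / 2 + 0"
        by (intro tendsto_intros lim t)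
      moreover have "\<forall>\<^sub>F i in sequentially. W2 (m n t) (\<mu> t) \<le> e / 2 + W2 (m (r i) t) (\<mu> t)"
        using eventually_ge_at_top[of N]
      proof eventually_elim
        case (elim i)
        have "W2 (m n t) (\<mu> t) \<le> W2 (m n t) (m (r i) t) + W2 (m (r i) t) (\<mu> t)"
          by (intro W2_triangle P2 \<mu> t)
        also have "W2 (m n t) (m (r i) t) < e / 2" using n t elim r(3)[of i] by (intro N) auto
        finally show ?case by simp
      qed
      ultimately have "W2 (m n t) (\<mu> t) \<le> e / 2 + 0"
        by (intro tendsto_lowerbound[of "\<lambda>i. e / 2 + W2 (m (r i) t) (\<mu> t)"]) auto
      then show ?thesis using \<open>e > 0\<close> by simp
    qed
    then show "\<forall>\<^sub>F n in sequentially. \<forall>t\<in>S. W2 (m n t) (\<mu> t) < e"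
      unfolding eventually_sequentially by blast
  qed
qed

lemma euler_curves_uniformly_Cauchy:
  assumes m: "\<And>n. euler_curve F lam T L (\<tau> n) (m n) (N n) (M n) (\<Phi> n)"
    and \<tau>: "\<tau> \<longlonglongrightarrow> 0" and \<mu>0: "\<mu>0 \<in> P2" and init: "(\<lambda>n. W2 (m n 0) \<mu>0) \<longlonglongrightarrow> 0" and e: "e > 0"
  shows "\<exists>n0. \<forall>k\<ge>n0. \<forall>l\<ge>n0. \<forall>t\<in>{0..T}. W2 (m k t) (m l t) < e"
proof -
  interpret m0: euler_curve F lam T L "\<tau> 0" "m 0" "N 0" "M 0" "\<Phi> 0" by (rule m)
  note T = m0.T and L = m0.L
  \<comment> \<open>makes the part \<open>\<delta> + 4 L \<delta>\<close> of the comparison estimate at most \<open>e / 4\<close>\<close>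
  define \<delta> where "\<delta> = min (T / 2) (e / (4 * (1 + 4 * L)))"
  have \<delta>: "0 < \<delta>" "\<delta> < T" using T L e by (auto simp: \<delta>_def)
  have "\<delta> * (1 + 4 * L) \<le> e / (4 * (1 + 4 * L)) * (1 + 4 * L)"
    using L by (intro mult_right_mono) (auto simp: \<delta>_def)
  also have "\<dots> = e / 4"
  proof -
    have "1 + 4 * L \<noteq> 0" using L by simp
    then show ?thesis by (simp only: mult.commute[of 4] divide_divide_eq_left[symmetric] times_divide_eq_left nonzero_mult_div_cancel_right) simp
  qed
  finally have \<delta>e: "\<delta> + 4 * L * \<delta> \<le> e / 4" by (simp add: algebra_simps)
  define G where "G = (\<lambda>\<rho>. exp (2 * \<bar>lam\<bar> * T) * ((2 * \<rho>)\<^sup>2 + T * ((2 * \<rho>) * (L\<^sup>2 + 1))))"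
  have "(G \<longlongrightarrow> exp (2 * \<bar>lam\<bar> * T) * ((2 * 0)\<^sup>2 + T * ((2 * 0) * (L\<^sup>2 + 1)))) (at_right 0)"
    unfolding G_def by (intro tendsto_intros)
  then have "\<forall>\<^sub>F \<rho> in at_right 0. G \<rho> < \<delta>\<^sup>2"
    by (rule order_tendstoD) (use \<delta> in auto)
  moreover have "((\<lambda>\<rho>. 2 * L * \<rho>) \<longlongrightarrow> 2 * L * 0) (at_right 0)" by (intro tendsto_intros)
  then have "\<forall>\<^sub>F \<rho> in at_right 0. 2 * L * \<rho> < e / 2" by (rule order_tendstoD) (use e in auto)
  moreover have "\<forall>\<^sub>F \<rho> in at_right (0::real). 0 < \<rho>" by (rule eventually_at_right_less)
  ultimately have "\<forall>\<^sub>F \<rho> in at_right 0. G \<rho> < \<delta>\<^sup>2 \<and> 2 * L * \<rho> < e / 2 \<and> 0 < \<rho>"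
    by eventually_elim auto
  then obtain \<rho> where \<rho>: "G \<rho> < \<delta>\<^sup>2" "2 * L * \<rho> < e / 2" "0 < \<rho>"
    using eventually_happens[of _ "at_right (0::real)"] by auto
  have "\<forall>\<^sub>F n in sequentially. W2 (m n 0) \<mu>0 < \<rho> \<and> \<tau> n < \<rho>"
    using order_tendstoD(2)[OF init \<rho>(3)] order_tendstoD(2)[OF \<tau> \<rho>(3)] by eventually_elim auto
  then obtain n0 where n0: "\<And>n. n \<ge> n0 \<Longrightarrow> W2 (m n 0) \<mu>0 < \<rho> \<and> \<tau> n < \<rho>"
    unfolding eventually_sequentially by blast
  show ?thesis
  proof (intro exI[of _ n0] allI impI ballI)
    fix k l t assume kl: "k \<ge> n0" "l \<ge> n0" and t: "t \<in> {0..T}"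
    interpret k: euler_curve F lam T L "\<tau> k" "m k" "N k" "M k" "\<Phi> k" by (rule m)
    interpret l: euler_curve F lam T L "\<tau> l" "m l" "N l" "M l" "\<Phi> l" by (rule m)
    have P2: "m k 0 \<in> P2" "m l 0 \<in> P2" using T by (auto intro: k.curve_in_P2 l.curve_in_P2)
    have "W2 (m k 0) (m l 0) \<le> W2 (m k 0) \<mu>0 + W2 \<mu>0 (m l 0)"
      by (intro W2_triangle P2 \<mu>0)
    also have "\<dots> \<le> 2 * \<rho>"
      using n0[OF kl(1)] n0[OF kl(2)] W2_commute[OF P2(2) \<mu>0] by linarith
    finally have "(W2 (m k 0) (m l 0))\<^sup>2 \<le> (2 * \<rho>)\<^sup>2" by (intro power_mono) auto
    moreover have "T * ((\<tau> k + \<tau> l) * (L\<^sup>2 + 1)) \<le> T * ((2 * \<rho>) * (L\<^sup>2 + 1))"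
      using n0[OF kl(1)] n0[OF kl(2)] T by (intro mult_left_mono mult_right_mono) auto
    ultimately have "exp (2 * \<bar>lam\<bar> * T) * ((W2 (m k 0) (m l 0))\<^sup>2 + T * ((\<tau> k + \<tau> l) * (L\<^sup>2 + 1)))
      \<le> G \<rho>"
      unfolding G_def by (rule mult_left_mono[OF add_mono]) simp
    with \<rho>(1) have B: "exp (2 * \<bar>lam\<bar> * T) * ((W2 (m k 0) (m l 0))\<^sup>2 + T * ((\<tau> k + \<tau> l) * (L\<^sup>2 + 1))) < \<delta>\<^sup>2"
      by linarith
    have "W2 (m k t) (m l t) \<le> \<delta> + 4 * L * \<delta> + 2 * L * \<tau> k"
      using t by (intro two_euler_curves_close[OF m m \<delta> B]) auto
    also have "2 * L * \<tau> k \<le> 2 * L * \<rho>" using n0[OF kl(1)] L by (intro mult_left_mono) auto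
    finally show "W2 (m k t) (m l t) < e" using \<delta>e \<rho>(2) e by linarith
  qed
qed

lemma euler_limit_curve:
  assumes m: "\<And>n. euler_curve F lam T L (\<tau> n) (m n) (N n) (M n) (\<Phi> n)"
    and \<tau>: "\<tau> \<longlonglongrightarrow> 0" and \<mu>0: "\<mu>0 \<in> W2_closure (mpvf_dom F)" and init: "(\<lambda>n. W2 (m n 0) \<mu>0) \<longlonglongrightarrow> 0"
  shows "\<exists>\<mu>. (\<forall>e>0. \<forall>\<^sub>F n in sequentially. \<forall>t\<in>{0..T}. W2 (m n t) (\<mu> t) < e) \<and>
    (\<forall>t\<in>{0..T}. \<mu> t \<in> W2_closure (mpvf_dom F)) \<and>
    (\<forall>s\<in>{0..T}. \<forall>t\<in>{0..T}. W2 (\<mu> s) (\<mu> t) \<le> L * \<bar>s - t\<bar>) \<and> \<mu> 0 = \<mu>0"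
proof -
  interpret m0: euler_curve F lam T L "\<tau> 0" "m 0" "N 0" "M 0" "\<Phi> 0" by (rule m)
  have \<mu>0P: "\<mu>0 \<in> P2" using \<mu>0 by (simp add: W2_closure_def)
  have mP2: "m n t \<in> P2" if "t \<in> {0..T}" for n t
    using euler_curve.curve_in_P2[OF m[of n], of t] that by auto
  obtain \<nu> where \<nu>: "\<And>t. t \<in> {0..T} \<Longrightarrow> \<nu> t \<in> P2"
    "\<And>e. e > 0 \<Longrightarrow> \<forall>\<^sub>F n in sequentially. \<forall>t\<in>{0..T}. W2 (m n t) (\<nu> t) < e"
    using W2_uniform_limit[of "{0..T}" m, OF mP2 euler_curves_uniformly_Cauchy[OF m \<tau> \<mu>0P init]] by blast
  \<comment> \<open>the limit at time \<open>0\<close> is \<open>\<mu>0\<close> itself, not merely a measure at distance zero from it\<close>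
  define \<mu> where "\<mu> = (\<lambda>t. if t = 0 then \<mu>0 else \<nu> t)"
  have \<mu>P: "\<mu> t \<in> P2" if "t \<in> {0..T}" for t using \<nu>(1)[OF that] \<mu>0P by (simp add: \<mu>_def)
  have conv: "\<forall>\<^sub>F n in sequentially. \<forall>t\<in>{0..T}. W2 (m n t) (\<mu> t) < e" if "e > 0" for e
    using \<nu>(2)[OF that] order_tendstoD(2)[OF init that] by eventually_elim (auto simp: \<mu>_def)
  show ?thesis
  proof (intro exI[of _ \<mu>] conjI ballI allI impI)
    show "\<forall>\<^sub>F n in sequentially. \<forall>t\<in>{0..T}. W2 (m n t) (\<mu> t) < e" if "e > 0" for e by (rule conv[OF that])
    show "\<mu> 0 = \<mu>0" by (simp add: \<mu>_def)
    show "\<mu> t \<in> W2_closure (mpvf_dom F)" if t: "t \<in> {0..T}" for t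
    proof -
      have "\<exists>\<nu>\<in>mpvf_dom F. W2 (\<mu> t) \<nu> < e" if e: "e > 0" for e
      proof -
        have "(\<lambda>n. L * \<tau> n) \<longlonglongrightarrow> L * 0" by (intro tendsto_intros \<tau>)
        then have "\<forall>\<^sub>F n in sequentially. L * \<tau> n < e / 2" by (rule order_tendstoD) (use e in auto)
        moreover have "\<forall>\<^sub>F n in sequentially. \<forall>t\<in>{0..T}. W2 (m n t) (\<mu> t) < e / 2" using e by (intro conv) auto
        ultimately have "\<forall>\<^sub>F n in sequentially. L * \<tau> n < e / 2 \<and> W2 (m n t) (\<mu> t) < e / 2"
          by eventually_elim (use t in auto)
        then obtain n where n: "L * \<tau> n < e / 2" "W2 (m n t) (\<mu> t) < e / 2"
          using eventually_happens[of _ sequentially] by auto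
        interpret n: euler_curve F lam T L "\<tau> n" "m n" "N n" "M n" "\<Phi> n" by (rule m)
        obtain k r where kr: "k < N n" "0 \<le> r" "r \<le> \<tau> n" "t = real k * \<tau> n + r"
          using n.previous_node[of t] t by auto
        let ?s = "real k * \<tau> n"
        have s: "0 \<le> ?s" "?s \<le> T" using n.\<tau> kr t by auto
        have "W2 (m n t) (m n ?s) \<le> L * \<bar>t - ?s\<bar>" using t s by (intro n.Lipschitz) auto
        also have "\<dots> \<le> L * \<tau> n" using kr n.L by (intro mult_left_mono) auto
        finally have "W2 (m n t) (m n ?s) < e / 2" using n by linarith
        moreover have "W2 (\<mu> t) (m n ?s) \<le> W2 (\<mu> t) (m n t) + W2 (m n t) (m n ?s)"
          using t s by (intro W2_triangle \<mu>P mP2) auto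
        ultimately have "W2 (\<mu> t) (m n ?s) < e"
          using n(2) W2_commute[OF \<mu>P[OF t] mP2[OF t, of n]] by linarith
        then show ?thesis using n.node_in_dom[OF kr(1)] by blast
      qed
      then show ?thesis using \<mu>P[OF t] by (simp add: W2_closure_def)
    qed
    show "W2 (\<mu> s) (\<mu> t) \<le> L * \<bar>s - t\<bar>" if st: "s \<in> {0..T}" "t \<in> {0..T}" for s t
    proof (rule field_le_epsilon)
      fix e :: real assume e: "e > 0"
      have "\<forall>\<^sub>F n in sequentially. \<forall>t\<in>{0..T}. W2 (m n t) (\<mu> t) < e / 2" using e by (intro conv) auto
      then obtain n where n: "\<And>t. t \<in> {0..T} \<Longrightarrow> W2 (m n t) (\<mu> t) < e / 2"
        using eventually_happens'[OF sequentially_bot] by blast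
      have "W2 (\<mu> s) (\<mu> t) \<le> W2 (\<mu> s) (m n s) + W2 (m n s) (\<mu> t)"
        by (intro W2_triangle \<mu>P mP2 st)
      moreover have "W2 (m n s) (\<mu> t) \<le> W2 (m n s) (m n t) + W2 (m n t) (\<mu> t)"
        by (intro W2_triangle \<mu>P mP2 st)
      moreover have "W2 (m n s) (m n t) \<le> L * \<bar>s - t\<bar>"
        using st by (intro euler_curve.Lipschitz[OF m]) auto
      ultimately show "W2 (\<mu> s) (\<mu> t) \<le> L * \<bar>s - t\<bar> + e"
        using n[OF st(1)] n[OF st(2)] W2_commute[OF \<mu>P[OF st(1)] mP2[OF st(1), of n]] by linarith
    qed
  qed
qed


section \<open>From discrete inequalities to distributions\<close>

text \<open>
  Summing the discrete inequality over the steps between the nodes preceding \<open>a\<close> and \<open>b\<close>, where the rate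
  \<open>H\<close> exceeds \<open>H a\<close> by at most \<open>K (b - a + e)\<close>, gives the bound with errors that vanish
  as \<open>e \<down> 0\<close>. The quadratic remainder \<open>K (b - a)\<^sup>2\<close> avoids any integral of the rate and
  disappears in difference quotients.
\<close>

lemma discrete_to_local_inequality:
  fixes u H :: "real \<Rightarrow> real" and T K L a b :: real
  assumes uK: "\<And>s t. s \<in> {0..T} \<Longrightarrow> t \<in> {0..T} \<Longrightarrow> \<bar>u s - u t\<bar> \<le> K * \<bar>s - t\<bar>"
    and HK: "\<And>s t. s \<in> {0..T} \<Longrightarrow> t \<in> {0..T} \<Longrightarrow> \<bar>H s - H t\<bar> \<le> K * \<bar>s - t\<bar>" and K: "K \<ge> 0"
    and approx: "\<And>e. e > 0 \<Longrightarrow> \<exists>\<tau> un Hn. 0 < \<tau> \<and> \<tau> \<le> e \<and> (\<forall>t\<in>{0..T}. \<bar>un t - u t\<bar> \<le> e \<and> Hn t \<le> H t + e) \<and>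
      (\<forall>k::nat. real (Suc k) * \<tau> \<le> T \<longrightarrow> un (real (Suc k) * \<tau>) - un (real k * \<tau>) \<le> \<tau> * (Hn (real k * \<tau>) + \<tau> * L))"
    and L: "L \<ge> 0" and ab: "0 \<le> a" "a < b" "b \<le> T"
  shows "u b - u a \<le> (b - a) * (H a + K * (b - a))"
proof -
  define X where "X = (\<lambda>e. H a + K * (b - a + e) + e + e * L)"
  have bound: "u b - u a \<le> (b - a) * X e + e * \<bar>X e\<bar> + 2 * e + 2 * K * e" if e: "e > 0" for e
  proof -
    obtain \<tau> un Hn where \<tau>: "0 < \<tau>" "\<tau> \<le> e"
      and un: "\<And>t. t \<in> {0..T} \<Longrightarrow> \<bar>un t - u t\<bar> \<le> e" and Hn: "\<And>t. t \<in> {0..T} \<Longrightarrow> Hn t \<le> H t + e"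
      and step: "\<And>k::nat. real (Suc k) * \<tau> \<le> T \<Longrightarrow> un (real (Suc k) * \<tau>) - un (real k * \<tau>) \<le> \<tau> * (Hn (real k * \<tau>) + \<tau> * L)"
      using approx[OF e] by blast
    have node: "real (nat \<lfloor>t / \<tau>\<rfloor>) * \<tau> \<le> t \<and> t < real (nat \<lfloor>t / \<tau>\<rfloor>) * \<tau> + \<tau>" if "t \<ge> 0" for t
    proof -
      have "real (nat \<lfloor>t / \<tau>\<rfloor>) = of_int \<lfloor>t / \<tau>\<rfloor>" using that \<tau> by simp
      then have "real (nat \<lfloor>t / \<tau>\<rfloor>) \<le> t / \<tau>" "t / \<tau> < real (nat \<lfloor>t / \<tau>\<rfloor>) + 1" by linarith+
      then have "real (nat \<lfloor>t / \<tau>\<rfloor>) * \<tau> \<le> t" "t < (real (nat \<lfloor>t / \<tau>\<rfloor>) + 1) * \<tau>"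
        using \<tau>(1) by (simp_all only: pos_le_divide_eq pos_divide_less_eq)
      then show ?thesis by (simp add: distrib_right)
    qed
    define i where "i = nat \<lfloor>a / \<tau>\<rfloor>"
    define j where "j = nat \<lfloor>b / \<tau>\<rfloor>"
    have i: "i * \<tau> \<le> a" "a < i * \<tau> + \<tau>" using node[OF ab(1)] unfolding i_def by auto
    have b0: "0 \<le> b" using ab by simp
    have j: "j * \<tau> \<le> b" "b < j * \<tau> + \<tau>" using node[OF b0] unfolding j_def by auto
    have ij: "i \<le> j" unfolding i_def j_def using ab \<tau> by (intro nat_mono floor_mono divide_right_mono) auto
    have inc: "un (real (Suc k) * \<tau>) - un (real k * \<tau>) \<le> \<tau> * X e" if k: "i \<le> k" "k < j" for k
    proof -
      have kj: "real (Suc k) * \<tau> \<le> real j * \<tau>" using k \<tau> by (intro mult_right_mono) auto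
      have ki: "real i * \<tau> \<le> real k * \<tau>" using k \<tau> by (intro mult_right_mono) auto
      have kk: "real k * \<tau> \<le> real (Suc k) * \<tau>" using \<tau> by (intro mult_right_mono) auto
      have k0: "0 \<le> real k * \<tau>" using \<tau> by simp
      have "real k * \<tau> \<le> T" using kj kk j ab by linarith
      then have kt: "real k * \<tau> \<in> {0..T}" using k0 by simp
      have 1: "H (real k * \<tau>) - H a \<le> K * \<bar>real k * \<tau> - a\<bar>" using HK[OF kt, of a] ab by auto
      have "\<bar>real k * \<tau> - a\<bar> \<le> b - a + e" using kj kk ki i j \<tau> ab by linarith
      then have 2: "K * \<bar>real k * \<tau> - a\<bar> \<le> K * (b - a + e)" using K by (rule mult_left_mono)
      have "Hn (real k * \<tau>) \<le> H a + K * (b - a + e) + e" using Hn[OF kt] 1 2 by linarith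
      moreover have "\<tau> * L \<le> e * L" using \<tau> L by (intro mult_right_mono) auto
      ultimately have "Hn (real k * \<tau>) + \<tau> * L \<le> X e" by (simp add: X_def)
      then have "\<tau> * (Hn (real k * \<tau>) + \<tau> * L) \<le> \<tau> * X e" using \<tau> by (intro mult_left_mono) auto
      moreover have "real (Suc k) * \<tau> \<le> T" using kj j ab by linarith
      ultimately show ?thesis using step[of k] by linarith
    qed
    have sum: "i + l \<le> j \<Longrightarrow> un (real (i + l) * \<tau>) - un (real i * \<tau>) \<le> real l * \<tau> * X e" for l
    proof (induction l)
      case (Suc l)
      have "un (real (i + l) * \<tau>) - un (real i * \<tau>) \<le> real l * \<tau> * X e" using Suc by simp
      moreover have "un (real (Suc (i + l)) * \<tau>) - un (real (i + l) * \<tau>) \<le> \<tau> * X e" using Suc.prems by (intro inc) auto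
      moreover have "real (Suc l) * \<tau> * X e = real l * \<tau> * X e + \<tau> * X e" by (simp add: algebra_simps)
      ultimately show ?case unfolding add_Suc_right by linarith
    qed simp
    have l: "real (j - i) * \<tau> = j * \<tau> - i * \<tau>" using ij by (simp add: of_nat_diff left_diff_distrib)
    have "un (real j * \<tau>) - un (real i * \<tau>) \<le> (j * \<tau> - i * \<tau>) * X e"
      using sum[of "j - i"] ij l by simp
    also have "\<dots> \<le> (b - a) * X e + e * \<bar>X e\<bar>"
    proof -
      have "(j * \<tau> - i * \<tau> - (b - a)) * X e \<le> \<bar>j * \<tau> - i * \<tau> - (b - a)\<bar> * \<bar>X e\<bar>"
        by (simp only: abs_mult[symmetric] abs_ge_self)
      also have "\<dots> \<le> e * \<bar>X e\<bar>" using i j \<tau> by (intro mult_right_mono) auto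
      finally show ?thesis by (simp add: left_diff_distrib)
    qed
    finally have main: "un (real j * \<tau>) - un (real i * \<tau>) \<le> (b - a) * X e + e * \<bar>X e\<bar>" .
    have "a \<le> T" "i * \<tau> \<le> T" "j * \<tau> \<le> T" using i(1) j(1) ab by linarith+
    then have abT: "a \<in> {0..T}" "b \<in> {0..T}" and it: "i * \<tau> \<in> {0..T}" and jt: "j * \<tau> \<in> {0..T}"
      using \<tau>(1) ab(1,3) b0 by simp_all
    have "K * \<bar>b - j * \<tau>\<bar> \<le> K * e" "K * \<bar>a - i * \<tau>\<bar> \<le> K * e"
      using i j \<tau> K by (simp_all add: mult_left_mono)
    then have "\<bar>u b - u (j * \<tau>)\<bar> \<le> K * e" "\<bar>u a - u (i * \<tau>)\<bar> \<le> K * e"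
      using uK[OF abT(2) jt] uK[OF abT(1) it] by (blast intro: order_trans)+
    with un[OF it] un[OF jt] have "u b - u (j * \<tau>) \<le> K * e" "u (i * \<tau>) - u a \<le> K * e"
      "u (j * \<tau>) - un (j * \<tau>) \<le> e" "un (i * \<tau>) - u (i * \<tau>) \<le> e"
      unfolding abs_le_iff by simp_all
    with main show ?thesis by linarith
  qed
  have "((\<lambda>e. (b - a) * X e + e * \<bar>X e\<bar> + 2 * e + 2 * K * e) \<longlongrightarrow> (b - a) * X 0 + 0 * \<bar>X 0\<bar> + 2 * 0 + 2 * K * 0) (at_right 0)"
    unfolding X_def by (intro tendsto_intros)
  then have "u b - u a \<le> (b - a) * X 0 + 0 * \<bar>X 0\<bar> + 2 * 0 + 2 * K * 0"
    by (rule tendsto_lowerbound) (use bound in \<open>auto simp: eventually_at_right_field intro!: exI[of _ 1]\<close>)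
  then show ?thesis by (simp add: X_def)
qed

lemma test_function_on_interval:
  assumes T: "T > 0" and \<phi>: "test_function {0<..<T} \<phi>"
  obtains \<alpha> \<beta> B where "0 < \<alpha>" "\<alpha> \<le> \<beta>" "\<beta> < T" "\<And>t. t \<notin> {\<alpha>..\<beta>} \<Longrightarrow> \<phi> t = 0" "\<And>t. t \<notin> {\<alpha>..\<beta>} \<Longrightarrow> deriv \<phi> t = 0"
    "\<And>t. (\<phi> has_real_derivative deriv \<phi> t) (at t)" "continuous_on UNIV (deriv \<phi>)" "\<And>t. \<bar>deriv \<phi> t\<bar> \<le> B"
proof -
  have d0: "\<phi> differentiable (at t)" and d1: "deriv \<phi> differentiable (at t)" for t
    using \<phi> spec[of "\<lambda>k. \<forall>t. (deriv ^^ k) \<phi> differentiable (at t)" 0] spec[of "\<lambda>k. \<forall>t. (deriv ^^ k) \<phi> differentiable (at t)" 1]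
    by (auto simp: test_function_def)
  have D: "(\<phi> has_real_derivative deriv \<phi> t) (at t)" for t
    using d0[of t] by (simp add: DERIV_deriv_iff_real_differentiable)
  have cont: "continuous_on UNIV (deriv \<phi>)"
    using d1 by (auto intro!: continuous_at_imp_continuous_on differentiable_imp_continuous_within)
  define S where "S = closure {t. \<phi> t \<noteq> 0}"
  have S: "compact S" "S \<subseteq> {0<..<T}" using \<phi> by (auto simp: test_function_def S_def)
  obtain \<alpha> \<beta> where ab: "0 < \<alpha>" "\<alpha> \<le> \<beta>" "\<beta> < T" "S \<subseteq> {\<alpha>..\<beta>}"
  proof (cases "S = {}")
    case True
    then show ?thesis using T by (intro that[of "T / 2" "T / 2"]) auto
  next
    case False
    obtain \<alpha> \<beta> where "\<alpha> \<in> S" "\<And>t. t \<in> S \<Longrightarrow> \<alpha> \<le> t" "\<beta> \<in> S" "\<And>t. t \<in> S \<Longrightarrow> t \<le> \<beta>"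
      using compact_attains_inf[OF S(1) False] compact_attains_sup[OF S(1) False] by blast
    then show ?thesis using S(2) by (intro that[of \<alpha> \<beta>]) auto
  qed
  have z: "\<phi> t = 0" if "t \<notin> {\<alpha>..\<beta>}" for t
    using that ab(4) closure_subset[of "{t. \<phi> t \<noteq> 0}"] by (auto simp: S_def)
  have z': "deriv \<phi> t = 0" if t: "t \<notin> {\<alpha>..\<beta>}" for t
  proof -
    have "\<forall>\<^sub>F x in nhds t. x \<in> - {\<alpha>..\<beta>}" using t by (intro eventually_nhds_in_open) auto
    then have "\<forall>\<^sub>F x in nhds t. \<phi> x = 0" by eventually_elim (use z in auto)
    then have "(\<phi> has_real_derivative 0) (at t)" by (subst DERIV_cong_ev[OF refl _ refl, of _ "\<lambda>_. 0"]) auto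
    then show ?thesis by (rule DERIV_imp_deriv)
  qed
  have "compact (deriv \<phi> ` {\<alpha>..\<beta>})" by (intro compact_continuous_image continuous_on_subset[OF cont]) auto
  from compact_imp_bounded[OF this] obtain B where "\<forall>y\<in>deriv \<phi> ` {\<alpha>..\<beta>}. norm y \<le> B"
    unfolding bounded_iff by blast
  then have B: "\<bar>deriv \<phi> x\<bar> \<le> B" if "x \<in> {\<alpha>..\<beta>}" for x using that by simp
  have "\<bar>deriv \<phi> t\<bar> \<le> B" for t
  proof (cases "t \<in> {\<alpha>..\<beta>}")
    case False
    have "0 \<le> B" using B[of \<alpha>] ab by auto
    then show ?thesis using z'[OF False] by simp
  qed (rule B)
  then show ?thesis using that ab z z' D cont by blast
qed

text \<open>
  Shifted arguments in difference quotients leave \<open>[0, T]\<close>, where curves have no meaning; composing with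
  the clamp extends functions continuously to the whole line.
\<close>

definition clamp_to :: "real \<Rightarrow> real \<Rightarrow> real" where "clamp_to T t = max 0 (min T t)"

lemma clamp_to_inside: "t \<in> {0..T} \<Longrightarrow> clamp_to T t = t"
  by (auto simp: clamp_to_def)

lemma clamp_to_in: "T > 0 \<Longrightarrow> clamp_to T t \<in> {0..T}"
  by (auto simp: clamp_to_def)

lemma continuous_on_clamp_to:
  assumes "continuous_on {0..T} f" "T > 0" shows "continuous_on UNIV (\<lambda>t. f (clamp_to T t))"
proof (rule continuous_on_compose2[OF assms(1)])
  show "continuous_on UNIV (clamp_to T)" unfolding clamp_to_def by (intro continuous_intros)
qed (use clamp_to_in[OF assms(2)] in auto)

lemma set_integral_clamp_to:
  fixes f g :: "real \<Rightarrow> real"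
  assumes m: "(\<lambda>t. f (clamp_to T t) * g t) \<in> borel_measurable borel" and g: "\<And>t. t \<notin> {0<..<T} \<Longrightarrow> g t = 0"
  shows "(LINT t:{0<..<T}|lebesgue. f t * g t) = (\<integral>t. f (clamp_to T t) * g t \<partial>lborel)"
proof -
  have "(LINT t:{0<..<T}|lebesgue. f t * g t) = (\<integral>t. f (clamp_to T t) * g t \<partial>lebesgue)"
    unfolding set_lebesgue_integral_def
    by (intro Bochner_Integration.integral_cong) (auto simp: g clamp_to_inside indicator_def)
  also have "\<dots> = (\<integral>t. f (clamp_to T t) * g t \<partial>lborel)"
    using m by (intro integral_completion) simp
  finally show ?thesis .
qed

lemma integrable_continuous_compact_support:
  fixes g :: "real \<Rightarrow> real"
  assumes "continuous_on UNIV g" "\<And>t. t \<notin> {a..b} \<Longrightarrow> g t = 0"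
  shows "integrable lborel g"
proof -
  have "integrable lborel (\<lambda>x. indicator {a..b} x *\<^sub>R g x)"
    by (intro borel_integrable_compact continuous_on_subset[OF assms(1)]) auto
  also have "(\<lambda>x. indicator {a..b} x *\<^sub>R g x) = g"
  proof
    fix x show "indicator {a..b} x *\<^sub>R g x = g x" using assms(2)[of x] by (cases "x \<in> {a..b}") auto
  qed
  finally show ?thesis .
qed

text \<open>
  A translation moves the difference quotient of \<open>\<phi>\<close> over to \<open>u\<close>, where the local inequality
  applies for shifts so small that the support of \<open>\<phi>\<close> stays inside \<open>[0, T]\<close>. Dominated convergence
  as the shift tends to zero yields the derivative of \<open>\<phi>\<close>.
\<close>

lemma local_to_distributional:
  fixes u H :: "real \<Rightarrow> real"
  assumes T: "T > 0" and u: "continuous_on {0..T} u" and H: "continuous_on {0..T} H"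
    and local: "\<And>a b. 0 \<le> a \<Longrightarrow> a < b \<Longrightarrow> b \<le> T \<Longrightarrow> u b - u a \<le> (b - a) * (H a + K * (b - a))"
    and \<phi>: "test_function {0<..<T} \<phi>" and pos: "\<And>t. 0 \<le> \<phi> t"
  shows "- (LINT t:{0<..<T}|lebesgue. u t * deriv \<phi> t) \<le> (LINT t:{0<..<T}|lebesgue. H t * \<phi> t)"
proof -
  obtain \<alpha> \<beta> B where ab: "0 < \<alpha>" "\<alpha> \<le> \<beta>" "\<beta> < T" and z: "\<And>t. t \<notin> {\<alpha>..\<beta>} \<Longrightarrow> \<phi> t = 0"
    and z': "\<And>t. t \<notin> {\<alpha>..\<beta>} \<Longrightarrow> deriv \<phi> t = 0"
    and D: "\<And>t. (\<phi> has_real_derivative deriv \<phi> t) (at t)" and dc: "continuous_on UNIV (deriv \<phi>)" and B: "\<And>t. \<bar>deriv \<phi> t\<bar> \<le> B"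
    by (rule test_function_on_interval[OF T \<phi>]) blast
  define U where "U = (\<lambda>t. u (clamp_to T t))"
  define HH where "HH = (\<lambda>t. H (clamp_to T t))"
  have Uc: "continuous_on UNIV U" and Hc: "continuous_on UNIV HH"
    unfolding U_def HH_def using u H T by (auto intro: continuous_on_clamp_to)
  have \<phi>c: "continuous_on UNIV \<phi>"
    by (intro continuous_at_imp_continuous_on ballI DERIV_isCont[OF D])
  have shiftc: "continuous_on UNIV (\<lambda>t. f (t + h))" if "continuous_on UNIV f" for f :: "real \<Rightarrow> real" and h
    using that by (intro continuous_on_compose2[OF that]) (auto intro!: continuous_intros)
  note [measurable] = borel_measurable_continuous_onI[OF Uc] borel_measurable_continuous_onI[OF Hc]
    borel_measurable_continuous_onI[OF \<phi>c] borel_measurable_continuous_onI[OF dc]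
  have lhs: "(LINT t:{0<..<T}|lebesgue. u t * deriv \<phi> t) = (\<integral>t. U t * deriv \<phi> t \<partial>lborel)"
  proof -
    have "(\<lambda>t. U t * deriv \<phi> t) \<in> borel_measurable borel" by measurable
    then show ?thesis unfolding U_def by (rule set_integral_clamp_to) (use ab in \<open>auto intro!: z'\<close>)
  qed
  have rhs: "(LINT t:{0<..<T}|lebesgue. H t * \<phi> t) = (\<integral>t. HH t * \<phi> t \<partial>lborel)"
  proof -
    have "(\<lambda>t. HH t * \<phi> t) \<in> borel_measurable borel" by measurable
    then show ?thesis unfolding HH_def by (rule set_integral_clamp_to) (use ab in \<open>auto intro!: z\<close>)
  qed
  \<comment> \<open>the room that the support of \<open>\<phi>\<close> leaves for shifts to the right\<close>
  define h0 where "h0 = T - \<beta>"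
  have h0: "h0 > 0" using ab by (simp add: h0_def)
  define h where "h = (\<lambda>n. h0 / real (Suc n))"
  have h: "0 < h n" "h n \<le> h0" for n
    using h0 by (auto simp: h_def divide_le_eq mult_left_mono)
  have hlim: "h \<longlonglongrightarrow> 0" unfolding h_def by (rule LIMSEQ_Suc[OF lim_const_over_n])
  have ineq: "(\<integral>t. U t * ((\<phi> (t - h n) - \<phi> t) / h n) \<partial>lborel) \<le> (\<integral>t. HH t * \<phi> t \<partial>lborel) + K * h n * (\<integral>t. \<phi> t \<partial>lborel)" for n
  proof -
    have out: "\<phi> (t - h n) = 0" if "t \<notin> {0..T}" for t
      using that ab h[of n] by (intro z) (auto simp: h0_def)
    have i1: "integrable lborel (\<lambda>t. U t * \<phi> (t - h n))"
      using shiftc[OF \<phi>c, of "- h n"] out by (intro integrable_continuous_compact_support[where a=0 and b=T] continuous_on_mult Uc) auto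
    have i2: "integrable lborel (\<lambda>t. U t * \<phi> t)" "integrable lborel (\<lambda>t. U (t + h n) * \<phi> t)"
        "integrable lborel (\<lambda>t. HH t * \<phi> t)" "integrable lborel \<phi>"
      using z shiftc[OF Uc, of "h n"] by (intro integrable_continuous_compact_support[where a=\<alpha> and b=\<beta>] continuous_on_mult Uc Hc \<phi>c; auto)+
    have shift: "(\<integral>t. U t * \<phi> (t - h n) \<partial>lborel) = (\<integral>t. U (t + h n) * \<phi> t \<partial>lborel)"
      using lborel_integral_real_affine[of 1 "\<lambda>t. U t * \<phi> (t - h n)" "h n"] by (simp add: add.commute)
    have "(\<integral>t. U t * ((\<phi> (t - h n) - \<phi> t) / h n) \<partial>lborel) = (\<integral>t. (U t * \<phi> (t - h n) - U t * \<phi> t) / h n \<partial>lborel)"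
      by (simp add: right_diff_distrib)
    also have "\<dots> = ((\<integral>t. U t * \<phi> (t - h n) \<partial>lborel) - (\<integral>t. U t * \<phi> t \<partial>lborel)) / h n"
      by (simp add: i1 i2)
    also have "\<dots> = (\<integral>t. (U (t + h n) * \<phi> t - U t * \<phi> t) / h n \<partial>lborel)"
      unfolding shift by (simp add: i2)
    also have "\<dots> \<le> (\<integral>t. HH t * \<phi> t + K * h n * \<phi> t \<partial>lborel)"
    proof (rule integral_mono)
      fix t
      show "(U (t + h n) * \<phi> t - U t * \<phi> t) / h n \<le> HH t * \<phi> t + K * h n * \<phi> t"
      proof (cases "t \<in> {\<alpha>..\<beta>}")
        case True
        then have t: "t \<in> {0..T}" "t + h n \<in> {0..T}" using ab h[of n] by (auto simp: h0_def)
        have "U (t + h n) - U t \<le> h n * (HH t + K * h n)"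
          using local[of t "t + h n"] t h[of n] by (simp add: U_def HH_def clamp_to_inside)
        then have "(U (t + h n) - U t) / h n \<le> HH t + K * h n" using h[of n] by (simp add: pos_divide_le_eq mult.commute)
        then have "(U (t + h n) - U t) / h n * \<phi> t \<le> (HH t + K * h n) * \<phi> t" using pos[of t] by (rule mult_right_mono)
        then show ?thesis by (simp add: left_diff_distrib distrib_right)
      qed (simp add: z)
    qed (use i2 in auto)
    also have "\<dots> = (\<integral>t. HH t * \<phi> t \<partial>lborel) + K * h n * (\<integral>t. \<phi> t \<partial>lborel)" by (simp add: i2)
    finally show ?thesis .
  qed
  have "compact (u ` {0..T})" by (intro compact_continuous_image u) auto
  from compact_imp_bounded[OF this] obtain C where "\<forall>y\<in>u ` {0..T}. norm y \<le> C"
    unfolding bounded_iff by blast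
  then have C: "\<bar>U t\<bar> \<le> C" for t unfolding U_def using clamp_to_in[OF T, of t] by simp
  have lim: "(\<lambda>n. \<integral>t. U t * ((\<phi> (t - h n) - \<phi> t) / h n) \<partial>lborel) \<longlonglongrightarrow> (\<integral>t. U t * - deriv \<phi> t \<partial>lborel)"
  proof (rule integral_dominated_convergence[where w="\<lambda>t. C * B * indicator {0..T} t"])
    show "integrable lborel (\<lambda>t. C * B * indicator {0..T} t :: real)"
      using T by (intro integrable_mult_right integrable_real_indicator) auto
    show "AE t in lborel. (\<lambda>n. U t * ((\<phi> (t - h n) - \<phi> t) / h n)) \<longlonglongrightarrow> U t * - deriv \<phi> t"
    proof (rule AE_I2)
      fix t
      have "filterlim (\<lambda>n. - h n) (at 0) sequentially"
        unfolding filterlim_at using tendsto_minus[OF hlim] h(1) by (auto simp: less_imp_neq[THEN not_sym])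
      from filterlim_compose[OF D[of t, unfolded DERIV_def] this]
      have "(\<lambda>n. (\<phi> (t + - h n) - \<phi> t) / - h n) \<longlonglongrightarrow> deriv \<phi> t" .
      then have "(\<lambda>n. U t * - ((\<phi> (t + - h n) - \<phi> t) / - h n)) \<longlonglongrightarrow> U t * - deriv \<phi> t"
        by (intro tendsto_intros)
      then show "(\<lambda>n. U t * ((\<phi> (t - h n) - \<phi> t) / h n)) \<longlonglongrightarrow> U t * - deriv \<phi> t" by simp
    qed
    show "AE t in lborel. norm (U t * ((\<phi> (t - h n) - \<phi> t) / h n)) \<le> C * B * indicator {0..T} t" for n
    proof (rule AE_I2)
      fix t
      show "norm (U t * ((\<phi> (t - h n) - \<phi> t) / h n)) \<le> C * B * indicator {0..T} t"
      proof (cases "t \<in> {0..T}")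
        case True
        have "norm (\<phi> (t - h n) - \<phi> t) \<le> B * norm (t - h n - t)"
          by (rule field_differentiable_bound[of UNIV \<phi> "deriv \<phi>"]) (use D B in auto)
        then have "\<bar>(\<phi> (t - h n) - \<phi> t) / h n\<bar> \<le> B" using h(1)[of n] by (simp add: abs_divide pos_divide_le_eq)
        then have "\<bar>U t\<bar> * \<bar>(\<phi> (t - h n) - \<phi> t) / h n\<bar> \<le> C * B"
          using C[of t] by (intro mult_mono) auto
        then show ?thesis using True by (simp add: abs_mult)
      next
        case False
        then have "\<phi> (t - h n) = 0" "\<phi> t = 0" using ab h[of n] by (intro z; auto simp: h0_def)+
        then show ?thesis using False by simp
      qed
    qed
  qed measurable
  have "(\<lambda>n. (\<integral>t. HH t * \<phi> t \<partial>lborel) + K * h n * (\<integral>t. \<phi> t \<partial>lborel)) \<longlonglongrightarrow> (\<integral>t. HH t * \<phi> t \<partial>lborel) + K * 0 * (\<integral>t. \<phi> t \<partial>lborel)"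
    by (intro tendsto_intros hlim)
  then have "(\<integral>t. U t * - deriv \<phi> t \<partial>lborel) \<le> (\<integral>t. HH t * \<phi> t \<partial>lborel) + K * 0 * (\<integral>t. \<phi> t \<partial>lborel)"
    by (rule LIMSEQ_le[OF lim]) (use ineq in auto)
  then show ?thesis unfolding lhs rhs by simp
qed


section \<open>The limit curve satisfies the EVI\<close>

lemma W2_power2_diff_le_right:
  fixes \<mu> \<nu> \<sigma> :: "'a::{real_inner, polish_space} measure"
  assumes "\<mu> \<in> P2" "\<nu> \<in> P2" "\<sigma> \<in> P2" and d: "W2 \<mu> \<nu> \<le> d"
  shows "\<bar>(W2 \<sigma> \<mu>)\<^sup>2 - (W2 \<sigma> \<nu>)\<^sup>2\<bar> \<le> d * (2 * W2 \<sigma> \<nu> + d)"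
  using W2_power2_diff_le[OF assms] W2_commute[OF assms(1,3)] W2_commute[OF assms(2,3)] by simp

text \<open>
  A uniform limit of Euler curves and one plan \<open>\<Phi>\<close> of \<open>F\<close> to test it against.
\<close>

locale euler_limit =
  fixes F :: "('a::{real_inner, polish_space} \<times> 'a) measure set" and lam T L :: real and \<tau> :: "nat \<Rightarrow> real"
    and m :: "nat \<Rightarrow> real \<Rightarrow> 'a measure" and N :: "nat \<Rightarrow> nat" and M :: "nat \<Rightarrow> nat \<Rightarrow> 'a measure"
    and \<Psi> :: "nat \<Rightarrow> nat \<Rightarrow> ('a \<times> 'a) measure" and \<mu> :: "real \<Rightarrow> 'a measure" and \<Phi> :: "('a \<times> 'a) measure"
  assumes curves: "\<And>n. euler_curve F lam T L (\<tau> n) (m n) (N n) (M n) (\<Psi> n)"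
    and \<tau>: "\<tau> \<longlonglongrightarrow> 0"
    and conv: "\<And>e. e > 0 \<Longrightarrow> \<forall>\<^sub>F n in sequentially. \<forall>t\<in>{0..T}. W2 (m n t) (\<mu> t) < e"
    and \<mu>_P2: "\<And>t. t \<in> {0..T} \<Longrightarrow> \<mu> t \<in> P2"
    and \<mu>_Lip: "\<And>s t. s \<in> {0..T} \<Longrightarrow> t \<in> {0..T} \<Longrightarrow> W2 (\<mu> s) (\<mu> t) \<le> L * \<bar>s - t\<bar>"
    and \<Phi>: "\<Phi> \<in> F"
begin

lemma \<Phi>_P2: "\<Phi> \<in> P2"
  using euler_curve.F(1)[OF curves] \<Phi> by (auto simp: MPVF_def)

lemma T_pos: "T > 0" and L_pos: "L > 0"
  using euler_curve.T[OF curves] euler_curve.L[OF curves] by auto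

definition sqdist :: "real \<Rightarrow> real \<Rightarrow> real" where
  "sqdist s t = (W2 (exp_push s \<Phi>) (\<mu> t))\<^sup>2"

text \<open>
  Twice the right-hand side of the EVI, with the pairing replaced by the difference quotient at
  \<open>s\<close> and with the error term of the split inequality that belongs to \<open>\<Phi>\<close>.
\<close>

definition rate :: "real \<Rightarrow> real \<Rightarrow> real" where
  "rate s t = 2 * lam * sqdist 0 t - (sqdist s t - sqdist 0 t) / s + s * (velocity_norm \<Phi>)\<^sup>2"

definition radius :: "real \<Rightarrow> real" where
  "radius s = W2 (exp_push s \<Phi>) (\<mu> 0) + L * T"

lemma W2_le_radius:
  assumes "t \<in> {0..T}" shows "W2 (exp_push s \<Phi>) (\<mu> t) \<le> radius s"
proof -
  have 0: "0 \<in> {0..T}" using T_pos by simp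
  have "W2 (exp_push s \<Phi>) (\<mu> t) \<le> W2 (exp_push s \<Phi>) (\<mu> 0) + W2 (\<mu> 0) (\<mu> t)"
    by (intro W2_triangle exp_push_in_P2 \<Phi>_P2 \<mu>_P2 0 assms)
  moreover have "W2 (\<mu> 0) (\<mu> t) \<le> L * T"
  proof -
    have "L * \<bar>0 - t\<bar> \<le> L * T" using assms L_pos by (intro mult_left_mono) auto
    then show ?thesis using \<mu>_Lip[OF 0 assms] by linarith
  qed
  ultimately show ?thesis by (simp add: radius_def)
qed

lemma radius_nonneg: "radius s \<ge> 0"
  using T_pos L_pos by (simp add: radius_def)

lemma sqdist_close:
  assumes "\<nu> \<in> P2" "t \<in> {0..T}" "W2 \<nu> (\<mu> t) \<le> d"
  shows "\<bar>(W2 (exp_push s \<Phi>) \<nu>)\<^sup>2 - sqdist s t\<bar> \<le> d * (2 * radius s + d)"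
proof -
  have d: "0 \<le> d" using assms(3) W2_nonneg[of \<nu> "\<mu> t"] by linarith
  have "\<bar>(W2 (exp_push s \<Phi>) \<nu>)\<^sup>2 - sqdist s t\<bar> \<le> d * (2 * W2 (exp_push s \<Phi>) (\<mu> t) + d)"
    unfolding sqdist_def by (intro W2_power2_diff_le_right assms \<mu>_P2 exp_push_in_P2 \<Phi>_P2)
  also have "\<dots> \<le> d * (2 * radius s + d)"
    using W2_le_radius[OF assms(2), of s] d by (intro mult_left_mono) auto
  finally show ?thesis .
qed

lemma sqdist_Lipschitz:
  assumes "s \<in> {0..T}" "t \<in> {0..T}"
  shows "\<bar>sqdist r s - sqdist r t\<bar> \<le> L * (2 * radius r + L * T) * \<bar>s - t\<bar>"
proof -
  have "\<bar>sqdist r s - sqdist r t\<bar> \<le> L * \<bar>s - t\<bar> * (2 * radius r + L * \<bar>s - t\<bar>)"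
    using sqdist_close[OF \<mu>_P2[OF assms(1)] assms(2) \<mu>_Lip[OF assms], of r] by (simp add: sqdist_def)
  also have "\<dots> \<le> L * \<bar>s - t\<bar> * (2 * radius r + L * T)"
    using assms L_pos by (intro mult_left_mono add_left_mono) auto
  finally show ?thesis by (simp add: mult_ac)
qed

lemma rate_perturbation:
  assumes s: "s > 0" and u: "\<bar>u - sqdist 0 t\<bar> \<le> q" and v: "\<bar>v - sqdist s t\<bar> \<le> q"
  shows "\<bar>2 * lam * u - (v - u) / s + s * (velocity_norm \<Phi>)\<^sup>2 - rate s t\<bar> \<le> (2 * \<bar>lam\<bar> + 2 / s) * q"
proof -
  have "2 * lam * u - (v - u) / s + s * (velocity_norm \<Phi>)\<^sup>2 - rate s t
      = 2 * lam * (u - sqdist 0 t) + (- ((v - sqdist s t) / s) + (u - sqdist 0 t) / s)"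
    by (simp add: rate_def right_diff_distrib diff_divide_distrib)
  also have "\<bar>\<dots>\<bar> \<le> 2 * \<bar>lam\<bar> * q + (q / s + q / s)"
  proof -
    have "\<bar>2 * lam * (u - sqdist 0 t)\<bar> \<le> 2 * \<bar>lam\<bar> * q"
      unfolding abs_mult using u by (intro mult_mono) auto
    moreover have "\<bar>(v - sqdist s t) / s\<bar> \<le> q / s" "\<bar>(u - sqdist 0 t) / s\<bar> \<le> q / s"
      using u v s by (auto simp: abs_divide intro!: divide_right_mono)
    ultimately show ?thesis by linarith
  qed
  finally show ?thesis by (simp add: distrib_right)
qed

text \<open>
  For fixed \<open>s\<close> the rate is a Lipschitz function of the squared distances to two fixed measures, so it
  converges uniformly along the Euler curves and is Lipschitz along the limit; the discrete
  inequality is \<open>dissipative_split_inequality\<close> for \<open>\<Phi>\<close> with step \<open>s\<close> and the plan of the current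
  Euler step with step \<open>\<tau>\<close>.
\<close>

lemma local_inequality:
  assumes s: "s > 0"
  obtains K where "K \<ge> 0" "\<And>x y. x \<in> {0..T} \<Longrightarrow> y \<in> {0..T} \<Longrightarrow> \<bar>sqdist 0 x - sqdist 0 y\<bar> \<le> K * \<bar>x - y\<bar>"
    "\<And>x y. x \<in> {0..T} \<Longrightarrow> y \<in> {0..T} \<Longrightarrow> \<bar>rate s x - rate s y\<bar> \<le> K * \<bar>x - y\<bar>"
    "\<And>a b. 0 \<le> a \<Longrightarrow> a < b \<Longrightarrow> b \<le> T \<Longrightarrow> sqdist 0 b - sqdist 0 a \<le> (b - a) * (rate s a + K * (b - a))"
proof -
  define R where "R = radius 0 + radius s"
  define A where "A = 2 * \<bar>lam\<bar> + 2 / s"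
  have A: "A \<ge> 0" using s by (simp add: A_def)
  have R: "radius 0 \<le> R" "radius s \<le> R" "0 \<le> R" using radius_nonneg[of 0] radius_nonneg[of s] by (auto simp: R_def)
  define K0 where "K0 = L * (2 * R + L * T)"
  have K0: "K0 \<ge> 0" using R L_pos T_pos by (simp add: K0_def)
  define K where "K = K0 + A * K0"
  have K: "K \<ge> 0" "K0 \<le> K" "A * K0 \<le> K" using K0 A by (auto simp: K_def)
  have Lip0: "\<bar>sqdist r x - sqdist r y\<bar> \<le> K0 * \<bar>x - y\<bar>" if "x \<in> {0..T}" "y \<in> {0..T}" "radius r \<le> R" for r x y
  proof -
    have "\<bar>sqdist r x - sqdist r y\<bar> \<le> L * (2 * radius r + L * T) * \<bar>x - y\<bar>"
      using that(1,2) by (rule sqdist_Lipschitz)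
    also have "\<dots> \<le> K0 * \<bar>x - y\<bar>"
      unfolding K0_def using that(3) L_pos by (intro mult_right_mono mult_left_mono) auto
    finally show ?thesis .
  qed
  have LipU: "\<bar>sqdist 0 x - sqdist 0 y\<bar> \<le> K * \<bar>x - y\<bar>" if "x \<in> {0..T}" "y \<in> {0..T}" for x y
    using Lip0[OF that R(1)] mult_right_mono[OF K(2), of "\<bar>x - y\<bar>"] by simp
  have LipR: "\<bar>rate s x - rate s y\<bar> \<le> K * \<bar>x - y\<bar>" if "x \<in> {0..T}" "y \<in> {0..T}" for x y
  proof -
    have "\<bar>rate s x - rate s y\<bar> \<le> A * (K0 * \<bar>x - y\<bar>)"
      using rate_perturbation[OF s Lip0[OF that R(1)] Lip0[OF that R(2)]] unfolding rate_def[of s x] A_def .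
    also have "\<dots> \<le> K * \<bar>x - y\<bar>" using mult_right_mono[OF K(3), of "\<bar>x - y\<bar>"] by (simp add: mult.assoc)
    finally show ?thesis .
  qed
  show ?thesis
  proof (rule that[OF K(1) LipU LipR])
    fix a b assume ab: "0 \<le> a" "a < b" "b \<le> T"
    show "sqdist 0 b - sqdist 0 a \<le> (b - a) * (rate s a + K * (b - a))"
    proof (rule discrete_to_local_inequality[where L="L\<^sup>2", OF LipU LipR K(1) _ _ ab])
      fix e :: real assume e: "e > 0"
      \<comment> \<open>\<open>d\<close> is the distance of the curves, \<open>q\<close> the resulting error of squared distances, \<open>A q\<close> that of the rates\<close>
      have "((\<lambda>d. (1 + A) * (d * (2 * R + d))) \<longlongrightarrow> (1 + A) * (0 * (2 * R + 0))) (at_right 0)"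
        by (intro tendsto_intros)
      then have "\<forall>\<^sub>F d in at_right 0. (1 + A) * (d * (2 * R + d)) < e" by (rule order_tendstoD) (use e in auto)
      moreover have "\<forall>\<^sub>F d in at_right (0::real). 0 < d" by (rule eventually_at_right_less)
      ultimately have "\<forall>\<^sub>F d in at_right 0. (1 + A) * (d * (2 * R + d)) < e \<and> 0 < d" by eventually_elim auto
      then obtain d where d: "(1 + A) * (d * (2 * R + d)) < e" "0 < d"
        using eventually_happens'[OF trivial_limit_at_right_real] by blast
      define q where "q = d * (2 * R + d)"
      have q: "0 \<le> q" "q \<le> e" "A * q \<le> e"
      proof -
        show "0 \<le> q" using d R by (simp add: q_def)
        then have "q + A * q < e" "0 \<le> A * q" using d(1) A by (auto simp: q_def[symmetric] distrib_right)
        with \<open>0 \<le> q\<close> show "q \<le> e" "A * q \<le> e" by linarith+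
      qed
      have "\<forall>\<^sub>F n in sequentially. \<tau> n < e \<and> (\<forall>t\<in>{0..T}. W2 (m n t) (\<mu> t) < d)"
        using order_tendstoD(2)[OF \<tau> e] conv[OF d(2)] by eventually_elim auto
      then obtain n where n: "\<tau> n < e" "\<And>t. t \<in> {0..T} \<Longrightarrow> W2 (m n t) (\<mu> t) < d"
        using eventually_happens'[OF sequentially_bot] by blast
      interpret n: euler_curve F lam T L "\<tau> n" "m n" "N n" "M n" "\<Psi> n" by (rule curves)
      define w where "w = (\<lambda>r t. (W2 (exp_push r \<Phi>) (m n t))\<^sup>2)"
      define Hn where "Hn = (\<lambda>t. 2 * lam * w 0 t - (w s t - w 0 t) / s + s * (velocity_norm \<Phi>)\<^sup>2)"
      have close: "\<bar>w r t - sqdist r t\<bar> \<le> q" if t: "t \<in> {0..T}" and r: "radius r \<le> R" for r t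
      proof -
        have "m n t \<in> P2" using t by (auto intro: n.curve_in_P2)
        then have "\<bar>w r t - sqdist r t\<bar> \<le> d * (2 * radius r + d)"
          unfolding w_def using t n(2)[OF t] by (intro sqdist_close) auto
        also have "\<dots> \<le> q" unfolding q_def using r d by (intro mult_left_mono) auto
        finally show ?thesis .
      qed
      have 1: "\<bar>w 0 t - sqdist 0 t\<bar> \<le> e \<and> Hn t \<le> rate s t + e" if t: "t \<in> {0..T}" for t
      proof
        show "\<bar>w 0 t - sqdist 0 t\<bar> \<le> e" using close[OF t R(1)] q by linarith
        have "\<bar>Hn t - rate s t\<bar> \<le> A * q"
          using rate_perturbation[OF s close[OF t R(1)] close[OF t R(2)]] by (simp add: Hn_def A_def)
        then show "Hn t \<le> rate s t + e" using q by linarith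
      qed
      have 2: "w 0 (real (Suc k) * \<tau> n) - w 0 (real k * \<tau> n) \<le> \<tau> n * (Hn (real k * \<tau> n) + \<tau> n * L\<^sup>2)"
        if k: "real (Suc k) * \<tau> n \<le> T" for k
      proof -
        have kN: "k < N n" using k n.\<tau> by (simp add: n.less_N_iff algebra_simps)
        have next_step: "m n (real (Suc k) * \<tau> n) = exp_push (\<tau> n) (\<Psi> n k)"
          using n.within_step[OF kN, of "\<tau> n"] k n.\<tau> by (simp add: algebra_simps)
        have "(w s (real k * \<tau> n) - w 0 (real k * \<tau> n)) / s + (w 0 (real (Suc k) * \<tau> n) - w 0 (real k * \<tau> n)) / \<tau> n
          \<le> 2 * lam * w 0 (real k * \<tau> n) + s * (velocity_norm \<Phi>)\<^sup>2 + \<tau> n * (velocity_norm (\<Psi> n k))\<^sup>2"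
          using dissipative_split_inequality[OF n.F \<Phi> n.plan(1)[OF kN] s n.\<tau>]
          unfolding w_def next_step n.node[OF kN] n.plan(3)[OF kN] exp_push_0[OF \<Phi>_P2] .
        moreover have "\<tau> n * (velocity_norm (\<Psi> n k))\<^sup>2 \<le> \<tau> n * L\<^sup>2"
          using n.velocity_power2_le[OF kN] n.\<tau> by (intro mult_left_mono) auto
        ultimately have "(w 0 (real (Suc k) * \<tau> n) - w 0 (real k * \<tau> n)) / \<tau> n \<le> Hn (real k * \<tau> n) + \<tau> n * L\<^sup>2"
          unfolding Hn_def by linarith
        then show ?thesis using n.\<tau> by (simp only: pos_divide_le_eq mult.commute[of "\<tau> n"])
      qed
      show "\<exists>\<tau> un Hn. 0 < \<tau> \<and> \<tau> \<le> e \<and> (\<forall>t\<in>{0..T}. \<bar>un t - sqdist 0 t\<bar> \<le> e \<and> Hn t \<le> rate s t + e) \<and>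
        (\<forall>k::nat. real (Suc k) * \<tau> \<le> T \<longrightarrow> un (real (Suc k) * \<tau>) - un (real k * \<tau>) \<le> \<tau> * (Hn (real k * \<tau>) + \<tau> * L\<^sup>2))"
        using n(1) n.\<tau> 1 2 by (intro exI[of _ "\<tau> n"] exI[of _ "w 0"] exI[of _ Hn]) auto
    qed (simp_all only: zero_le_power2)
  qed
qed

lemma continuous_on_of_Lipschitz:
  fixes f :: "real \<Rightarrow> real"
  assumes "\<And>x y. x \<in> S \<Longrightarrow> y \<in> S \<Longrightarrow> \<bar>f x - f y\<bar> \<le> K * \<bar>x - y\<bar>" "K \<ge> 0"
  shows "continuous_on S f"
  by (rule lipschitz_on_continuous_on[of K]) (use assms in \<open>auto simp: lipschitz_on_def dist_real_def\<close>)

lemma continuous_sqdist: "continuous_on {0..T} (sqdist r)"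
  using sqdist_Lipschitz radius_nonneg[of r] L_pos T_pos
  by (intro continuous_on_of_Lipschitz[where K="L * (2 * radius r + L * T)"]) auto

lemma continuous_rate: "continuous_on {0..T} (rate s)"
  unfolding rate_def divide_inverse by (intro continuous_intros continuous_sqdist)

lemma approximate_EVI:
  assumes "s > 0" "test_function {0<..<T} \<phi>" "\<And>t. 0 \<le> \<phi> t"
  shows "- (LINT t:{0<..<T}|lebesgue. sqdist 0 t * deriv \<phi> t) \<le> (LINT t:{0<..<T}|lebesgue. rate s t * \<phi> t)"
proof -
  obtain K where "\<And>a b. 0 \<le> a \<Longrightarrow> a < b \<Longrightarrow> b \<le> T \<Longrightarrow> sqdist 0 b - sqdist 0 a \<le> (b - a) * (rate s a + K * (b - a))"
    by (rule local_inequality[OF assms(1)]) blast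
  then show ?thesis
    using assms(2,3) by (intro local_to_distributional[where K=K] T_pos continuous_sqdist continuous_rate)
qed

definition limit_rate :: "real \<Rightarrow> real" where
  "limit_rate t = 2 * lam * sqdist 0 t - 2 * pairing_meas \<Phi> (\<mu> t)"

lemma rate_tendsto:
  assumes t: "t \<in> {0..T}" shows "(\<lambda>n. rate (1 / real (Suc n)) t) \<longlonglongrightarrow> limit_rate t"
proof -
  have s: "(\<lambda>n. 1 / real (Suc n)) \<longlonglongrightarrow> 0" by (rule LIMSEQ_Suc[OF lim_const_over_n])
  then have "filterlim (\<lambda>n. 1 / real (Suc n)) (at_right 0) sequentially"
    unfolding filterlim_at by auto
  from filterlim_compose[OF pairing_meas_tendsto[OF \<Phi>_P2 \<mu>_P2[OF t]] this]
  have "(\<lambda>n. (sqdist (1 / real (Suc n)) t - sqdist 0 t) / (2 * (1 / real (Suc n)))) \<longlonglongrightarrow> pairing_meas \<Phi> (\<mu> t)"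
    unfolding sqdist_def exp_push_0[OF \<Phi>_P2] .
  then have "(\<lambda>n. 2 * lam * sqdist 0 t - 2 * ((sqdist (1 / real (Suc n)) t - sqdist 0 t) / (2 * (1 / real (Suc n)))) + 1 / real (Suc n) * (velocity_norm \<Phi>)\<^sup>2)
     \<longlonglongrightarrow> 2 * lam * sqdist 0 t - 2 * pairing_meas \<Phi> (\<mu> t) + 0 * (velocity_norm \<Phi>)\<^sup>2"
    by (intro tendsto_intros s)
  then show ?thesis by (simp add: rate_def limit_rate_def)
qed

lemma rate_bounded:
  obtains B where "\<And>s t. 0 < s \<Longrightarrow> s \<le> 1 \<Longrightarrow> t \<in> {0..T} \<Longrightarrow> \<bar>rate s t\<bar> \<le> B"
proof
  fix s t :: real assume s: "0 < s" "s \<le> 1" and t: "t \<in> {0..T}"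
  let ?a = "velocity_norm \<Phi>"
  have a: "?a \<ge> 0" by (rule velocity_norm_nonneg[OF \<Phi>_P2])
  have lip: "W2 (exp_push s \<Phi>) (exp_push 0 \<Phi>) \<le> s * ?a" using exp_push_Lipschitz[OF \<Phi>_P2, of s 0] s by simp
  have r: "W2 (exp_push 0 \<Phi>) (\<mu> t) \<le> radius 0" by (rule W2_le_radius[OF t])
  have "\<bar>sqdist s t - sqdist 0 t\<bar> \<le> s * ?a * (2 * W2 (exp_push 0 \<Phi>) (\<mu> t) + s * ?a)"
    unfolding sqdist_def by (intro W2_power2_diff_le exp_push_in_P2 \<Phi>_P2 \<mu>_P2 t lip)
  also have "\<dots> \<le> s * ?a * (2 * radius 0 + ?a)"
    using r s a by (intro mult_left_mono add_mono) (auto simp: mult_left_le_one_le)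
  finally have "\<bar>(sqdist s t - sqdist 0 t) / s\<bar> \<le> ?a * (2 * radius 0 + ?a)"
    using s by (simp add: abs_divide pos_divide_le_eq mult_ac)
  moreover have "\<bar>2 * lam * sqdist 0 t\<bar> \<le> 2 * \<bar>lam\<bar> * (radius 0)\<^sup>2"
    unfolding abs_mult using r by (intro mult_mono) (auto simp: sqdist_def intro: power_mono)
  moreover have "0 \<le> s * ?a\<^sup>2" "s * ?a\<^sup>2 \<le> ?a\<^sup>2" using s by (auto simp: mult_left_le_one_le)
  ultimately show "\<bar>rate s t\<bar> \<le> 2 * \<bar>lam\<bar> * (radius 0)\<^sup>2 + ?a * (2 * radius 0 + ?a) + ?a\<^sup>2"
    unfolding rate_def by linarith
qed

lemma limit_rate_measurable: "(\<lambda>t. limit_rate (clamp_to T t)) \<in> borel_measurable borel"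
proof (rule borel_measurable_LIMSEQ_metric)
  show "(\<lambda>t. rate (1 / real (Suc n)) (clamp_to T t)) \<in> borel_measurable borel" for n
    by (intro borel_measurable_continuous_onI continuous_on_clamp_to continuous_rate T_pos)
  show "(\<lambda>n. rate (1 / real (Suc n)) (clamp_to T t)) \<longlonglongrightarrow> limit_rate (clamp_to T t)" for t
    by (intro rate_tendsto clamp_to_in T_pos)
qed

lemma limit_rate_bounded:
  obtains B where "\<And>t. t \<in> {0..T} \<Longrightarrow> \<bar>limit_rate t\<bar> \<le> B"
proof -
  obtain B where B: "\<And>s t. 0 < s \<Longrightarrow> s \<le> 1 \<Longrightarrow> t \<in> {0..T} \<Longrightarrow> \<bar>rate s t\<bar> \<le> B" by (rule rate_bounded) blast
  have "\<bar>limit_rate t\<bar> \<le> B" if "t \<in> {0..T}" for t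
    by (rule tendsto_upperbound[OF tendsto_rabs[OF rate_tendsto[OF that]]]) (use B[OF _ _ that] in auto)
  then show ?thesis using that by blast
qed

text \<open>
  The rates are bounded uniformly for \<open>s \<le> 1\<close> and converge pointwise as \<open>s \<down> 0\<close>, so the inequality for
  fixed \<open>s\<close> passes to the limit. Being a pointwise limit of continuous functions, the limit rate is
  measurable although the pairing need not be continuous along the curve.
\<close>

lemma limit_EVI:
  assumes \<phi>: "test_function {0<..<T} \<phi>" and pos: "\<And>t. 0 \<le> \<phi> t"
  shows "- (LINT t:{0<..<T}|lebesgue. sqdist 0 t * deriv \<phi> t) \<le> (LINT t:{0<..<T}|lebesgue. limit_rate t * \<phi> t)"
proof -
  obtain \<alpha> \<beta> D where ab: "0 < \<alpha>" "\<beta> < T" and z: "\<And>t. t \<notin> {\<alpha>..\<beta>} \<Longrightarrow> \<phi> t = 0"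
    and D: "\<And>t. (\<phi> has_real_derivative D t) (at t)"
    by (rule test_function_on_interval[OF T_pos \<phi>]) blast
  have \<phi>c: "continuous_on UNIV \<phi>"
    by (intro continuous_at_imp_continuous_on ballI DERIV_isCont[OF D])
  note [measurable] = borel_measurable_continuous_onI[OF \<phi>c] limit_rate_measurable
  have [measurable]: "(\<lambda>t. rate s (clamp_to T t)) \<in> borel_measurable borel" for s
    by (intro borel_measurable_continuous_onI continuous_on_clamp_to continuous_rate T_pos)
  have z0: "\<phi> t = 0" if "t \<notin> {0<..<T}" for t using that ab by (intro z) auto
  have rhs: "(LINT t:{0<..<T}|lebesgue. rate s t * \<phi> t) = (\<integral>t. rate s (clamp_to T t) * \<phi> t \<partial>lborel)" for s
    by (rule set_integral_clamp_to[OF _ z0]) measurable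
  have rhs': "(LINT t:{0<..<T}|lebesgue. limit_rate t * \<phi> t) = (\<integral>t. limit_rate (clamp_to T t) * \<phi> t \<partial>lborel)"
    by (rule set_integral_clamp_to[OF _ z0]) measurable
  obtain B where B: "\<And>s t. 0 < s \<Longrightarrow> s \<le> 1 \<Longrightarrow> t \<in> {0..T} \<Longrightarrow> \<bar>rate s t\<bar> \<le> B" by (rule rate_bounded) blast
  have "(\<lambda>n. LINT t:{0<..<T}|lebesgue. rate (1 / real (Suc n)) t * \<phi> t) \<longlonglongrightarrow> (LINT t:{0<..<T}|lebesgue. limit_rate t * \<phi> t)"
    unfolding rhs rhs'
  proof (rule integral_dominated_convergence[where w="\<lambda>t. B * \<phi> t"])
    have "integrable lborel \<phi>" by (rule integrable_continuous_compact_support[OF \<phi>c z])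
    then show "integrable lborel (\<lambda>t. B * \<phi> t)" by simp
    show "AE t in lborel. (\<lambda>n. rate (1 / real (Suc n)) (clamp_to T t) * \<phi> t) \<longlonglongrightarrow> limit_rate (clamp_to T t) * \<phi> t"
      by (intro AE_I2 tendsto_intros rate_tendsto clamp_to_in T_pos)
    show "AE t in lborel. norm (rate (1 / real (Suc n)) (clamp_to T t) * \<phi> t) \<le> B * \<phi> t" for n
    proof (rule AE_I2)
      fix t
      have "\<bar>rate (1 / real (Suc n)) (clamp_to T t)\<bar> \<le> B" by (intro B clamp_to_in T_pos) auto
      then show "norm (rate (1 / real (Suc n)) (clamp_to T t) * \<phi> t) \<le> B * \<phi> t"
        using pos[of t] by (simp add: abs_mult mult_right_mono)
    qed
  qed measurable
  then show ?thesis
    by (rule tendsto_lowerbound) (use approximate_EVI[OF _ \<phi> pos] in auto)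
qed

lemma locally_integrable_bounded:
  assumes m: "(\<lambda>t. f (clamp_to T t)) \<in> borel_measurable borel" and B: "\<And>t. t \<in> {0..T} \<Longrightarrow> \<bar>f t\<bar> \<le> B"
  shows "locally_integrable {0<..<T} f"
  unfolding locally_integrable_def
proof (intro allI impI, elim conjE)
  fix S :: "real set" assume S: "compact S" "S \<subseteq> {0<..<T}"
  note m [measurable]
  have [measurable]: "S \<in> sets borel" using S(1) by (simp add: borel_compact)
  have "integrable lborel (\<lambda>t. B * indicator S t)"
    using emeasure_compact_finite[OF S(1)] by (intro integrable_mult_right integrable_real_indicator) auto
  then have "integrable lborel (\<lambda>t. indicator S t *\<^sub>R f (clamp_to T t))"
  proof (rule Bochner_Integration.integrable_bound)
    show "AE t in lborel. norm (indicator S t *\<^sub>R f (clamp_to T t)) \<le> norm (B * indicator S t)"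
    proof (rule AE_I2)
      fix t
      have "\<bar>f (clamp_to T t)\<bar> \<le> B" by (intro B clamp_to_in T_pos)
      then show "norm (indicator S t *\<^sub>R f (clamp_to T t)) \<le> norm (B * indicator S t)" by (auto simp: indicator_def)
    qed
  qed measurable
  then have "integrable lebesgue (\<lambda>t. indicator S t *\<^sub>R f (clamp_to T t))"
    by (subst integrable_completion) auto
  also have "(\<lambda>t. indicator S t *\<^sub>R f (clamp_to T t)) = (\<lambda>t. indicator S t *\<^sub>R f t)"
  proof
    fix t
    show "indicator S t *\<^sub>R f (clamp_to T t) = indicator S t *\<^sub>R f t"
      using S(2) clamp_to_inside[of t T] by (cases "t \<in> S") auto
  qed
  finally show "f absolutely_integrable_on S" by (simp add: set_integrable_def)
qed

text \<open>
  Half of \<open>limit_EVI\<close>, with the arguments of the distance interchanged.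
\<close>

lemma EVI_inequality:
  "distr_deriv_le {0<..<T} (\<lambda>t. 1 / 2 * (W2 (\<mu> t) (base \<Phi>))\<^sup>2)
     (\<lambda>t. lam * (W2 (\<mu> t) (base \<Phi>))\<^sup>2 - pairing_meas \<Phi> (\<mu> t))"
proof -
  have base: "base \<Phi> \<in> P2" by (rule base_in_P2[OF \<Phi>_P2])
  have sq: "(W2 (\<mu> t) (base \<Phi>))\<^sup>2 = sqdist 0 t" if "t \<in> {0..T}" for t
    using W2_commute[OF \<mu>_P2[OF that] base] by (simp add: sqdist_def exp_push_0 \<Phi>_P2)
  let ?u = "\<lambda>t. 1 / 2 * (W2 (\<mu> t) (base \<Phi>))\<^sup>2" and ?g = "\<lambda>t. lam * (W2 (\<mu> t) (base \<Phi>))\<^sup>2 - pairing_meas \<Phi> (\<mu> t)"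
  have u: "?u t = sqdist 0 t / 2" and g: "?g t = limit_rate t / 2" if "t \<in> {0..T}" for t
    using sq[OF that] by (auto simp: limit_rate_def)
  have "locally_integrable {0<..<T} ?u"
  proof (rule locally_integrable_bounded)
    have "(\<lambda>t. sqdist 0 (clamp_to T t) / 2) \<in> borel_measurable borel"
      by (intro borel_measurable_continuous_onI continuous_intros continuous_on_clamp_to continuous_sqdist T_pos) auto
    then show "(\<lambda>t. ?u (clamp_to T t)) \<in> borel_measurable borel"
      by (simp only: u clamp_to_in[OF T_pos])
    show "\<bar>?u t\<bar> \<le> (radius 0)\<^sup>2" if t: "t \<in> {0..T}" for t
    proof -
      have "sqdist 0 t \<le> (radius 0)\<^sup>2" unfolding sqdist_def using W2_le_radius[OF t] by (intro power_mono) auto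
      moreover have "0 \<le> sqdist 0 t" by (simp add: sqdist_def)
      ultimately show ?thesis unfolding u[OF t] by linarith
    qed
  qed
  moreover have "locally_integrable {0<..<T} ?g"
  proof -
    obtain B where B: "\<And>t. t \<in> {0..T} \<Longrightarrow> \<bar>limit_rate t\<bar> \<le> B" by (rule limit_rate_bounded) blast
    show ?thesis
    proof (rule locally_integrable_bounded)
      have "(\<lambda>t. limit_rate (clamp_to T t) / 2) \<in> borel_measurable borel"
        using limit_rate_measurable by measurable
      then show "(\<lambda>t. ?g (clamp_to T t)) \<in> borel_measurable borel"
        by (simp only: g clamp_to_in[OF T_pos])
      show "\<bar>?g t\<bar> \<le> B" if t: "t \<in> {0..T}" for t
        using B[OF t] unfolding g[OF t] by simp
    qed
  qed
  moreover have "- (LINT t:{0<..<T}|lebesgue. ?u t * deriv \<phi> t) \<le> (LINT t:{0<..<T}|lebesgue. ?g t * \<phi> t)"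
    if \<phi>: "test_function {0<..<T} \<phi>" "\<forall>t. 0 \<le> \<phi> t" for \<phi>
  proof -
    have sub: "t \<in> {0..T}" if "t \<in> {0<..<T}" for t using that by auto
    have "(LINT t:{0<..<T}|lebesgue. ?u t * deriv \<phi> t) = (LINT t:{0<..<T}|lebesgue. 1 / 2 * (sqdist 0 t * deriv \<phi> t))"
    proof (rule set_lebesgue_integral_cong)
      show "\<forall>t. t \<in> {0<..<T} \<longrightarrow> ?u t * deriv \<phi> t = 1 / 2 * (sqdist 0 t * deriv \<phi> t)"
        using u[OF sub] by simp
    qed simp
    moreover have "(LINT t:{0<..<T}|lebesgue. ?g t * \<phi> t) = (LINT t:{0<..<T}|lebesgue. 1 / 2 * (limit_rate t * \<phi> t))"
    proof (rule set_lebesgue_integral_cong)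
      show "\<forall>t. t \<in> {0<..<T} \<longrightarrow> ?g t * \<phi> t = 1 / 2 * (limit_rate t * \<phi> t)"
        using g[OF sub] by simp
    qed simp
    ultimately show ?thesis using limit_EVI[OF \<phi>(1)] \<phi>(2) by simp
  qed
  ultimately show ?thesis unfolding distr_deriv_le_def by blast
qed

end

theorem theorem7p7:
  fixes F :: "('a::{real_inner, polish_space} \<times> 'a) measure set"
    and lam T L :: real
    and \<tau> :: "nat \<Rightarrow> real"
    and \<mu>0n :: "nat \<Rightarrow> 'a measure" and \<mu>0 :: "'a measure"
    and M :: "nat \<Rightarrow> real \<Rightarrow> 'a measure"
  assumes "MPVF F" and "dissipative lam F"
    and "T > 0" and "L > 0"
    and "\<And>n. \<tau> n > 0" and "\<tau> \<longlonglongrightarrow> 0"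
    and "\<And>n. \<mu>0n n \<in> mpvf_dom F"
    and "\<mu>0 \<in> W2_closure (mpvf_dom F)"
    and "(\<lambda>n. W2 (\<mu>0n n) \<mu>0) \<longlonglongrightarrow> 0"
    and "\<And>n. M n \<in> Euler_curves F (\<mu>0n n) (\<tau> n) T L"
  shows "\<exists>\<mu>. (\<forall>e>0. \<forall>\<^sub>F n in sequentially. \<forall>t\<in>{0..T}. W2 (M n t) (\<mu> t) < e) \<and>
             \<mu> \<in> W2_Lip {0..T} (W2_closure (mpvf_dom F)) \<and>
             EVI_solution lam F {0..T} \<mu> \<and> \<mu> 0 = \<mu>0"
proof -
  have "\<forall>n. \<exists>N P \<Phi>. euler_curve F lam T L (\<tau> n) (M n) N P \<Phi> \<and> M n 0 = \<mu>0n n"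
    using euler_curve_of_Euler_curves[OF assms(1-5) assms(10)] by blast
  then obtain N P \<Phi> where curves: "\<And>n. euler_curve F lam T L (\<tau> n) (M n) (N n) (P n) (\<Phi> n)"
    and init: "\<And>n. M n 0 = \<mu>0n n" by metis
  have init0: "(\<lambda>n. W2 (M n 0) \<mu>0) \<longlonglongrightarrow> 0" using assms(9) by (simp add: init)
  obtain \<mu> where conv: "\<And>e. e > 0 \<Longrightarrow> \<forall>\<^sub>F n in sequentially. \<forall>t\<in>{0..T}. W2 (M n t) (\<mu> t) < e"
    and dom: "\<And>t. t \<in> {0..T} \<Longrightarrow> \<mu> t \<in> W2_closure (mpvf_dom F)"
    and Lip: "\<And>s t. s \<in> {0..T} \<Longrightarrow> t \<in> {0..T} \<Longrightarrow> W2 (\<mu> s) (\<mu> t) \<le> L * \<bar>s - t\<bar>"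
    and \<mu>0: "\<mu> 0 = \<mu>0"
    using euler_limit_curve[OF curves assms(6,8) init0] by blast
  have P2: "\<mu> t \<in> P2" if "t \<in> {0..T}" for t using dom[OF that] by (simp add: W2_closure_def)
  have "W2_continuous_on {0..T} \<mu>"
    unfolding W2_continuous_on_def
  proof
    fix t assume t: "t \<in> {0..T}"
    have "((\<lambda>s. L * \<bar>s - t\<bar>) \<longlongrightarrow> L * \<bar>t - t\<bar>) (at t within {0..T})" by (intro tendsto_intros)
    then have "((\<lambda>s. L * \<bar>s - t\<bar>) \<longlongrightarrow> 0) (at t within {0..T})" by simp
    then show "((\<lambda>s. W2 (\<mu> s) (\<mu> t)) \<longlongrightarrow> 0) (at t within {0..T})"
      by (rule tendsto_sandwich[OF _ _ tendsto_const, rotated 2]) (use Lip t in \<open>auto simp: eventually_at_filter\<close>)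
  qed
  moreover have "distr_deriv_le {0<..<T} (\<lambda>t. 1 / 2 * (W2 (\<mu> t) (base \<Psi>))\<^sup>2)
     (\<lambda>t. lam * (W2 (\<mu> t) (base \<Psi>))\<^sup>2 - pairing_meas \<Psi> (\<mu> t))" if "\<Psi> \<in> F" for \<Psi>
  proof -
    interpret euler_limit F lam T L \<tau> M N P \<Phi> \<mu> \<Psi>
      by (rule euler_limit.intro) (fact curves assms(6) conv P2 Lip that)+
    show ?thesis by (rule EVI_inequality)
  qed
  ultimately have "EVI_solution lam F {0..T} \<mu>"
    unfolding EVI_solution_def using dom by (auto simp: is_interval_cc)
  moreover have "\<mu> \<in> W2_Lip {0..T} (W2_closure (mpvf_dom F))"
    unfolding W2_Lip_def using dom Lip assms(4) by (auto intro!: exI[of _ L])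
  ultimately show ?thesis using conv \<mu>0 by blast
qed

end
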